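(* Let $b\ge 2$ be an integer, let $\alpha,\lambda>0$, let $X$ be a symmetric real random variable with $\mathbb{E}[X]=0$, $\mathbb{E}[X^2]=1$ and $\lim_{x\to\infty}x^{-\alpha}\log\mathbb{P}(X>x)=-\lambda$, and let $A\subset\mathbb{R}$, $A\notin\{\emptyset,\mathbb{R}\}$, be a finite union of $r_A\ge1$ pairwise disjoint intervals with endpoints $-\infty\le a_j<b_j\le\infty$. Let $\overline Z_n$ be the empirical distribution at generation $n$ of the branching random walk on the $b$-ary tree with displacement $X$, and let $Q_A:[0,1]\to[0,\infty]$ be the function defined in the context. Then $\{\overline Z_n(\sqrt n\,A)\}_{n\ge1}$ satisfies a full large-deviation principle on $[0,1]$ with speed $n^{\alpha/2}$ and good rate function $Q_A$. That is, $Q_A$ is lower semicontinuous with compact sublevel sets, and for every Borel set $\Gamma\subset[0,1]$, $$-\inf_{q\in\Gamma^\circ}Q_A(q)\le\liminf_{n\to\infty}n^{-\alpha/2}\log\mathbb{P}\big(\overline Z_n(\sqrt n\,A)\in\Gamma\big)\le\limsup_{n\to\infty}n^{-\alpha/2}\log\mathbb{P}\big(\overline Z_n(\sqrt n\,A)\in\Gamma\big)\le-\inf_{q\in\overline\Gamma}Q_A(q),$$ where $\Gamma^\circ$ and $\overline\Gamma$ are the interior and closure of $\Gamma$ in $[0,1]$. Moreover, whenever $Q_A(q)<\infty$, the infimum defining $Q_A(q)$ is attained.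
   Context: Branching random walk: $\mathbb{T}_b=\bigcup_{k\ge0}\{1,\dots,b\}^k$ is the rooted $b$-ary tree with root $\varnothing$; $|v|$ is the generation (length) of $v$; $v\preceq u$ means $v$ is an ancestor of $u$ or $v=u$ (prefix order), $v\prec u$ means strict ancestor. $(X_v)_{v\ne\varnothing}$ are i.i.d. copies of $X$; $S_\varnothing=0$, $S_u=\sum_{\varnothing\prec v\preceq u}X_v$; $Z_n=\sum_{|u|=n}\delta_{S_u}$ and $\overline Z_n=Z_n/Z_n(\mathbb{R})=b^{-n}Z_n$. $\sqrt n\,A=\{\sqrt n\,a:a\in A\}$. $\nu$ is the standard Gaussian measure on $\mathbb{R}$, and $g_A(x)=\nu(A-x)$ with $A-x=\{a-x:a\in A\}$. Tree space: $\mathcal{H}_b$ is the set of real fields $h=(h_v)_{v\in\mathbb{T}_b}$ with $h_\varnothing=0$ and $\|h\|_b:=\sum_{k\ge1}b^{-k}\sum_{|v|=k}|h_v|<\infty$. $\partial\mathbb{T}_b=\{1,\dots,b\}^{\{1,2,\dots\}}$ carries the product $\sigma$-algebra and the product measure $\mathbf{m}_b$ of uniform measures on $\{1,\dots,b\}$; for $\xi\in\partial\mathbb{T}_b$, $\xi|k\in\{1,\dots,b\}^k$ is the vector of its first $k$ coordinates. For $h\in\mathcal{H}_b$, $H_h(\xi)=\sum_{k\ge1}h_{\xi|k}$ (absolutely convergent for $\mathbf{m}_b$-a.e. $\xi$), $\Psi_A(h)=\int_{\partial\mathbb{T}_b}g_A(H_h(\xi))\,\mathbf{m}_b(d\xi)$,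 and $\mathcal{I}_\alpha(h)=\lambda\sum_{v\ne\varnothing}|h_v|^\alpha\in[0,\infty]$. Rate function: $Q_A(q)=\inf\{\mathcal{I}_\alpha(h):h\in\mathcal{H}_b,\ \Psi_A(h)=q\}$ for $q\in[0,1]$, with $\inf\emptyset=\infty$. Convention: $\log 0=-\infty$. *)

theory Defs
  imports "HOL-Probability.Probability" "HOL-Library.Sublist"
begin

section \<open>Extended logarithm and large deviation principles\<close>

definition elog :: "real \<Rightarrow> ereal" where
  "elog x = (if x \<le> 0 then -\<infinity> else ereal (ln x))"

definition lsc_on :: "'a::topological_space set \<Rightarrow> ('a \<Rightarrow> ennreal) \<Rightarrow> bool" where
  "lsc_on E I \<longleftrightarrow> (\<forall>c. openin (top_of_set E) {x \<in> E. c < I x})"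

definition good_rate_function_on :: "'a::topological_space set \<Rightarrow> ('a \<Rightarrow> ennreal) \<Rightarrow> bool" where
  "good_rate_function_on E I \<longleftrightarrow> lsc_on E I \<and> (\<forall>c::real. compact {x \<in> E. I x \<le> ennreal c})"

text \<open>
  The infima live in \<^typ>\<open>ennreal\<close>, so that an infimum over the empty set is \<^term>\<open>\<infinity>::ennreal\<close>.
\<close>

definition LDP_on ::
  "'a::topological_space set \<Rightarrow> 'w measure \<Rightarrow> (nat \<Rightarrow> 'w \<Rightarrow> 'a) \<Rightarrow> (nat \<Rightarrow> real) \<Rightarrow> ('a \<Rightarrow> ennreal) \<Rightarrow> bool" where
  "LDP_on E M Y s I \<longleftrightarrow>
    (\<forall>\<Gamma> \<in> sets borel. \<Gamma> \<subseteq> E \<longrightarrow>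
      (let r = (\<lambda>n. ereal (1 / s n) * elog (measure M {\<omega> \<in> space M. Y n \<omega> \<in> \<Gamma>}))
       in - enn2ereal (INF q \<in> top_of_set E interior_of \<Gamma>. I q) \<le> liminf r
          \<and> liminf r \<le> limsup r
          \<and> limsup r \<le> - enn2ereal (INF q \<in> top_of_set E closure_of \<Gamma>. I q)))"


section \<open>Branching random walk on the regular tree\<close>

definition tree :: "nat \<Rightarrow> nat list set" where
  "tree b = {v. set v \<subseteq> {1..b}}"

definition level :: "nat \<Rightarrow> nat \<Rightarrow> nat list set" where
  "level b n = {v \<in> tree b. length v = n}"

definition iid_copies ::
  "'w measure \<Rightarrow> 'i set \<Rightarrow> ('i \<Rightarrow> 'w \<Rightarrow> real) \<Rightarrow> 'x measure \<Rightarrow> ('x \<Rightarrow> real) \<Rightarrow> bool" where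
  "iid_copies M J Y N X \<longleftrightarrow>
     prob_space.indep_vars M (\<lambda>_. borel) Y J \<and> (\<forall>j\<in>J. distr M borel (Y j) = distr N borel X)"

definition position :: "(nat list \<Rightarrow> 'w \<Rightarrow> real) \<Rightarrow> nat list \<Rightarrow> 'w \<Rightarrow> real" where
  "position \<xi> u \<omega> = (\<Sum>v | strict_prefix [] v \<and> prefix v u. \<xi> v \<omega>)"

text \<open>\<open>brw_count b \<xi> n \<omega> B\<close> is the mass that the point measure \<open>\<Sum>|u|=n. \<delta>(S u)\<close> gives to \<open>B\<close>.\<close>

definition brw_count :: "nat \<Rightarrow> (nat list \<Rightarrow> 'w \<Rightarrow> real) \<Rightarrow> nat \<Rightarrow> 'w \<Rightarrow> real set \<Rightarrow> real" where
  "brw_count b \<xi> n \<omega> B = (\<Sum>u\<in>level b n. indicator B (position \<xi> u \<omega>))"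

definition brw_empirical :: "nat \<Rightarrow> (nat list \<Rightarrow> 'w \<Rightarrow> real) \<Rightarrow> nat \<Rightarrow> 'w \<Rightarrow> real set \<Rightarrow> real" where
  "brw_empirical b \<xi> n \<omega> B = brw_count b \<xi> n \<omega> B / brw_count b \<xi> n \<omega> UNIV"

text \<open>The interval may or may not contain each of its finite endpoints.\<close>

definition interval_with_endpoints :: "ereal \<Rightarrow> ereal \<Rightarrow> real set \<Rightarrow> bool" where
  "interval_with_endpoints l u J \<longleftrightarrow>
     {x. l < ereal x \<and> ereal x < u} \<subseteq> J \<and> J \<subseteq> {x. l \<le> ereal x \<and> ereal x \<le> u}"


section \<open>Tree fields and the rate function\<close>

definition gauss_shift :: "real set \<Rightarrow> real \<Rightarrow> real" where
  "gauss_shift A x = measure std_normal_distribution ((\<lambda>a. a - x) ` A)"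

definition field_norm :: "nat \<Rightarrow> (nat list \<Rightarrow> real) \<Rightarrow> ennreal" where
  "field_norm b h = (\<Sum>k. ennreal ((1 / real b) ^ Suc k * (\<Sum>v\<in>level b (Suc k). \<bar>h v\<bar>)))"

definition tree_fields :: "nat \<Rightarrow> (nat list \<Rightarrow> real) set" where
  "tree_fields b = {h \<in> extensional (tree b). h [] = 0 \<and> field_norm b h < \<infinity>}"

text \<open>Boundary points are functions on the index set \<open>{1..}\<close>, with values in \<open>{1..b}\<close>.\<close>

definition boundary_measure :: "nat \<Rightarrow> (nat \<Rightarrow> nat) measure" where
  "boundary_measure b = (\<Pi>\<^sub>M i\<in>{1..}. uniform_count_measure {1..b})"

definition ray_prefix :: "(nat \<Rightarrow> nat) \<Rightarrow> nat \<Rightarrow> nat list" where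
  "ray_prefix \<xi> k = map \<xi> [1..<Suc k]"

text \<open>On the null set of rays where the series diverges, \<open>ray_sum\<close> has an unspecified value.\<close>

definition ray_sum :: "(nat list \<Rightarrow> real) \<Rightarrow> (nat \<Rightarrow> nat) \<Rightarrow> real" where
  "ray_sum h \<xi> = (\<Sum>k. h (ray_prefix \<xi> (Suc k)))"

definition Psi :: "nat \<Rightarrow> real set \<Rightarrow> (nat list \<Rightarrow> real) \<Rightarrow> real" where
  "Psi b A h = (\<integral>\<xi>. gauss_shift A (ray_sum h \<xi>) \<partial>boundary_measure b)"

definition field_cost :: "nat \<Rightarrow> real \<Rightarrow> real \<Rightarrow> (nat list \<Rightarrow> real) \<Rightarrow> ennreal" where
  "field_cost b \<alpha> lam h = ennreal lam * (\<Sum>\<^sub>\<infinity>v\<in>tree b - {[]}. ennreal (\<bar>h v\<bar> powr \<alpha>))"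

definition rate_Q :: "nat \<Rightarrow> real \<Rightarrow> real \<Rightarrow> real set \<Rightarrow> real \<Rightarrow> ennreal" where
  "rate_Q b \<alpha> lam A q = (INF h \<in> {h \<in> tree_fields b. Psi b A h = q}. field_cost b \<alpha> lam h)"

end

theory Submission
  imports Defs "HOL-Real_Asymp.Real_Asymp"
begin

text \<open>
  Condition on the displacements of the first \<open>L\<close> generations, where \<open>b ^ L\<close> is slightly larger than
  the speed \<open>n powr (\<alpha> / 2)\<close>. The empirical mass is then an average of \<open>b ^ L\<close> independent \<open>[0,1]\<close>-valued
  variables, so by Hoeffding it is superexponentially close to its conditional mean, which by the
  central limit theorem (uniform over finite unions of intervals) is close to \<open>Psi\<close> of the field of
  rescaled displacements cut at level \<open>L\<close>. Exponential moments of the energy discounted by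
  \<open>b powr (- \<gamma> * length v)\<close> show that only finitely many generations \<open>K\<close> of this field matter. For
  these finitely many independent displacements the upper bound is Chernoff's inequality for
  \<open>\<Sum> \<bar>\<xi> v\<bar> powr \<alpha>\<close> and the lower bound is the product of one-dimensional estimates. The functional
  \<open>Psi\<close> is continuous on sublevel sets of the cost, which are compact in the product topology; this
  turns the two bounds into the large deviation principle and gives attainment of the infimum.
\<close>

section \<open>Intervals and the Gaussian law\<close>

text \<open>The cut level is pulled two ways. Hoeffding's bound needs \<open>b ^ L\<close> well
  above the speed, but the first \<open>L\<close> generations carry at least \<open>b ^ L\<close>
  displacements, so the exponential moment of their plain energy is of order
  \<open>exp (const * b ^ L)\<close>, which no multiple of the speed in the exponent can beat.
  Discounting generation k by \<open>b powr (- \<gamma> * k)\<close> lowers the total weight to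
  about \<open>(b ^ L) powr (1 - \<gamma>)\<close>. With \<open>b ^ L\<close> close to
  \<open>n powr (\<alpha> / 2 * (1 + \<gamma>))\<close> this is
  \<open>n powr (\<alpha> / 2 * (1 - \<gamma>^2))\<close> up to a logarithm, hence below the speed.
  The discount is affordable because the effect of a generation on \<open>Psi\<close> is controlled
  by its mean absolute value, and by \<open>sum_mean_powr_le\<close> the \<alpha>-th power of that
  mean is at most \<open>b powr (- min 1 \<alpha> * k)\<close> times the energy of generation k. Any
  \<gamma> < min 1 \<alpha> therefore leaves geometric decay in k; \<open>discount\<close> is half
  of that threshold.\<close>

definition lower_set :: "real set \<Rightarrow> bool" where
  "lower_set D \<longleftrightarrow> (\<forall>x\<in>D. \<forall>y\<le>x. y \<in> D)"

lemma lower_set_cases: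
  assumes "lower_set D"
  obtains "D = {}" | "D = UNIV" | a where "D = {..a}" | a where "D = {..<a}"
proof (cases "D = {} \<or> D = UNIV")
  case True
  then show ?thesis by (elim disjE) (fact that(1), fact that(2))
next
  case False
  then obtain x y where x: "x \<in> D" and y: "y \<notin> D" by auto
  have yub: "z < y" if "z \<in> D" for z
    using assms that y unfolding lower_set_def by (meson not_less)
  have bdd: "bdd_above D" using yub by (meson bdd_above.I less_imp_le)
  have less: "z \<in> D" if z: "z < Sup D" for z
  proof -
    obtain w where "w \<in> D" "z < w" using less_cSupD[OF _ z] x by auto
    then show ?thesis using assms unfolding lower_set_def by auto
  qed
  have le: "z \<le> Sup D" if "z \<in> D" for z
    using cSup_upper[OF that bdd] .
  show ?thesis
  proof (cases "Sup D \<in> D")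
    case True
    have "D = {..Sup D}"
    proof (intro set_eqI iffI)
      fix z assume "z \<in> {..Sup D}"
      then show "z \<in> D" using less[of z] True by (cases "z = Sup D") auto
    qed (use le in simp)
    then show ?thesis by (rule that(3))
  next
    case False
    have "D = {..<Sup D}"
    proof (intro set_eqI iffI)
      fix z assume "z \<in> D"
      then show "z \<in> {..<Sup D}" using le[of z] False by (cases "z = Sup D") auto
    qed (use less in simp)
    then show ?thesis by (rule that(4))
  qed
qed

lemma lower_set_borel:
  assumes "lower_set D"
  shows "D \<in> sets borel"
  using assms by (cases D rule: lower_set_cases) simp_all

text \<open>\<open>U\<close> collects the points below some point of \<open>J\<close>, and
  \<open>V\<close> those of them that lie strictly below all of \<open>J\<close>. Measures of
  intervals thus become differences of two values of cdf type, whichever endpoints belong to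
  \<open>J\<close>.\<close>

lemma interval_eq_lower_set_diff:
  fixes J :: "real set"
  assumes "is_interval J"
  obtains U V where "lower_set U" "lower_set V" "V \<subseteq> U" "J = U - V"
proof
  \<comment> \<open>The second factor of \<open>?V\<close> matters for empty \<open>J\<close>, where
    the first one is the whole line and \<open>V \<subseteq> U\<close> would fail.\<close>
  let ?U = "{x. \<exists>y\<in>J. x \<le> y}" and ?V = "{x. \<forall>y\<in>J. x < y} \<inter> {x. \<exists>y\<in>J. x \<le> y}"
  show "lower_set ?U"
    unfolding lower_set_def Ball_def mem_Collect_eq by (meson order_trans)
  show "lower_set ?V"
    unfolding lower_set_def Ball_def Int_iff mem_Collect_eq by (meson order_trans le_less_trans)
  show "?V \<subseteq> ?U" by (rule Int_lower2)
  show "J = ?U - ?V"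
  proof (intro set_eqI iffI)
    fix x assume "x \<in> ?U - ?V"
    then obtain y z where "y \<in> J" "x \<le> y" "z \<in> J" "z \<le> x" by (auto simp: not_less)
    then show "x \<in> J" using assms unfolding is_interval_1 by blast
  qed auto
qed

lemma interval_with_endpoints_is_interval:
  assumes "interval_with_endpoints l u J"
  shows "is_interval J"
  unfolding is_interval_1
proof (intro ballI allI impI)
  fix a b x assume ab: "a \<in> J" "b \<in> J" and "a \<le> x \<and> x \<le> b"
  then consider "x = a" | "x = b" | "a < x" "x < b" by linarith
  then show "x \<in> J"
  proof cases
    case 3
    have "l \<le> ereal a" "ereal b \<le> u"
      using assms ab unfolding interval_with_endpoints_def by auto
    with 3 have "l < ereal x" "ereal x < u"
      by (meson le_less_trans less_le_trans less_ereal.simps(1))+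
    then show ?thesis using assms unfolding interval_with_endpoints_def by auto
  qed (use ab in auto)
qed

lemma measure_lower_set_diff_le:
  assumes M1: "real_distribution M1" and M2: "real_distribution M2"
    and e: "\<And>t. \<bar>cdf M1 t - cdf M2 t\<bar> \<le> e" and D: "lower_set D"
  shows "\<bar>measure M1 D - measure M2 D\<bar> \<le> e"
proof -
  interpret M1: real_distribution M1 by fact
  interpret M2: real_distribution M2 by fact
  have e0: "0 \<le> e" using e[of 0] by linarith
  from D show ?thesis
  proof (cases rule: lower_set_cases)
    case 2
    then show ?thesis using e0 M1.prob_space M2.prob_space by simp
  next
    case (3 a)
    then show ?thesis using e[of a] by (simp add: cdf_def)
  next
    case (4 a)
    \<comment> \<open>The measure of an open half line is a left limit of cdf values, so a bound
      valid at every t survives.\<close>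
    have "((\<lambda>t. \<bar>cdf M1 t - cdf M2 t\<bar>) \<longlongrightarrow> \<bar>measure M1 {..<a} - measure M2 {..<a}\<bar>) (at_left a)"
      by (intro tendsto_intros M1.cdf_at_left M2.cdf_at_left)
    then have "\<bar>measure M1 {..<a} - measure M2 {..<a}\<bar> \<le> e"
      by (rule tendsto_upperbound) (auto simp: e)
    then show ?thesis using 4 by simp
  qed (use e0 in auto)
qed

lemma measure_interval_diff_le:
  assumes M1: "real_distribution M1" and M2: "real_distribution M2"
    and e: "\<And>t. \<bar>cdf M1 t - cdf M2 t\<bar> \<le> e" and J: "is_interval J"
  shows "\<bar>measure M1 J - measure M2 J\<bar> \<le> 2 * e"
proof -
  interpret M1: real_distribution M1 by fact
  interpret M2: real_distribution M2 by fact
  obtain U V where UV: "lower_set U" "lower_set V" "V \<subseteq> U" "J = U - V"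
    using interval_eq_lower_set_diff[OF J] by blast
  have "measure M1 J = measure M1 U - measure M1 V" "measure M2 J = measure M2 U - measure M2 V"
    using UV by (auto intro!: M1.finite_measure_Diff M2.finite_measure_Diff simp: lower_set_borel)
  then show ?thesis
    using measure_lower_set_diff_le[OF M1 M2 e UV(1)] measure_lower_set_diff_le[OF M1 M2 e UV(2)]
    by linarith
qed

text \<open>Endpoints are forgotten; only the number \<open>r\<close> of intervals is kept, because
  it enters the constants \<open>2 * real r\<close> of all later estimates.\<close>

definition interval_union :: "nat \<Rightarrow> real set \<Rightarrow> bool" where
  "interval_union r A \<longleftrightarrow> (\<exists>J. A = (\<Union>j<r. J j) \<and> disjoint_family_on J {..<r} \<and> (\<forall>j<r. is_interval (J j)))"

lemma is_interval_borel: "is_interval J \<Longrightarrow> J \<in> sets (borel :: real measure)"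
  by (metis interval_eq_lower_set_diff lower_set_borel sets.Diff)

lemma interval_union_borel: "interval_union r A \<Longrightarrow> A \<in> sets borel"
  unfolding interval_union_def by (metis finite_lessThan is_interval_borel lessThan_iff sets.finite_UN)

lemma measure_interval_union_diff_le:
  assumes M1: "real_distribution M1" and M2: "real_distribution M2"
    and e: "\<And>t. \<bar>cdf M1 t - cdf M2 t\<bar> \<le> e" and A: "interval_union r A"
  shows "\<bar>measure M1 A - measure M2 A\<bar> \<le> 2 * real r * e"
proof -
  interpret M1: real_distribution M1 by fact
  interpret M2: real_distribution M2 by fact
  obtain J where J: "A = (\<Union>j<r. J j)" "disjoint_family_on J {..<r}" "\<And>j. j < r \<Longrightarrow> is_interval (J j)"
    using A unfolding interval_union_def by blast
  have "measure M1 A = (\<Sum>j<r. measure M1 (J j))" "measure M2 A = (\<Sum>j<r. measure M2 (J j))"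
    unfolding J(1) using J(2,3)
    by (auto intro!: M1.finite_measure_finite_Union M2.finite_measure_finite_Union simp: is_interval_borel)
  then have "\<bar>measure M1 A - measure M2 A\<bar> \<le> (\<Sum>j<r. \<bar>measure M1 (J j) - measure M2 (J j)\<bar>)"
    by (simp add: sum_subtractf[symmetric])
  also have "\<dots> \<le> (\<Sum>j<r. 2 * e)"
    by (intro sum_mono measure_interval_diff_le[OF M1 M2 e]) (use J in auto)
  finally show ?thesis by simp
qed

section \<open>The standard Gaussian law and its shifts\<close>

lemma real_distribution_std_normal: "real_distribution std_normal_distribution"
  by (simp add: real_distribution_def prob_space_normal_density real_distribution_axioms_def)

text \<open>The density is bounded by \<open>1 / sqrt (2 * pi)\<close>, which is below 1.\<close>

lemma cdf_std_normal_lipschitz: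
  "\<bar>cdf std_normal_distribution s - cdf std_normal_distribution t\<bar> \<le> \<bar>s - t\<bar>"
proof -
  interpret real_distribution std_normal_distribution by (rule real_distribution_std_normal)
  have *: "cdf std_normal_distribution t - cdf std_normal_distribution s \<le> t - s" if "s < t" for s t
  proof -
    have sq: "sqrt (2 * pi) \<ge> 1" using pi_gt3 by simp
    have dens: "normal_density 0 1 x \<le> 1" for x
    proof -
      have "normal_density 0 1 x = 1 / sqrt (2 * pi) * exp (- (x\<^sup>2 / 2))"
        by (simp add: normal_density_def)
      also have "\<dots> \<le> 1 * 1"
        using sq by (intro mult_mono) (auto simp: divide_le_eq_1)
      finally show ?thesis by simp
    qed
    have "emeasure std_normal_distribution {s<..t}
        = (\<integral>\<^sup>+x. ennreal (normal_density 0 1 x) * indicator {s<..t} x \<partial>lborel)"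
      by (subst emeasure_density) auto
    also have "\<dots> \<le> (\<integral>\<^sup>+x. indicator {s<..t} x \<partial>lborel)"
      using dens by (intro nn_integral_mono) (auto simp: indicator_def)
    also have "\<dots> = ennreal (t - s)" using that by simp
    finally have "measure std_normal_distribution {s<..t} \<le> t - s"
      using that by (simp add: emeasure_eq_measure)
    then show ?thesis using cdf_diff_eq[OF that] by simp
  qed
  show ?thesis
  proof (cases s t rule: linorder_cases)
    case less
    then show ?thesis using *[OF less] cdf_nondecreasing[of s t] by linarith
  next
    case greater
    then show ?thesis using *[OF greater] cdf_nondecreasing[of t s] by linarith
  qed simp
qed

lemma isCont_cdf_std_normal: "isCont (cdf std_normal_distribution) t"
proof -
  have "((\<lambda>s. cdf std_normal_distribution s - cdf std_normal_distribution t) \<longlongrightarrow> 0) (at t)"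
  proof (rule Lim_null_comparison)
    show "\<forall>\<^sub>F s in at t. norm (cdf std_normal_distribution s - cdf std_normal_distribution t) \<le> \<bar>s - t\<bar>"
      using cdf_std_normal_lipschitz by simp
    show "((\<lambda>s. \<bar>s - t\<bar>) \<longlongrightarrow> 0) (at t)"
      by (rule tendsto_eq_intros refl | simp)+
  qed
  then show ?thesis by (simp add: isCont_def LIM_zero_iff)
qed

lemma cdf_shift:
  assumes "sets M = sets borel"
  shows "cdf (distr M borel (\<lambda>z. z + x)) t = cdf M (t - x)"
proof -
  have sp: "space M = UNIV" using sets_eq_imp_space_eq[OF assms] by simp
  have "(\<lambda>z. z + x) -` {..t} = {..t - x}" by auto
  then show ?thesis unfolding cdf_def
    by (subst measure_distr) (auto simp: measurable_cong_sets[OF assms refl] sp)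
qed

text \<open>Moving the shift from the set to the law keeps \<open>A\<close> fixed, so that
  \<open>measure_interval_union_diff_le\<close> can compare two shifts, or a shift with the law of a
  random walk.\<close>

lemma gauss_shift_eq_distr:
  assumes "A \<in> sets borel"
  shows "gauss_shift A x = measure (distr std_normal_distribution borel (\<lambda>z. z + x)) A"
proof -
  have "(\<lambda>a. a - x) ` A = (\<lambda>z. z + x) -` A" by (auto simp: image_iff) (metis add_diff_cancel)
  then show ?thesis unfolding gauss_shift_def using assms
    by (subst measure_distr) auto
qed

lemma real_distribution_shift:
  "real_distribution (distr std_normal_distribution borel (\<lambda>z. z + x))"
  by (intro prob_space.real_distribution_distr prob_space_normal_density) auto

text \<open>Each of the \<open>r\<close> intervals has two ends, and shifting the Gaussian law
  changes its cdf by at most the size of the shift.\<close>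

lemma gauss_shift_lipschitz:
  assumes A: "interval_union r A"
  shows "\<bar>gauss_shift A x - gauss_shift A y\<bar> \<le> 2 * real r * \<bar>x - y\<bar>"
  unfolding gauss_shift_eq_distr[OF interval_union_borel[OF A]]
proof (rule measure_interval_union_diff_le[OF real_distribution_shift real_distribution_shift _ A])
  fix t show "\<bar>cdf (distr std_normal_distribution borel (\<lambda>z. z + x)) t -
         cdf (distr std_normal_distribution borel (\<lambda>z. z + y)) t\<bar> \<le> \<bar>x - y\<bar>"
    using cdf_std_normal_lipschitz[of "t - x" "t - y"] by (simp add: cdf_shift)
qed

lemma gauss_shift_bounds: "0 \<le> gauss_shift A x" "gauss_shift A x \<le> 1"
  unfolding gauss_shift_def
  using prob_space.prob_le_1[OF prob_space_normal_density[of 1 0]] by auto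

lemma gauss_shift_continuous:
  assumes A: "interval_union r A"
  shows "continuous_on UNIV (gauss_shift A)"
proof (rule continuous_onI)
  fix x e :: real assume "e > 0"
  show "\<exists>d>0. \<forall>x'\<in>UNIV. dist x' x < d \<longrightarrow> dist (gauss_shift A x') (gauss_shift A x) \<le> e"
  proof (intro exI[of _ "e / (2 * real r + 1)"] conjI ballI impI)
    fix y assume "dist y x < e / (2 * real r + 1)"
    then have "(2 * real r + 1) * \<bar>y - x\<bar> \<le> e"
      by (subst (asm) pos_less_divide_eq) (auto simp: dist_real_def mult.commute)
    moreover have "2 * real r * \<bar>y - x\<bar> \<le> (2 * real r + 1) * \<bar>y - x\<bar>"
      by (intro mult_right_mono) auto
    ultimately show "dist (gauss_shift A y) (gauss_shift A x) \<le> e"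
      using gauss_shift_lipschitz[OF A, of y x] by (simp add: dist_real_def)
  qed (use \<open>e > 0\<close> in auto)
qed

lemma gauss_shift_measurable: "interval_union r A \<Longrightarrow> gauss_shift A \<in> borel_measurable borel"
  by (rule borel_measurable_continuous_onI[OF gauss_shift_continuous])

text \<open>Polya's theorem: the grid consists of quantiles of the continuous limit law.\<close>

lemma cdf_convergence_uniform:
  fixes F :: "nat \<Rightarrow> real \<Rightarrow> real"
  assumes G: "real_distribution G" and cont: "\<And>t. isCont (cdf G) t"
    and mono: "\<And>n. mono (F n)" and bounds: "\<And>n t. 0 \<le> F n t" "\<And>n t. F n t \<le> 1"
    and conv: "\<And>t. (\<lambda>n. F n t) \<longlonglongrightarrow> cdf G t" and e: "e > 0"
  shows "\<forall>\<^sub>F n in sequentially. \<forall>t. \<bar>F n t - cdf G t\<bar> \<le> e"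
proof -
  interpret G: real_distribution G by fact
  \<comment> \<open>The grid consists of the quantiles of order k / N. Two grid cells cost
    \<open>2 / real N\<close>, at most e / 2; the other half of e is for the error at the grid
    points.\<close>
  obtain N :: nat where N: "4 / e < real N" using reals_Archimedean2 by blast
  then have N0: "N > 0" using e by (cases N) (auto simp: field_simps)
  have Ne: "2 / real N \<le> e / 2" using N N0 e by (simp add: field_simps)
  have "\<exists>t. cdf G t = real k / real N" if k: "k \<in> {1..<N}" for k
  proof -
    have "\<forall>\<^sub>F t in at_bot. cdf G t < real k / real N"
      using G.cdf_lim_at_bot k N0 by (intro order_tendstoD) auto
    then obtain a where a: "\<And>t. t \<le> a \<Longrightarrow> cdf G t < real k / real N"
      unfolding eventually_at_bot_linorder by auto
    have "\<forall>\<^sub>F t in at_top. cdf G t > real k / real N"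
      using G.cdf_lim_at_top_prob k N0 by (intro order_tendstoD) auto
    then obtain b where b: "\<And>t. t \<ge> b \<Longrightarrow> cdf G t > real k / real N"
      unfolding eventually_at_top_linorder by auto
    have "a \<le> b" using a[of a] b[of a] by (meson less_asym not_le less_imp_le)
    then have "\<exists>t\<ge>a. t \<le> b \<and> cdf G t = real k / real N"
      using a[of a] b[of b] cont by (intro IVT) (auto intro: less_imp_le)
    then show ?thesis by blast
  qed
  then obtain q where q: "\<And>k. k \<in> {1..<N} \<Longrightarrow> cdf G (q k) = real k / real N" by metis
  have "\<forall>\<^sub>F n in sequentially. \<bar>F n (q k) - cdf G (q k)\<bar> < e / 2" for k
    using tendstoD[OF conv[of "q k"], of "e/2"] e by (simp add: dist_real_def)
  then have "\<forall>\<^sub>F n in sequentially. \<forall>k\<in>{1..<N}. \<bar>F n (q k) - cdf G (q k)\<bar> < e / 2"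
    by (intro eventually_ball_finite) auto
  then show ?thesis
  proof eventually_elim
    case (elim n)
    show ?case
    proof
      fix t
      define k where "k = nat \<lfloor>real N * cdf G t\<rfloor>"
      have g: "0 \<le> cdf G t" "cdf G t \<le> 1" using G.cdf_nonneg G.cdf_bounded_prob by auto
      have "real k = of_int \<lfloor>real N * cdf G t\<rfloor>" unfolding k_def using g by simp
      then have k: "real k \<le> real N * cdf G t" "real N * cdf G t < real k + 1" by linarith+
      have N1: "1 / real N > 0" "2 / real N = 1 / real N + 1 / real N" using N0 by auto
      have kN: "real k / real N \<le> cdf G t" "cdf G t < real k / real N + 1 / real N"
        using k N0 by (auto simp: field_simps)
      \<comment> \<open>The cdf may be flat, so \<open>q k \<le> t\<close> need not hold when
        \<open>cdf G t\<close> equals k / N. The quantile \<open>q (k - 1)\<close> has a strictly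
        smaller cdf value and hence lies to the left of t. To the right, \<open>q (k + 1)\<close>
        already has a strictly larger value. Where these quantiles leave the grid, the bounds 0 and
        1 on \<open>F n\<close> suffice.\<close>
      have lower: "cdf G t - e \<le> F n t"
      proof (cases "k < 2")
        case True
        then have "(real k + 1) / real N \<le> 2 / real N" by (intro divide_right_mono) auto
        then show ?thesis using kN Ne bounds(1)[of n t] e by (simp add: add_divide_distrib)
      next
        case False
        have "real k \<le> real N" using k(1) g N0 mult_left_mono[OF g(2), of "real N"] by linarith
        then have mem: "k - 1 \<in> {1..<N}" using False by auto
        have qk: "cdf G (q (k - 1)) = real k / real N - 1 / real N"
          using q[OF mem] False by (simp add: of_nat_diff diff_divide_distrib)
        then have "cdf G (q (k - 1)) < cdf G t" using kN N1 by linarith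
        then have "q (k - 1) \<le> t" using G.cdf_nondecreasing by (meson not_le less_imp_le)
        then have "F n (q (k - 1)) \<le> F n t" using mono by (auto simp: mono_def)
        moreover have "cdf G t - cdf G (q (k - 1)) \<le> 2 / real N"
          using kN N1 unfolding qk by linarith
        moreover have "\<bar>F n (q (k - 1)) - cdf G (q (k - 1))\<bar> < e / 2" using elim mem by blast
        ultimately show ?thesis using Ne by linarith
      qed
      have upper: "F n t \<le> cdf G t + e"
      proof (cases "k + 1 < N")
        case False
        then have "real k / real N \<ge> (real N - 1) / real N" by (intro divide_right_mono) auto
        then have "cdf G t \<ge> 1 - 1 / real N" using kN N0 by (simp add: diff_divide_distrib)
        then show ?thesis using Ne N1 bounds(2)[of n t] e by linarith
      next
        case True
        then have mem: "k + 1 \<in> {1..<N}" by auto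
        have qk: "cdf G (q (k + 1)) = real k / real N + 1 / real N"
          using q[OF mem] by (simp add: add_divide_distrib)
        then have "cdf G t < cdf G (q (k + 1))" using kN by simp
        then have "t \<le> q (k + 1)" using G.cdf_nondecreasing by (meson not_le less_imp_le)
        then have "F n t \<le> F n (q (k + 1))" using mono by (auto simp: mono_def)
        moreover have "cdf G (q (k + 1)) - cdf G t \<le> 1 / real N"
          using kN unfolding qk by linarith
        moreover have "\<bar>F n (q (k + 1)) - cdf G (q (k + 1))\<bar> < e / 2" using elim mem by blast
        ultimately show ?thesis using Ne N1 e by linarith
      qed
      show "\<bar>F n t - cdf G t\<bar> \<le> e" using lower upper by linarith
    qed
  qed
qed


section \<open>Fields on the regular tree\<close>

text \<open>For \<alpha> at least 1 this is Jensen's inequality with gain 1 / card S; for smaller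
  \<alpha> it is subadditivity of the power, and the gain is only
  \<open>card S powr (- \<alpha>)\<close>. Over a whole generation this gain beats the
  discount.\<close>

lemma sum_mean_powr_le:
  fixes a :: "'i \<Rightarrow> real"
  assumes S: "finite S" "S \<noteq> {}" and a: "\<And>i. i \<in> S \<Longrightarrow> 0 \<le> a i" and \<alpha>: "\<alpha> > 0"
  shows "((\<Sum>i\<in>S. a i) / card S) powr \<alpha> \<le> real (card S) powr (- min 1 \<alpha>) * (\<Sum>i\<in>S. a i powr \<alpha>)"
proof -
  have N: "real (card S) > 0" using S by (simp add: card_gt_0_iff)
  define s where "s = (\<Sum>i\<in>S. a i)"
  have s0: "s \<ge> 0" unfolding s_def using a by (rule sum_nonneg)
  have nn: "0 \<le> (\<Sum>i\<in>S. a i powr \<alpha>)" by (intro sum_nonneg) auto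
  show ?thesis
  proof (cases "s = 0")
    case True
    then show ?thesis using nn \<alpha> unfolding s_def by simp
  next
    case False
    then have s: "s > 0" using s0 by simp
    show ?thesis
    proof (cases "\<alpha> \<ge> 1")
      case True
      \<comment> \<open>Jensen is applied to the positive entries. Returning from
        \<open>card P\<close> to the larger \<open>card S\<close> is harmless because the exponent
        \<open>1 - \<alpha>\<close> is at most 0.\<close>
      define P where "P = {i\<in>S. a i > 0}"
      have P: "finite P" "P \<subseteq> S" using S unfolding P_def by auto
      have sP: "s = (\<Sum>i\<in>P. a i)" unfolding s_def P_def
        by (rule sum.mono_neutral_right) (use S a in \<open>auto simp: not_less intro: antisym\<close>)
      have "P \<noteq> {}" using s sP by auto
      then have n: "real (card P) > 0" using P by (simp add: card_gt_0_iff)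
      have "(\<Sum>i\<in>P. (1 / card P) *\<^sub>R a i) powr \<alpha> \<le> (\<Sum>i\<in>P. (1 / card P) * a i powr \<alpha>)"
        using powr_convex[OF True]
        by (rule convex_on_sum[OF P(1) \<open>P \<noteq> {}\<close>]) (use n in \<open>auto simp: P_def\<close>)
      then have "(s / card P) powr \<alpha> \<le> (\<Sum>i\<in>P. a i powr \<alpha>) / card P"
        by (simp add: sP sum_divide_distrib flip: sum_distrib_left)
      also have "\<dots> \<le> (\<Sum>i\<in>S. a i powr \<alpha>) / card P"
        by (intro divide_right_mono sum_mono2) (use S P in auto)
      finally have "card P * ((s / card P) powr \<alpha>) \<le> (\<Sum>i\<in>S. a i powr \<alpha>)"
        using n by (simp add: field_simps)
      moreover have "card P * ((s / card P) powr \<alpha>) = s powr \<alpha> * real (card P) powr (1 - \<alpha>)"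
        using n s by (simp add: powr_divide powr_diff)
      moreover have "real (card S) powr (1 - \<alpha>) \<le> real (card P) powr (1 - \<alpha>)"
        using True n P S by (intro powr_mono2') (auto intro: card_mono)
      ultimately have *: "s powr \<alpha> * real (card S) powr (1 - \<alpha>) \<le> (\<Sum>i\<in>S. a i powr \<alpha>)"
        by (smt (verit) mult_left_mono powr_ge_zero)
      have "(s / card S) powr \<alpha> = real (card S) powr (- 1) * (s powr \<alpha> * real (card S) powr (1 - \<alpha>))"
        using N s by (simp add: powr_divide powr_diff powr_minus field_simps)
      also have "\<dots> \<le> real (card S) powr (- 1) * (\<Sum>i\<in>S. a i powr \<alpha>)"
        by (intro mult_left_mono *) auto
      finally show ?thesis using True unfolding s_def by (simp add: min_def)
    next
      case False
      \<comment> \<open>The normalised entries lie in [0,1], where a power with exponent below 1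
        dominates the identity.\<close>
      have "1 = (\<Sum>i\<in>S. a i / s)" using s by (simp add: s_def flip: sum_divide_distrib)
      also have "\<dots> \<le> (\<Sum>i\<in>S. (a i / s) powr \<alpha>)"
      proof (rule sum_mono)
        fix i assume i: "i \<in> S"
        have "a i \<le> s" unfolding s_def using S a i by (intro member_le_sum) auto
        then have "(a i / s) powr 1 \<le> (a i / s) powr \<alpha>"
          using a[OF i] s False by (intro powr_mono') auto
        then show "a i / s \<le> (a i / s) powr \<alpha>" using a[OF i] s by simp
      qed
      also have "\<dots> = (\<Sum>i\<in>S. a i powr \<alpha>) / s powr \<alpha>"
        using a s by (simp add: powr_divide sum_divide_distrib)
      finally have *: "s powr \<alpha> \<le> (\<Sum>i\<in>S. a i powr \<alpha>)" using s by (simp add: field_simps)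
      have "(s / card S) powr \<alpha> = real (card S) powr (- \<alpha>) * s powr \<alpha>"
        using N s by (simp add: powr_divide powr_minus field_simps)
      also have "\<dots> \<le> real (card S) powr (- \<alpha>) * (\<Sum>i\<in>S. a i powr \<alpha>)"
        by (intro mult_left_mono *) auto
      finally show ?thesis using False unfolding s_def by (simp add: min_def)
    qed
  qed
qed

locale regular_tree =
  fixes b :: nat
  assumes b: "b \<ge> 2"
begin

definition level_mean :: "nat \<Rightarrow> (nat list \<Rightarrow> real) \<Rightarrow> real" where
  "level_mean k f = (1 / real b) ^ k * (\<Sum>v\<in>level b k. f v)"

lemma level_eq: "level b k = {v. set v \<subseteq> {1..b} \<and> length v = k}"
  by (auto simp: level_def tree_def)

lemma finite_level [simp]: "finite (level b k)"
  unfolding level_eq by (rule finite_lists_length_eq) simp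

lemma card_level: "card (level b k) = b ^ k"
  unfolding level_eq by (subst card_lists_length_eq) auto

lemma level_nonempty: "level b k \<noteq> {}"
  using card_level[of k] b by auto

lemma level_mono_mean:
  "(\<And>v. v \<in> level b k \<Longrightarrow> f v \<le> g v) \<Longrightarrow> level_mean k f \<le> level_mean k g"
  unfolding level_mean_def by (intro mult_left_mono sum_mono) auto

lemma level_mean_const: "level_mean k (\<lambda>_. c) = c"
  using b by (simp add: level_mean_def card_level power_one_over)

lemma level_mean_nonneg: "(\<And>v. v \<in> level b k \<Longrightarrow> 0 \<le> f v) \<Longrightarrow> 0 \<le> level_mean k f"
  unfolding level_mean_def by (intro mult_nonneg_nonneg sum_nonneg) auto

lemma level_mean_diff: "level_mean k (\<lambda>v. f v - g v) = level_mean k f - level_mean k g"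
  by (simp add: level_mean_def sum_subtractf right_diff_distrib)

lemma abs_level_mean_le: "\<bar>level_mean k f\<bar> \<le> level_mean k (\<lambda>v. \<bar>f v\<bar>)"
  unfolding level_mean_def by (auto simp: abs_mult intro!: mult_left_mono sum_abs)

lemma field_norm_eq: "field_norm b h = (\<Sum>k. ennreal (level_mean (Suc k) (\<lambda>v. \<bar>h v\<bar>)))"
  by (simp add: field_norm_def level_mean_def)

section \<open>Uniform random rays and integrals over the boundary\<close>

sublocale ray: product_prob_space "\<lambda>_. uniform_count_measure {1..b}" "{1..} :: nat set"
proof -
  interpret prob_space "uniform_count_measure {1..b}"
    using b by (intro prob_space_uniform_count_measure) auto
  show "product_prob_space (\<lambda>_. uniform_count_measure {1..b})" by unfold_locales
qed

lemma prob_space_boundary: "prob_space (boundary_measure b)"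
  unfolding boundary_measure_def by (rule ray.prob_space_axioms)

lemma space_boundary: "space (boundary_measure b) = (\<Pi>\<^sub>E i\<in>{1..}. {1..b})"
  by (simp add: boundary_measure_def space_PiM space_uniform_count_measure)

lemma length_ray_prefix [simp]: "length (ray_prefix \<xi> k) = k"
  by (simp add: ray_prefix_def)

lemma ray_prefix_in_level: "\<xi> \<in> space (boundary_measure b) \<Longrightarrow> ray_prefix \<xi> k \<in> level b k"
  by (auto simp: level_eq space_boundary ray_prefix_def PiE_iff)

lemma take_ray_prefix: "j \<le> k \<Longrightarrow> take j (ray_prefix \<xi> k) = ray_prefix \<xi> j"
  by (simp add: ray_prefix_def take_map take_upt del: upt_Suc)

text \<open>A prefix event is a cylinder fixing k independent uniform coordinates. Rays are indexed
  from 1 and lists from 0, hence \<open>u ! (i - 1)\<close>.\<close>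

lemma emeasure_ray_prefix:
  assumes u: "u \<in> level b k"
  shows "{\<xi> \<in> space (boundary_measure b). ray_prefix \<xi> k = u} \<in> sets (boundary_measure b)" (is ?S)
    and "emeasure (boundary_measure b) {\<xi> \<in> space (boundary_measure b). ray_prefix \<xi> k = u} = ennreal ((1 / real b) ^ k)" (is ?E)
proof -
  have len: "length u = k" and mem: "\<And>i. i < k \<Longrightarrow> u ! i \<in> {1..b}"
    using u unfolding level_eq by (auto dest: nth_mem)
  have "ray_prefix \<xi> k = u \<longleftrightarrow> (\<forall>i\<in>{1..k}. \<xi> i \<in> {u ! (i - 1)})" for \<xi>
  proof -
    have "ray_prefix \<xi> k = u \<longleftrightarrow> (\<forall>i<k. \<xi> (Suc i) = u ! i)"
      using len by (auto simp: list_eq_iff_nth_eq ray_prefix_def simp del: upt_Suc)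
    also have "\<dots> \<longleftrightarrow> (\<forall>i\<in>{1..k}. \<xi> i = u ! (i - 1))"
    proof safe
      fix i assume "\<forall>i<k. \<xi> (Suc i) = u ! i" "i \<in> {1..k}"
      then show "\<xi> i = u ! (i - 1)" by (cases i) auto
    qed auto
    finally show ?thesis by simp
  qed
  then have eq: "{\<xi> \<in> space (boundary_measure b). ray_prefix \<xi> k = u}
      = {\<xi> \<in> space (boundary_measure b). \<forall>i\<in>{1..k}. \<xi> i \<in> {u ! (i - 1)}}" by simp
  have m: "{u ! (i - 1)} \<in> sets (uniform_count_measure {1..b})" if "i \<in> {1..k}" for i
    using mem[of "i - 1"] that by (auto simp: sets_uniform_count_measure)
  show ?S unfolding eq unfolding boundary_measure_def
    by (intro sets.sets_Collect_finite_All sets_Collect_single) (use m in auto)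
  have "emeasure (boundary_measure b) {\<xi> \<in> space (boundary_measure b). ray_prefix \<xi> k = u}
      = (\<Prod>i\<in>{1..k}. emeasure (uniform_count_measure {1..b}) {u ! (i - 1)})"
    unfolding eq unfolding boundary_measure_def
    by (rule ray.emeasure_PiM_Collect) (use m in auto)
  also have "\<dots> = (\<Prod>i\<in>{1..k}. ennreal (1 / real b))"
  proof (rule prod.cong)
    fix i assume "i \<in> {1..k}"
    then have "u ! (i - 1) \<in> {1..b}" using mem[of "i - 1"] by (cases i) auto
    then show "emeasure (uniform_count_measure {1..b}) {u ! (i - 1)} = ennreal (1 / real b)"
      by (subst emeasure_uniform_count_measure) auto
  qed simp
  also have "\<dots> = ennreal ((1 / real b) ^ k)" by (simp add: ennreal_power)
  finally show ?E .
qed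

lemma ray_prefix_measurable [measurable]:
  "(\<lambda>\<xi>. ray_prefix \<xi> k) \<in> measurable (boundary_measure b) (count_space UNIV)"
proof (intro measurable_count_space_eq2_countable[THEN iffD2] conjI ballI)
  fix u :: "nat list"
  have "(\<lambda>\<xi>. ray_prefix \<xi> k) -` {u} \<inter> space (boundary_measure b)
      = {\<xi> \<in> space (boundary_measure b). ray_prefix \<xi> k = u}" by auto
  also have "\<dots> \<in> sets (boundary_measure b)"
  proof (cases "u \<in> level b k")
    case True
    then show ?thesis by (rule emeasure_ray_prefix(1))
  next
    case False
    then have "{\<xi> \<in> space (boundary_measure b). ray_prefix \<xi> k = u} = {}"
      using ray_prefix_in_level by auto
    then show ?thesis by (simp only: sets.empty_sets)
  qed
  finally show "(\<lambda>\<xi>. ray_prefix \<xi> k) -` {u} \<inter> space (boundary_measure b) \<in> sets (boundary_measure b)" .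
qed auto

text \<open>The length-k prefix of a uniform ray is uniform on generation k, so boundary integrals
  of such functions are finite averages.\<close>

lemma integral_ray_prefix:
  fixes f :: "nat list \<Rightarrow> real"
  shows "integrable (boundary_measure b) (\<lambda>\<xi>. f (ray_prefix \<xi> k))"
    and "(\<integral>\<xi>. f (ray_prefix \<xi> k) \<partial>boundary_measure b) = level_mean k f"
proof -
  interpret prob_space "boundary_measure b" by (rule prob_space_boundary)
  define E where "E u = {\<xi> \<in> space (boundary_measure b). ray_prefix \<xi> k = u}" for u
  have E: "E u \<in> events" "prob (E u) = (1 / real b) ^ k" if "u \<in> level b k" for u
    using emeasure_ray_prefix[OF that] b by (auto simp: E_def measure_def)
  have eq: "f (ray_prefix \<xi> k) = (\<Sum>u\<in>level b k. f u * indicator (E u) \<xi>)"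
    if \<xi>: "\<xi> \<in> space (boundary_measure b)" for \<xi>
  proof -
    have "(\<Sum>u\<in>level b k. f u * indicator (E u) \<xi>) = (\<Sum>u\<in>level b k. if ray_prefix \<xi> k = u then f u else 0)"
      by (intro sum.cong) (use \<xi> in \<open>auto simp: E_def indicator_def\<close>)
    then show ?thesis using ray_prefix_in_level[OF \<xi>] by simp
  qed
  have int: "integrable (boundary_measure b) (\<lambda>\<xi>. \<Sum>u\<in>level b k. f u * indicator (E u) \<xi>)"
    using E by (intro Bochner_Integration.integrable_sum integrable_mult_right integrable_real_indicator)
      (auto simp: emeasure_eq_measure)
  then show "integrable (boundary_measure b) (\<lambda>\<xi>. f (ray_prefix \<xi> k))"
    by (subst Bochner_Integration.integrable_cong[OF refl eq])
  have "(\<integral>\<xi>. f (ray_prefix \<xi> k) \<partial>boundary_measure b)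
      = (\<integral>\<xi>. (\<Sum>u\<in>level b k. f u * indicator (E u) \<xi>) \<partial>boundary_measure b)"
    by (rule Bochner_Integration.integral_cong[OF refl eq])
  also have "\<dots> = (\<Sum>u\<in>level b k. f u * prob (E u))"
    using E by (subst Bochner_Integration.integral_sum) (auto intro!: integrable_real_indicator simp: emeasure_eq_measure)
  also have "\<dots> = level_mean k f"
    using E by (simp add: level_mean_def sum_distrib_left) (simp add: mult.commute)
  finally show "(\<integral>\<xi>. f (ray_prefix \<xi> k) \<partial>boundary_measure b) = level_mean k f" .
qed

lemma nn_integral_ray_prefix:
  fixes f :: "nat list \<Rightarrow> real"
  assumes "\<And>v. 0 \<le> f v"
  shows "(\<integral>\<^sup>+\<xi>. ennreal (f (ray_prefix \<xi> k)) \<partial>boundary_measure b) = ennreal (level_mean k f)"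
  by (subst nn_integral_eq_integral[OF integral_ray_prefix(1)]) (use assms in \<open>auto simp: integral_ray_prefix(2)\<close>)

lemma ray_sum_measurable [measurable]: "ray_sum h \<in> borel_measurable (boundary_measure b)"
  unfolding ray_sum_def by measurable

text \<open>By Tonelli, \<open>field_norm b h\<close> is the integral over rays of the series of
  absolute values; a finite integral forces an almost everywhere finite integrand.\<close>

lemma AE_ray_summable:
  assumes "field_norm b h < \<infinity>"
  shows "AE \<xi> in boundary_measure b. summable (\<lambda>k. \<bar>h (ray_prefix \<xi> (Suc k))\<bar>)"
proof -
  have "(\<integral>\<^sup>+\<xi>. (\<Sum>k. ennreal \<bar>h (ray_prefix \<xi> (Suc k))\<bar>) \<partial>boundary_measure b) = field_norm b h"
    by (subst nn_integral_suminf) (auto simp: field_norm_eq nn_integral_ray_prefix[where f="\<lambda>v. \<bar>h v\<bar>"])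
  then have "AE \<xi> in boundary_measure b. (\<Sum>k. ennreal \<bar>h (ray_prefix \<xi> (Suc k))\<bar>) \<noteq> \<infinity>"
    using assms by (intro nn_integral_PInf_AE) auto
  then show ?thesis
    by eventually_elim (auto intro: summable_suminf_not_top)
qed

text \<open>\<open>Psi\<close> is Lipschitz for the field norm: \<open>gauss_shift A\<close> is
  Lipschitz, and Tonelli turns the integrated ray series into a series of level means. The majorant
  \<open>B\<close> lets each application supply an explicit real series.\<close>

lemma Psi_diff_le:
  assumes A: "interval_union r A" and h: "h \<in> tree_fields b" "h' \<in> tree_fields b"
    and B: "\<And>k. level_mean (Suc k) (\<lambda>v. \<bar>h v - h' v\<bar>) \<le> B k" "summable B"
  shows "\<bar>Psi b A h - Psi b A h'\<bar> \<le> 2 * real r * suminf B"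
proof -
  interpret prob_space "boundary_measure b" by (rule prob_space_boundary)
  note [measurable] = gauss_shift_measurable[OF A]
  define G where "G f = (\<lambda>\<xi>. gauss_shift A (ray_sum f \<xi>))" for f
  have Gm [measurable]: "G f \<in> borel_measurable (boundary_measure b)" for f
    unfolding G_def by measurable
  have int: "integrable (boundary_measure b) (G f)" for f
    by (rule integrable_const_bound[where B=1]) (auto simp: G_def gauss_shift_bounds)
  have B0: "0 \<le> B k" for k
    using level_mean_nonneg[of "Suc k" "\<lambda>v. \<bar>h v - h' v\<bar>"] B(1)[of k] by linarith
  have sB: "0 \<le> suminf B" using B B0 by (intro suminf_nonneg)
  have "AE \<xi> in boundary_measure b. summable (\<lambda>k. \<bar>h (ray_prefix \<xi> (Suc k))\<bar>)"
       "AE \<xi> in boundary_measure b. summable (\<lambda>k. \<bar>h' (ray_prefix \<xi> (Suc k))\<bar>)"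
    using h by (auto simp: tree_fields_def intro!: AE_ray_summable)
  then have AE: "AE \<xi> in boundary_measure b. ennreal \<bar>G h \<xi> - G h' \<xi>\<bar>
      \<le> ennreal (2 * real r) * (\<Sum>k. ennreal \<bar>h (ray_prefix \<xi> (Suc k)) - h' (ray_prefix \<xi> (Suc k))\<bar>)"
  proof eventually_elim
    case (elim \<xi>)
    let ?d = "\<lambda>k. h (ray_prefix \<xi> (Suc k)) - h' (ray_prefix \<xi> (Suc k))"
    have s: "summable (\<lambda>k. \<bar>?d k\<bar>)"
      by (rule summable_comparison_test'[OF summable_add[OF elim], of 0]) (auto simp: abs_triangle_ineq4)
    have "\<bar>G h \<xi> - G h' \<xi>\<bar> \<le> 2 * real r * \<bar>ray_sum h \<xi> - ray_sum h' \<xi>\<bar>"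
      unfolding G_def by (rule gauss_shift_lipschitz[OF A])
    also have "ray_sum h \<xi> - ray_sum h' \<xi> = (\<Sum>k. ?d k)"
      unfolding ray_sum_def using elim by (intro suminf_diff) (auto dest: summable_rabs_cancel)
    also have "\<bar>\<dots>\<bar> \<le> (\<Sum>k. \<bar>?d k\<bar>)" by (rule summable_rabs[OF s])
    finally have "\<bar>G h \<xi> - G h' \<xi>\<bar> \<le> 2 * real r * (\<Sum>k. \<bar>?d k\<bar>)" by (simp add: mult_left_mono)
    then have "ennreal \<bar>G h \<xi> - G h' \<xi>\<bar> \<le> ennreal (2 * real r * (\<Sum>k. \<bar>?d k\<bar>))" by (rule ennreal_leI)
    then show ?case using s by (simp add: ennreal_mult suminf_nonneg suminf_ennreal2)
  qed
  have "Psi b A h - Psi b A h' = (\<integral>\<xi>. G h \<xi> - G h' \<xi> \<partial>boundary_measure b)"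
    unfolding Psi_def using int[of h] int[of h'] by (simp add: G_def)
  then have "\<bar>Psi b A h - Psi b A h'\<bar> \<le> (\<integral>\<xi>. \<bar>G h \<xi> - G h' \<xi>\<bar> \<partial>boundary_measure b)"
    by (metis integral_abs_bound)
  then have "ennreal \<bar>Psi b A h - Psi b A h'\<bar> \<le> (\<integral>\<^sup>+\<xi>. ennreal \<bar>G h \<xi> - G h' \<xi>\<bar> \<partial>boundary_measure b)"
    using int by (subst nn_integral_eq_integral) (auto intro!: ennreal_leI)
  also have "\<dots> \<le> (\<integral>\<^sup>+\<xi>. ennreal (2 * real r) * (\<Sum>k. ennreal \<bar>h (ray_prefix \<xi> (Suc k)) - h' (ray_prefix \<xi> (Suc k))\<bar>) \<partial>boundary_measure b)"
    by (rule nn_integral_mono_AE[OF AE])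
  also have "\<dots> = ennreal (2 * real r) * (\<Sum>k. ennreal (level_mean (Suc k) (\<lambda>v. \<bar>h v - h' v\<bar>)))"
    by (subst nn_integral_cmult, measurable, subst nn_integral_suminf)
      (auto simp: nn_integral_ray_prefix[where f="\<lambda>v. \<bar>h v - h' v\<bar>"])
  also have "\<dots> \<le> ennreal (2 * real r) * (\<Sum>k. ennreal (B k))"
    by (intro mult_left_mono suminf_le ennreal_leI B) auto
  also have "\<dots> = ennreal (2 * real r * suminf B)"
    using B B0 sB by (simp add: ennreal_mult suminf_ennreal2)
  finally show ?thesis using sB by (simp add: ennreal_le_iff)
qed

section \<open>Truncated fields, level energies and the size of the discarded tail\<close>

definition trunc :: "nat \<Rightarrow> (nat list \<Rightarrow> real) \<Rightarrow> nat list \<Rightarrow> real" where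
  "trunc K h = (\<lambda>v\<in>tree b. if v \<noteq> [] \<and> length v \<le> K then h v else 0)"

definition path_sum :: "(nat list \<Rightarrow> real) \<Rightarrow> nat list \<Rightarrow> real" where
  "path_sum h u = (\<Sum>k<length u. h (take (Suc k) u))"

definition level_energy :: "real \<Rightarrow> nat \<Rightarrow> (nat list \<Rightarrow> real) \<Rightarrow> real" where
  "level_energy \<alpha> k h = (\<Sum>v\<in>level b k. \<bar>h v\<bar> powr \<alpha>)"

text \<open>The square root of the factor by which the bound on level means shrinks per generation.
  Working with the root leaves one copy for smallness in the truncation level and one for summing a
  geometric series.\<close>

definition decay :: "real \<Rightarrow> real \<Rightarrow> real" where
  "decay \<alpha> \<gamma> = real b powr (- (min 1 \<alpha> - \<gamma>) / (2 * \<alpha>))"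

lemma level_in_tree: "v \<in> level b k \<Longrightarrow> v \<in> tree b"
  by (simp add: level_def)

lemma length_level: "v \<in> level b k \<Longrightarrow> length v = k"
  by (simp add: level_def)

lemma trunc_level: "v \<in> level b (Suc k) \<Longrightarrow> trunc K h v = (if Suc k \<le> K then h v else 0)"
  using length_level[of v "Suc k"] level_in_tree[of v "Suc k"] by (auto simp: trunc_def)

lemma trunc_trunc: "K \<le> L \<Longrightarrow> trunc K (trunc L h) = trunc K h"
  by (auto simp: trunc_def fun_eq_iff)

lemma decay_bounds:
  assumes "\<alpha> > 0" "\<gamma> < min 1 \<alpha>"
  shows "0 < decay \<alpha> \<gamma>" "decay \<alpha> \<gamma> < 1"
proof -
  show "0 < decay \<alpha> \<gamma>" using b by (simp add: decay_def)
  have "real b powr (- (min 1 \<alpha> - \<gamma>) / (2 * \<alpha>)) < real b powr 0"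
    using assms b by (intro powr_less_mono) (auto simp: field_simps)
  then show "decay \<alpha> \<gamma> < 1" using b by (simp add: decay_def)
qed

text \<open>Averaging over \<open>b ^ k\<close> vertices gains
  \<open>b powr (- min 1 \<alpha> * k)\<close> by \<open>sum_mean_powr_le\<close>, against the
  permitted growth \<open>b powr (\<gamma> * k)\<close> of the energy; the rest is an \<alpha>-th
  root.\<close>

lemma level_mean_le_energy:
  assumes \<alpha>: "\<alpha> > 0" and e: "level_energy \<alpha> k h \<le> real b powr (\<gamma> * real k) * y"
  shows "level_mean k (\<lambda>v. \<bar>h v\<bar>) \<le> y powr (1 / \<alpha>) * decay \<alpha> \<gamma> ^ (2 * k)"
proof -
  have b0: "real b > 0" using b by simp
  let ?m = "level_mean k (\<lambda>v. \<bar>h v\<bar>)"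
  have m0: "0 \<le> ?m" by (rule level_mean_nonneg) simp
  have m: "?m = (\<Sum>v\<in>level b k. \<bar>h v\<bar>) / card (level b k)"
    by (simp add: level_mean_def card_level power_one_over field_simps)
  have "0 \<le> level_energy \<alpha> k h" unfolding level_energy_def by (intro sum_nonneg) auto
  then have "0 \<le> real b powr (\<gamma> * real k) * y" using e by linarith
  then have y: "0 \<le> y" using b0 by (simp add: zero_le_mult_iff)
  have bk: "real (b ^ k) = real b powr real k" using b0 by (simp add: powr_realpow)
  have "?m powr \<alpha> \<le> real (card (level b k)) powr (- min 1 \<alpha>) * level_energy \<alpha> k h"
    unfolding m level_energy_def by (rule sum_mean_powr_le) (use \<alpha> level_nonempty in auto)
  also have "real (card (level b k)) powr (- min 1 \<alpha>) = real b powr (- min 1 \<alpha> * real k)"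
    unfolding card_level bk powr_powr by (simp add: mult.commute)
  also have "\<dots> * level_energy \<alpha> k h \<le> real b powr (- min 1 \<alpha> * real k) * (real b powr (\<gamma> * real k) * y)"
    by (intro mult_left_mono e) auto
  also have "\<dots> = y * real b powr (- (min 1 \<alpha> - \<gamma>) * real k)"
    by (simp add: mult.assoc[symmetric] powr_add[symmetric] algebra_simps)
  finally have "(?m powr \<alpha>) powr (1 / \<alpha>) \<le> (y * real b powr (- (min 1 \<alpha> - \<gamma>) * real k)) powr (1 / \<alpha>)"
    using \<alpha> by (intro powr_mono2) auto
  also have "\<dots> = y powr (1 / \<alpha>) * real b powr (- (min 1 \<alpha> - \<gamma>) * real k / \<alpha>)"
    using y by (simp add: powr_mult powr_powr)
  also have "real b powr (- (min 1 \<alpha> - \<gamma>) * real k / \<alpha>) = decay \<alpha> \<gamma> ^ (2 * k)"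
  proof -
    have "decay \<alpha> \<gamma> ^ (2 * k) = real b powr (- (min 1 \<alpha> - \<gamma>) / (2 * \<alpha>) * real (2 * k))"
      using b0 by (subst powr_realpow[symmetric]) (auto simp: decay_def powr_powr)
    moreover have "- (min 1 \<alpha> - \<gamma>) / (2 * \<alpha>) * real (2 * k) = - (min 1 \<alpha> - \<gamma>) * real k / \<alpha>"
      using \<alpha> by simp
    ultimately show ?thesis by simp
  qed
  finally show ?thesis using m0 \<alpha> by (simp add: powr_powr)
qed

lemma tree_fields_if_energy:
  assumes \<alpha>: "\<alpha> > 0" and \<gamma>: "\<gamma> < min 1 \<alpha>" and h: "h \<in> extensional (tree b)" "h [] = 0"
    and e: "\<And>k. level_energy \<alpha> (Suc k) h \<le> real b powr (\<gamma> * real (Suc k)) * y"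
  shows "h \<in> tree_fields b"
proof -
  note d = decay_bounds[OF \<alpha> \<gamma>]
  have "field_norm b h \<le> (\<Sum>k. ennreal (y powr (1 / \<alpha>) * decay \<alpha> \<gamma> ^ k))"
    unfolding field_norm_eq
  proof (intro suminf_le ennreal_leI)
    fix k
    have "level_mean (Suc k) (\<lambda>v. \<bar>h v\<bar>) \<le> y powr (1 / \<alpha>) * decay \<alpha> \<gamma> ^ (2 * Suc k)"
      by (rule level_mean_le_energy[OF \<alpha> e])
    also have "\<dots> \<le> y powr (1 / \<alpha>) * decay \<alpha> \<gamma> ^ k"
      using d by (intro mult_left_mono power_decreasing) auto
    finally show "level_mean (Suc k) (\<lambda>v. \<bar>h v\<bar>) \<le> y powr (1 / \<alpha>) * decay \<alpha> \<gamma> ^ k" .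
  qed auto
  also have "\<dots> = ennreal (\<Sum>k. y powr (1 / \<alpha>) * decay \<alpha> \<gamma> ^ k)"
    using d by (intro suminf_ennreal2) (auto intro!: summable_mult summable_geometric)
  finally show ?thesis using h by (auto simp: tree_fields_def intro: le_less_trans)
qed

lemma level_energy_trunc:
  "level_energy \<alpha> (Suc k) (trunc K h) = (if Suc k \<le> K then level_energy \<alpha> (Suc k) h else 0)"
  by (auto simp: level_energy_def trunc_level)

text \<open>The function \<open>h\<close> is arbitrary: \<open>trunc\<close> itself sets the root to
  0, fixes the values off the tree and keeps finitely many generations. This turns the raw rescaled
  displacements into a field.\<close>

lemma trunc_in_tree_fields: "trunc K h \<in> tree_fields b"
proof -
  have "field_norm b (trunc K h) = (\<Sum>k<K. ennreal (level_mean (Suc k) (\<lambda>v. \<bar>trunc K h v\<bar>)))"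
    unfolding field_norm_eq by (rule suminf_finite) (auto simp: level_mean_def trunc_level)
  also have "\<dots> < \<infinity>" by simp
  finally show ?thesis by (simp add: tree_fields_def trunc_def tree_def)
qed

text \<open>Applied with \<gamma> = 0 to fields of finite cost and with \<gamma> =
  \<open>discount\<close> to the random field, whose level energies are controlled only up to the
  discount.\<close>

lemma Psi_trunc_diff_le:
  assumes A: "interval_union r A" and \<alpha>: "\<alpha> > 0" and \<gamma>: "\<gamma> < min 1 \<alpha>"
    and h: "h \<in> tree_fields b"
    and e: "\<And>k. level_energy \<alpha> (Suc k) h \<le> real b powr (\<gamma> * real (Suc k)) * y"
  shows "\<bar>Psi b A h - Psi b A (trunc K h)\<bar>
    \<le> 2 * real r * (y powr (1 / \<alpha>) * decay \<alpha> \<gamma> ^ K / (1 - decay \<alpha> \<gamma>))"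
proof -
  note d = decay_bounds[OF \<alpha> \<gamma>]
  define B where "B k = y powr (1 / \<alpha>) * decay \<alpha> \<gamma> ^ K * decay \<alpha> \<gamma> ^ k" for k
  have "level_mean (Suc k) (\<lambda>v. \<bar>h v - trunc K h v\<bar>) \<le> B k" for k
  proof (cases "Suc k \<le> K")
    case True
    then have "level_mean (Suc k) (\<lambda>v. \<bar>h v - trunc K h v\<bar>) = 0"
      by (simp add: level_mean_def trunc_level)
    then show ?thesis using d by (simp add: B_def)
  next
    case False
    then have "level_mean (Suc k) (\<lambda>v. \<bar>h v - trunc K h v\<bar>) = level_mean (Suc k) (\<lambda>v. \<bar>h v\<bar>)"
      by (simp add: level_mean_def trunc_level)
    also have "\<dots> \<le> y powr (1 / \<alpha>) * decay \<alpha> \<gamma> ^ (2 * Suc k)"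
      by (rule level_mean_le_energy[OF \<alpha> e])
    \<comment> \<open>Here \<open>Suc k\<close> exceeds \<open>K\<close>, so
      \<open>2 * Suc k\<close> is at least \<open>K + k\<close>.\<close>
    also have "\<dots> \<le> y powr (1 / \<alpha>) * decay \<alpha> \<gamma> ^ (K + k)"
      using d False by (intro mult_left_mono power_decreasing) auto
    finally show ?thesis by (simp add: B_def power_add mult.assoc)
  qed
  moreover have "B sums (y powr (1 / \<alpha>) * decay \<alpha> \<gamma> ^ K * (1 / (1 - decay \<alpha> \<gamma>)))"
    unfolding B_def using d by (intro sums_mult geometric_sums) auto
  ultimately show ?thesis
    using Psi_diff_le[OF A h trunc_in_tree_fields, of K h B] by (auto simp: sums_iff)
qed

lemma Psi_trunc_local:
  assumes A: "interval_union r A" and d: "\<And>v. v \<in> tree b \<Longrightarrow> v \<noteq> [] \<Longrightarrow> length v \<le> K \<Longrightarrow> \<bar>h v - h' v\<bar> \<le> \<delta>"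
    and \<delta>: "0 \<le> \<delta>"
  shows "\<bar>Psi b A (trunc K h) - Psi b A (trunc K h')\<bar> \<le> 2 * real r * (real K * \<delta>)"
proof -
  define B where "B k = (if k < K then \<delta> else 0)" for k
  have "level_mean (Suc k) (\<lambda>v. \<bar>trunc K h v - trunc K h' v\<bar>) \<le> B k" for k
  proof -
    have "level_mean (Suc k) (\<lambda>v. \<bar>trunc K h v - trunc K h' v\<bar>) \<le> level_mean (Suc k) (\<lambda>_. B k)"
    proof (rule level_mono_mean)
      fix v assume v: "v \<in> level b (Suc k)"
      then have "v \<noteq> []" using length_level[OF v] by auto
      then show "\<bar>trunc K h v - trunc K h' v\<bar> \<le> B k"
        using v d[OF level_in_tree[OF v]] length_level[OF v] \<delta> by (auto simp: trunc_level B_def)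
    qed
    then show ?thesis by (simp add: level_mean_const)
  qed
  moreover have "B sums (\<Sum>k<K. B k)"
    by (rule sums_finite) (auto simp: B_def)
  moreover have "(\<Sum>k<K. B k) = real K * \<delta>" by (simp add: B_def)
  ultimately show ?thesis
    using Psi_diff_le[OF A trunc_in_tree_fields trunc_in_tree_fields, of K h K h' B] by (auto simp: sums_iff)
qed

text \<open>On truncated fields \<open>Psi\<close> is a finite average of continuous functions of
  finitely many coordinates. This is the source of its continuity, its measurability and its
  comparison with conditional means.\<close>

lemma Psi_trunc_eq: "Psi b A (trunc L h) = level_mean L (\<lambda>u. gauss_shift A (path_sum h u))"
proof -
  have "ray_sum (trunc L h) \<xi> = path_sum h (ray_prefix \<xi> L)" if \<xi>: "\<xi> \<in> space (boundary_measure b)" for \<xi>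
  proof -
    have r: "ray_prefix \<xi> (Suc k) \<in> level b (Suc k)" for k by (rule ray_prefix_in_level[OF \<xi>])
    have "ray_sum (trunc L h) \<xi> = (\<Sum>k<L. trunc L h (ray_prefix \<xi> (Suc k)))"
      unfolding ray_sum_def by (rule suminf_finite) (auto simp: trunc_level[OF r])
    also have "\<dots> = (\<Sum>k<L. h (ray_prefix \<xi> (Suc k)))"
      by (intro sum.cong) (auto simp: trunc_level[OF r])
    also have "\<dots> = path_sum h (ray_prefix \<xi> L)"
      by (auto simp: path_sum_def take_ray_prefix)
    finally show ?thesis .
  qed
  then have "Psi b A (trunc L h) = (\<integral>\<xi>. gauss_shift A (path_sum h (ray_prefix \<xi> L)) \<partial>boundary_measure b)"
    unfolding Psi_def by (intro Bochner_Integration.integral_cong) auto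
  then show ?thesis using integral_ray_prefix(2)[of "\<lambda>u. gauss_shift A (path_sum h u)" L] by simp
qed

end


section \<open>Compactness and the rate function\<close>

context regular_tree
begin

definition below :: "nat \<Rightarrow> nat list set" where
  "below K = {v \<in> tree b. v \<noteq> [] \<and> length v \<le> K}"

lemma below_eq: "below K = (\<Union>k<K. level b (Suc k))"
proof (intro set_eqI iffI)
  fix v assume "v \<in> below K"
  then have "v \<in> level b (Suc (length v - 1))" "length v - 1 < K"
    by (cases v; auto simp: below_def level_def)+
  then show "v \<in> (\<Union>k<K. level b (Suc k))" by blast
qed (auto simp: below_def level_def)

lemma finite_below [simp]: "finite (below K)"
  unfolding below_eq by (intro finite_UN_I finite_lessThan finite_level)

lemma below_subset: "below K \<subseteq> tree b - {[]}"
  by (auto simp: below_def)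

lemma sum_below: "(\<Sum>v\<in>below K. f v) = (\<Sum>k<K. \<Sum>v\<in>level b (Suc k). f v)"
proof -
  have "level b i \<inter> level b j = {}" if "i \<noteq> j" for i j
    using that by (auto simp: level_def)
  then show ?thesis unfolding below_eq by (intro sum.UNION_disjoint) auto
qed

text \<open>Finiteness of the norm is a consequence of the cost bound
  (\<open>sublevel_tree_fields\<close>). What remains are conditions on finitely many coordinates at
  a time, which makes the set closed under pointwise convergence.\<close>

definition sublevel :: "real \<Rightarrow> real \<Rightarrow> real \<Rightarrow> (nat list \<Rightarrow> real) set" where
  "sublevel \<alpha> lam c = {h \<in> extensional (tree b). h [] = 0 \<and> field_cost b \<alpha> lam h \<le> ennreal c}"

text \<open>A sum in \<open>ennreal\<close> is the supremum of its finite partial sums, so a cost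
  bound is an intersection of closed conditions.\<close>

lemma field_cost_le_iff:
  assumes lam: "lam > 0" and c: "c \<ge> 0"
  shows "field_cost b \<alpha> lam h \<le> ennreal c \<longleftrightarrow>
    (\<forall>F. finite F \<and> F \<subseteq> tree b - {[]} \<longrightarrow> lam * (\<Sum>v\<in>F. \<bar>h v\<bar> powr \<alpha>) \<le> c)"
proof -
  have "field_cost b \<alpha> lam h
      = (SUP F\<in>{F. finite F \<and> F \<subseteq> tree b - {[]}}. ennreal lam * (\<Sum>v\<in>F. ennreal (\<bar>h v\<bar> powr \<alpha>)))"
    unfolding field_cost_def by (subst nonneg_infsum_complete) (auto simp: SUP_mult_left_ennreal)
  also have "\<dots> = (SUP F\<in>{F. finite F \<and> F \<subseteq> tree b - {[]}}. ennreal (lam * (\<Sum>v\<in>F. \<bar>h v\<bar> powr \<alpha>)))"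
    using lam by (intro SUP_cong) (auto simp: sum_ennreal ennreal_mult sum_nonneg)
  finally show ?thesis using c by (auto simp: SUP_le_iff ennreal_le_iff)
qed

text \<open>The power with exponent \<open>0 * real (Suc k)\<close> equals 1; the bound is written
  this way to match the energy hypotheses at \<gamma> = 0.\<close>

lemma level_energy_le:
  assumes lam: "lam > 0" and c: "c \<ge> 0" and h: "field_cost b \<alpha> lam h \<le> ennreal c"
  shows "level_energy \<alpha> (Suc k) h \<le> real b powr (0 * real (Suc k)) * (c / lam)"
proof -
  have "lam * (\<Sum>v\<in>level b (Suc k). \<bar>h v\<bar> powr \<alpha>) \<le> c"
  proof -
    have "level b (Suc k) \<subseteq> tree b - {[]}" by (auto simp: level_def)
    then show ?thesis using h unfolding field_cost_le_iff[OF lam c] by (meson finite_level)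
  qed
  then show ?thesis using lam b by (simp add: level_energy_def field_simps)
qed

lemma sublevel_tree_fields:
  assumes "\<alpha> > 0" "lam > 0" "c \<ge> 0" "h \<in> sublevel \<alpha> lam c"
  shows "h \<in> tree_fields b"
  using assms
  by (intro tree_fields_if_energy[OF _ _ _ _ level_energy_le[of lam c]]) (auto simp: sublevel_def)

lemma trunc_in_sublevel:
  assumes lam: "lam > 0" and c: "c \<ge> 0" and h: "lam * (\<Sum>v\<in>below K. \<bar>h v\<bar> powr \<alpha>) \<le> c"
  shows "trunc K h \<in> sublevel \<alpha> lam c"
proof -
  have "lam * (\<Sum>v\<in>F. \<bar>trunc K h v\<bar> powr \<alpha>) \<le> c" if F: "finite F" "F \<subseteq> tree b - {[]}" for F
  proof -
    have "(\<Sum>v\<in>F. \<bar>trunc K h v\<bar> powr \<alpha>) = (\<Sum>v\<in>F \<inter> below K. \<bar>trunc K h v\<bar> powr \<alpha>)"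
      using F by (intro sum.mono_neutral_right) (auto simp: trunc_def below_def)
    also have "\<dots> = (\<Sum>v\<in>F \<inter> below K. \<bar>h v\<bar> powr \<alpha>)"
      by (intro sum.cong) (auto simp: trunc_def below_def)
    also have "\<dots> \<le> (\<Sum>v\<in>below K. \<bar>h v\<bar> powr \<alpha>)"
      by (intro sum_mono2) auto
    finally show ?thesis using h lam by (smt (verit) mult_left_mono)
  qed
  then show ?thesis using field_cost_le_iff[OF lam c]
    by (auto simp: sublevel_def trunc_def tree_def)
qed

text \<open>Tychonoff: the cost of a single vertex confines its value to [-R, R], and inside the
  resulting box the finite-sum conditions are closed.\<close>

lemma compact_sublevel:
  assumes \<alpha>: "\<alpha> > 0" and lam: "lam > 0" and c: "c \<ge> 0"
  shows "compact (sublevel \<alpha> lam c)"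
proof -
  define R where "R = (c / lam) powr (1 / \<alpha>)"
  \<comment> \<open>The singleton \<open>{undefined}\<close> off the tree encodes extensionality, so
    the product can run over all lists and its topology is that of the function type.\<close>
  define box where "box v = (if v \<in> tree b then if v = [] then {0} else {- R..R} else {undefined :: real})" for v :: "nat list"
  define C where "C F = {h :: nat list \<Rightarrow> real. lam * (\<Sum>v\<in>F. \<bar>h v\<bar> powr \<alpha>) \<le> c}" for F
  have "compactin (product_topology (\<lambda>_. euclidean) UNIV) (PiE UNIV box)"
    unfolding compactin_PiE by (auto simp: box_def)
  then have "compact (PiE UNIV box)" by (simp add: euclidean_product_topology)
  moreover have "closed (C F)" for F
    unfolding C_def
    by (intro closed_Collect_le continuous_intros continuous_on_powr')
      (use \<alpha> in \<open>auto intro: continuous_on_product_coordinates\<close>)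
  then have "closed (\<Inter>F\<in>{F. finite F \<and> F \<subseteq> tree b - {[]}}. C F)" by blast
  ultimately have "compact (PiE UNIV box \<inter> (\<Inter>F\<in>{F. finite F \<and> F \<subseteq> tree b - {[]}}. C F))"
    by (rule compact_Int_closed)
  also have "PiE UNIV box \<inter> (\<Inter>F\<in>{F. finite F \<and> F \<subseteq> tree b - {[]}}. C F) = sublevel \<alpha> lam c"
  proof (intro set_eqI iffI)
    fix h assume h: "h \<in> PiE UNIV box \<inter> (\<Inter>F\<in>{F. finite F \<and> F \<subseteq> tree b - {[]}}. C F)"
    then have bx: "h v \<in> box v" for v by auto
    have "h \<in> extensional (tree b)"
      unfolding extensional_def
    proof (intro CollectI allI impI)
      fix v assume "v \<notin> tree b" then show "h v = undefined" using bx[of v] by (simp add: box_def)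
    qed
    moreover have "h [] = 0" using bx[of "[]"] by (simp add: box_def tree_def)
    ultimately show "h \<in> sublevel \<alpha> lam c"
      using h by (auto simp: sublevel_def field_cost_le_iff[OF lam c] C_def)
  next
    fix h assume h: "h \<in> sublevel \<alpha> lam c"
    then have F: "lam * (\<Sum>v\<in>F. \<bar>h v\<bar> powr \<alpha>) \<le> c" if "finite F" "F \<subseteq> tree b - {[]}" for F
      using that by (simp add: sublevel_def field_cost_le_iff[OF lam c])
    have "h v \<in> box v" for v
    proof (cases "v \<in> tree b \<and> v \<noteq> []")
      case True
      then have "\<bar>h v\<bar> powr \<alpha> \<le> c / lam" using F[of "{v}"] lam by (simp add: field_simps)
      then have "(\<bar>h v\<bar> powr \<alpha>) powr (1 / \<alpha>) \<le> R"
        unfolding R_def using \<alpha> by (intro powr_mono2) auto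
      then have "\<bar>h v\<bar> \<le> R" using \<alpha> by (simp add: powr_powr)
      then show ?thesis using True by (auto simp: box_def)
    qed (use h in \<open>auto simp: box_def sublevel_def extensional_def\<close>)
    then show "h \<in> PiE UNIV box \<inter> (\<Inter>F\<in>{F. finite F \<and> F \<subseteq> tree b - {[]}}. C F)"
      using F by (auto simp: C_def)
  qed
  finally show ?thesis .
qed

text \<open>Pointwise convergence alone does not control infinitely many generations. A cost bound
  makes the truncation error uniformly small, so \<open>Psi\<close> is a uniform limit of continuous
  functions of finitely many coordinates.\<close>

lemma Psi_continuous_on_sublevel:
  assumes A: "interval_union r A" and \<alpha>: "\<alpha> > 0" and lam: "lam > 0" and c: "c \<ge> 0"
  shows "continuous_on (sublevel \<alpha> lam c) (Psi b A)"
proof (rule uniform_limit_theorem)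
  have g: "(0::real) < min 1 \<alpha>" using \<alpha> by simp
  note d = decay_bounds[OF \<alpha> g]
  have [continuous_intros]: "continuous_on UNIV (\<lambda>h. path_sum h u)" for u
    unfolding path_sum_def by (intro continuous_intros continuous_on_product_coordinates)
  have "continuous_on UNIV (\<lambda>h. Psi b A (trunc K h))" for K
    unfolding Psi_trunc_eq level_mean_def
    by (intro continuous_intros continuous_on_compose2[OF gauss_shift_continuous[OF A]]) auto
  then show "\<forall>\<^sub>F K in sequentially. continuous_on (sublevel \<alpha> lam c) (\<lambda>h. Psi b A (trunc K h))"
    by (intro always_eventually allI) (rule continuous_on_subset[OF _ subset_UNIV])
  define C where "C = 2 * real r * ((c / lam) powr (1 / \<alpha>) / (1 - decay \<alpha> 0))"
  show "uniform_limit (sublevel \<alpha> lam c) (\<lambda>K h. Psi b A (trunc K h)) (Psi b A) sequentially"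
  proof (rule uniform_limitI)
    fix e :: real assume e: "e > 0"
    have "(\<lambda>K. C * decay \<alpha> 0 ^ K) \<longlonglongrightarrow> C * 0"
      using d by (intro tendsto_intros LIMSEQ_power_zero) auto
    then have "\<forall>\<^sub>F K in sequentially. C * decay \<alpha> 0 ^ K < e"
      using e by (intro order_tendstoD) auto
    then show "\<forall>\<^sub>F K in sequentially. \<forall>h\<in>sublevel \<alpha> lam c. dist (Psi b A (trunc K h)) (Psi b A h) < e"
    proof eventually_elim
      case (elim K)
      show ?case
      proof
        fix h assume h: "h \<in> sublevel \<alpha> lam c"
        have "\<bar>Psi b A h - Psi b A (trunc K h)\<bar>
            \<le> 2 * real r * ((c / lam) powr (1 / \<alpha>) * decay \<alpha> 0 ^ K / (1 - decay \<alpha> 0))"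
          by (rule Psi_trunc_diff_le[OF A \<alpha> g sublevel_tree_fields[OF \<alpha> lam c h] level_energy_le[OF lam c]])
            (use h in \<open>auto simp: sublevel_def\<close>)
        also have "\<dots> = C * decay \<alpha> 0 ^ K" by (simp add: C_def)
        finally show "dist (Psi b A (trunc K h)) (Psi b A h) < e"
          using elim by (simp add: dist_real_def abs_minus_commute)
      qed
    qed
  qed
qed simp

section \<open>The rate function: attainment, compact sublevel sets, separation\<close>

lemma Psi_range: "interval_union r A \<Longrightarrow> Psi b A h \<in> {0..1}"
proof -
  assume A: "interval_union r A"
  interpret prob_space "boundary_measure b" by (rule prob_space_boundary)
  note [measurable] = gauss_shift_measurable[OF A]
  have "integrable (boundary_measure b) (\<lambda>\<xi>. gauss_shift A (ray_sum h \<xi>))"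
    by (rule integrable_const_bound[where B=1]) (auto simp: gauss_shift_bounds)
  then show ?thesis unfolding Psi_def
    by (auto intro!: integral_nonneg integral_le_const simp: gauss_shift_bounds)
qed

lemma rate_Q_le_if_sublevel:
  assumes "\<alpha> > 0" "lam > 0" "c \<ge> 0" "h \<in> sublevel \<alpha> lam c"
  shows "rate_Q b \<alpha> lam A (Psi b A h) \<le> ennreal c"
  unfolding rate_Q_def
  by (rule INF_lower2[of h]) (use assms sublevel_tree_fields in \<open>auto simp: sublevel_def\<close>)

text \<open>The direct method: near-minimisers lie in a compact sublevel set, and continuity of
  \<open>Psi\<close> there preserves the constraint in the limit.\<close>

lemma rate_Q_attained:
  assumes A: "interval_union r A" and \<alpha>: "\<alpha> > 0" and lam: "lam > 0"
    and fin: "rate_Q b \<alpha> lam A q < \<infinity>"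
  obtains h where "h \<in> tree_fields b" "Psi b A h = q" "field_cost b \<alpha> lam h = rate_Q b \<alpha> lam A q"
proof -
  define c where "c = enn2real (rate_Q b \<alpha> lam A q)"
  have c: "rate_Q b \<alpha> lam A q = ennreal c" "c \<ge> 0"
    using fin by (auto simp: c_def less_top)
  define e where "e n = 1 / real (Suc n)" for n
  have e: "e n > 0" for n by (simp add: e_def)
  have "\<exists>h. h \<in> sublevel \<alpha> lam (c + e n) \<and> Psi b A h = q" for n
  proof -
    have "rate_Q b \<alpha> lam A q < ennreal (c + e n)" using c e[of n] by (simp add: ennreal_less_iff)
    then obtain h where "h \<in> tree_fields b" "Psi b A h = q" "field_cost b \<alpha> lam h < ennreal (c + e n)"
      unfolding rate_Q_def by (auto simp: INF_less_iff)
    then show ?thesis by (intro exI[of _ h]) (auto simp: sublevel_def tree_fields_def)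
  qed
  then obtain h where h: "\<And>n. h n \<in> sublevel \<alpha> lam (c + e n)" "\<And>n. Psi b A (h n) = q" by metis
  have mono: "sublevel \<alpha> lam (c + e n) \<subseteq> sublevel \<alpha> lam (c + e m)" if "m \<le> n" for m n
  proof -
    have "ennreal (c + e n) \<le> ennreal (c + e m)"
      using that by (intro ennreal_leI) (auto simp: e_def frac_le)
    then show ?thesis unfolding sublevel_def by (auto intro: order_trans)
  qed
  have cpt: "compact (sublevel \<alpha> lam (c + e n))" for n
    using c e[of n] by (intro compact_sublevel \<alpha> lam) auto
  have "h n \<in> sublevel \<alpha> lam (c + e 0)" for n using h(1)[of n] mono[of 0 n] by auto
  then obtain l \<sigma> where l: "l \<in> sublevel \<alpha> lam (c + e 0)" "strict_mono \<sigma>" "(h \<circ> \<sigma>) \<longlonglongrightarrow> l"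
    using compact_imp_seq_compact[OF cpt] unfolding seq_compact_def by metis
  \<comment> \<open>The sublevel sets at \<open>c + e m\<close> are closed and decreasing, so the
    limit lies in each of them and its cost is at most \<open>c\<close>.\<close>
  have lm: "l \<in> sublevel \<alpha> lam (c + e m)" for m
  proof (rule Lim_in_closed_set[OF compact_imp_closed[OF cpt] _ _ l(3)])
    show "\<forall>\<^sub>F n in sequentially. (h \<circ> \<sigma>) n \<in> sublevel \<alpha> lam (c + e m)"
    proof (rule eventually_sequentiallyI[of m])
      fix n assume "n \<ge> m"
      then have "m \<le> \<sigma> n" using seq_suble[OF l(2), of n] by linarith
      then show "(h \<circ> \<sigma>) n \<in> sublevel \<alpha> lam (c + e m)" using h(1)[of "\<sigma> n"] mono[of m "\<sigma> n"] by auto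
    qed
  qed simp
  have "(\<lambda>n. Psi b A ((h \<circ> \<sigma>) n)) \<longlonglongrightarrow> Psi b A l"
  proof (rule continuous_on_tendsto_compose[OF Psi_continuous_on_sublevel[OF A \<alpha> lam, of "c + e 0"] l(3) l(1)])
    show "0 \<le> c + e 0" using c e[of 0] by simp
    show "\<forall>\<^sub>F n in sequentially. (h \<circ> \<sigma>) n \<in> sublevel \<alpha> lam (c + e 0)"
      using \<open>\<And>n. h n \<in> sublevel \<alpha> lam (c + e 0)\<close> by simp
  qed
  then have Psi_l: "Psi b A l = q" using h(2) by (simp add: LIMSEQ_const_iff)
  have "field_cost b \<alpha> lam l \<le> ennreal c"
  proof (rule LIMSEQ_le_const)
    have "(\<lambda>n. c + e n) \<longlonglongrightarrow> c + 0"
      unfolding e_def by (intro tendsto_intros LIMSEQ_Suc[OF lim_1_over_n])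
    then show "(\<lambda>n. ennreal (c + e n)) \<longlonglongrightarrow> ennreal c" by (intro tendsto_ennrealI) simp
    show "\<exists>N. \<forall>n\<ge>N. field_cost b \<alpha> lam l \<le> ennreal (c + e n)"
      using lm by (auto simp: sublevel_def)
  qed
  moreover have tf: "l \<in> tree_fields b"
    using sublevel_tree_fields[OF \<alpha> lam _ lm[of 0]] c e[of 0] by simp
  moreover have "rate_Q b \<alpha> lam A q \<le> field_cost b \<alpha> lam l"
    unfolding rate_Q_def by (rule INF_lower) (use tf Psi_l in auto)
  ultimately show ?thesis using that Psi_l c by (metis antisym)
qed

text \<open>Attainment is what makes the sublevel sets of the infimum equal to images of compact
  sets under \<open>Psi\<close>, rather than merely intersections of such images.\<close>

lemma rate_Q_le_iff:
  assumes A: "interval_union r A" and \<alpha>: "\<alpha> > 0" and lam: "lam > 0" and c: "c \<ge> 0"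
  shows "rate_Q b \<alpha> lam A q \<le> ennreal c \<longleftrightarrow> q \<in> Psi b A ` sublevel \<alpha> lam c"
proof
  assume le: "rate_Q b \<alpha> lam A q \<le> ennreal c"
  then have "rate_Q b \<alpha> lam A q < \<infinity>" by (auto intro: le_less_trans)
  then obtain h where "h \<in> tree_fields b" "Psi b A h = q" "field_cost b \<alpha> lam h = rate_Q b \<alpha> lam A q"
    using rate_Q_attained[OF A \<alpha> lam] by blast
  then show "q \<in> Psi b A ` sublevel \<alpha> lam c"
    using le by (auto simp: sublevel_def tree_fields_def)
qed (use rate_Q_le_if_sublevel[OF \<alpha> lam c] in auto)

lemma rate_Q_sublevel_compact:
  assumes A: "interval_union r A" and \<alpha>: "\<alpha> > 0" and lam: "lam > 0"
  shows "compact {q \<in> {0..1}. rate_Q b \<alpha> lam A q \<le> ennreal c}"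
proof -
  \<comment> \<open>For negative \<open>c\<close> the value \<open>ennreal c\<close> is 0, hence the
    maximum.\<close>
  have "{q \<in> {0..1}. rate_Q b \<alpha> lam A q \<le> ennreal c} = Psi b A ` sublevel \<alpha> lam (max 0 c)"
    using rate_Q_le_iff[OF A \<alpha> lam, of "max 0 c"] Psi_range[OF A]
    by (auto simp: ennreal_max_0 max.commute)
  then show ?thesis
    by (simp add: compact_continuous_image Psi_continuous_on_sublevel[OF A \<alpha> lam] compact_sublevel[OF \<alpha> lam])
qed

lemma good_rate_Q:
  assumes A: "interval_union r A" and \<alpha>: "\<alpha> > 0" and lam: "lam > 0"
  shows "good_rate_function_on {0..1} (rate_Q b \<alpha> lam A)"
  unfolding good_rate_function_on_def lsc_on_def
proof (intro conjI allI)
  fix c :: ennreal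
  show "openin (top_of_set {0..1}) {x \<in> {0..1}. c < rate_Q b \<alpha> lam A x}"
  proof (cases c)
    case (real c')
    have "{x \<in> {0..1}. c < rate_Q b \<alpha> lam A x}
        = {0..1} \<inter> - {q \<in> {0..1}. rate_Q b \<alpha> lam A q \<le> ennreal c'}"
      using real by auto
    then show ?thesis
      using compact_imp_closed[OF rate_Q_sublevel_compact[OF A \<alpha> lam, of c']]
      by (simp add: openin_open_Int open_Compl)
  qed auto
qed (rule rate_Q_sublevel_compact[OF A \<alpha> lam])

text \<open>The compact image of the sublevel set is disjoint from \<open>F\<close>, so it has
  positive distance to \<open>F\<close>. This distance is the room for the approximation error in
  the upper bound.\<close>

lemma rate_Q_separation:
  assumes A: "interval_union r A" and \<alpha>: "\<alpha> > 0" and lam: "lam > 0" and c: "c \<ge> 0"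
    and F: "closed F" and large: "\<And>q. q \<in> F \<Longrightarrow> ennreal c < rate_Q b \<alpha> lam A q"
  obtains \<epsilon> where "\<epsilon> > 0" "\<And>h q. h \<in> sublevel \<alpha> lam c \<Longrightarrow> q \<in> F \<Longrightarrow> \<epsilon> \<le> \<bar>Psi b A h - q\<bar>"
proof -
  have "compact (Psi b A ` sublevel \<alpha> lam c)"
    by (intro compact_continuous_image Psi_continuous_on_sublevel[OF A \<alpha> lam c] compact_sublevel[OF \<alpha> lam c])
  moreover have "Psi b A ` sublevel \<alpha> lam c \<inter> F = {}"
    using rate_Q_le_if_sublevel[OF \<alpha> lam c] large by (auto simp: not_le[symmetric])
  ultimately show ?thesis
    using separate_compact_closed[OF _ F] that by (metis dist_real_def image_eqI)
qed

end


section \<open>Displacements with stretched exponential tails\<close>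

locale displacement_law = real_distribution \<mu> for \<mu> :: "real measure" +
  fixes \<alpha> lam :: real
  assumes \<alpha>: "\<alpha> > 0" and lam: "lam > 0"
    and symmetric: "distr \<mu> borel uminus = \<mu>"
    and tail: "((\<lambda>t. ereal (t powr (- \<alpha>)) * elog (measure \<mu> {t<..})) \<longlongrightarrow> ereal (- lam)) at_top"
begin

lemma tail_bounds:
  assumes "\<eta> > 0"
  shows "\<forall>\<^sub>F t in at_top. exp (- (lam + \<eta>) * t powr \<alpha>) \<le> prob {t<..}"
    and "\<forall>\<^sub>F t in at_top. prob {t<..} \<le> exp (- (lam - \<eta>) * t powr \<alpha>)"
proof -
  have *: "\<forall>\<^sub>F t in at_top. ereal (- (lam + \<eta>)) < ereal (t powr (- \<alpha>)) * elog (prob {t<..})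
      \<and> ereal (t powr (- \<alpha>)) * elog (prob {t<..}) < ereal (- (lam - \<eta>)) \<and> t > 0"
    using assms by (intro eventually_conj order_tendstoD[OF tail] eventually_gt_at_top) auto
  have "\<forall>\<^sub>F t in at_top. exp (- (lam + \<eta>) * t powr \<alpha>) \<le> prob {t<..} \<and> prob {t<..} \<le> exp (- (lam - \<eta>) * t powr \<alpha>)"
    using *
  proof eventually_elim
    case (elim t)
    let ?p = "prob {t<..}"
    have t: "t > 0" and tp: "t powr (- \<alpha>) > 0" "t powr \<alpha> > 0" using elim by auto
    have inv: "t powr (- \<alpha>) * t powr \<alpha> = 1" using t by (simp flip: powr_add)
    \<comment> \<open>A vanishing tail would have logarithm minus infinity, against the finite
      limit.\<close>
    have p: "?p > 0"
    proof (rule ccontr)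
      assume "\<not> ?p > 0"
      then have "ereal (t powr (- \<alpha>)) * elog ?p = - \<infinity>" using tp by (simp add: elog_def not_less)
      then have "ereal (- (lam + \<eta>)) < - \<infinity>" using elim by (simp only:)
      then show False by simp
    qed
    then have l: "- (lam + \<eta>) < t powr (- \<alpha>) * ln ?p" "t powr (- \<alpha>) * ln ?p < - (lam - \<eta>)"
      using elim by (simp_all add: elog_def)
    have "t powr \<alpha> * (t powr (- \<alpha>) * ln ?p) = ln ?p" using inv by (simp add: mult.assoc[symmetric] mult.commute)
    then have "t powr \<alpha> * - (lam + \<eta>) < ln ?p" "ln ?p < t powr \<alpha> * - (lam - \<eta>)"
      using mult_strict_left_mono[OF l(1) tp(2)] mult_strict_left_mono[OF l(2) tp(2)] by argo+
    then have "- (lam + \<eta>) * t powr \<alpha> \<le> ln ?p" "ln ?p \<le> - (lam - \<eta>) * t powr \<alpha>"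
      by (simp_all only: mult.commute[of "t powr \<alpha>"] less_imp_le)
    then show ?case using p by (metis exp_le_cancel_iff exp_ln)
  qed
  then show "\<forall>\<^sub>F t in at_top. exp (- (lam + \<eta>) * t powr \<alpha>) \<le> prob {t<..}"
    and "\<forall>\<^sub>F t in at_top. prob {t<..} \<le> exp (- (lam - \<eta>) * t powr \<alpha>)"
    by (auto elim: eventually_mono)
qed

lemma prob_uminus:
  assumes "B \<in> sets borel"
  shows "prob (uminus -` B) = prob B"
proof -
  have "prob B = measure (distr \<mu> borel uminus) B" by (simp add: symmetric)
  also have "\<dots> = prob (uminus -` B)" using assms by (subst measure_distr) auto
  finally show ?thesis by simp
qed

lemma prob_abs_greater: "t \<ge> 0 \<Longrightarrow> prob {x. \<bar>x\<bar> > t} \<le> 2 * prob {t<..}"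
proof -
  assume "t \<ge> 0"
  have um: "uminus -` {t<..} = {..<- t}" by auto
  have "{x. \<bar>x\<bar> > t} \<subseteq> {t<..} \<union> uminus -` {t<..}" by auto
  then have "prob {x. \<bar>x\<bar> > t} \<le> prob ({t<..} \<union> uminus -` {t<..})"
    by (intro finite_measure_mono) (simp_all add: um)
  also have "\<dots> \<le> prob {t<..} + prob (uminus -` {t<..})"
    by (intro measure_Un_le) (simp_all add: um)
  finally show ?thesis by (simp add: prob_uminus)
qed

lemma exp_moment_finite:
  assumes \<theta>: "0 \<le> \<theta>" "\<theta> < lam"
  shows "(\<integral>\<^sup>+x. ennreal (exp (\<theta> * \<bar>x\<bar> powr \<alpha>)) \<partial>\<mu>) < \<infinity>"
proof -
  define p where "p k = prob {x. \<bar>x\<bar> powr \<alpha> > real k}" for k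
  \<comment> \<open>Giving up half of the gap between \<theta> and \<open>lam\<close> keeps the
    ratio of the dominating geometric series below 1.\<close>
  define \<eta> where "\<eta> = (lam - \<theta>) / 2"
  have \<eta>: "\<eta> > 0" "\<theta> < lam - \<eta>" using \<theta> by (auto simp: \<eta>_def field_simps)
  have m: "{x. \<bar>x\<bar> powr \<alpha> > real k} \<in> sets borel" for k by measurable
  have set_eq: "{x. \<bar>x\<bar> powr \<alpha> > real k} = {x. \<bar>x\<bar> > real k powr (1 / \<alpha>)}" for k
  proof -
    have "\<bar>x\<bar> powr \<alpha> > real k \<longleftrightarrow> \<bar>x\<bar> > real k powr (1 / \<alpha>)" for x :: real
    proof -
      have "\<bar>x\<bar> > real k powr (1 / \<alpha>) \<longleftrightarrow> \<bar>x\<bar> powr \<alpha> > (real k powr (1 / \<alpha>)) powr \<alpha>"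
      proof (cases "\<bar>x\<bar> > real k powr (1 / \<alpha>)")
        case True
        then show ?thesis using powr_less_mono2[OF \<alpha> _ True] by simp
      next
        case False
        then have "\<bar>x\<bar> powr \<alpha> \<le> (real k powr (1 / \<alpha>)) powr \<alpha>" using \<alpha> by (intro powr_mono2) auto
        then show ?thesis using False by (simp add: not_less)
      qed
      also have "(real k powr (1 / \<alpha>)) powr \<alpha> = real k" using \<alpha> by (simp add: powr_powr)
      finally show ?thesis by simp
    qed
    then show ?thesis by simp
  qed
  have "filterlim (\<lambda>k. real k powr (1 / \<alpha>)) at_top sequentially"
    using \<alpha> by real_asymp
  from eventually_compose_filterlim[OF tail_bounds(2)[OF \<eta>(1)] this]
  have "\<forall>\<^sub>F k in sequentially. norm (exp (\<theta> * (real k + 1)) * p k) \<le> 2 * exp \<theta> * exp (- (lam - \<eta> - \<theta>)) ^ k"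
  proof eventually_elim
    case (elim k)
    have "p k \<le> 2 * prob {real k powr (1 / \<alpha>)<..}"
      unfolding p_def set_eq by (rule prob_abs_greater) simp
    also have "\<dots> \<le> 2 * exp (- (lam - \<eta>) * real k)"
      using elim \<alpha> by (simp add: powr_powr)
    finally have "exp (\<theta> * (real k + 1)) * p k \<le> exp (\<theta> * (real k + 1)) * (2 * exp (- (lam - \<eta>) * real k))"
      by (intro mult_left_mono) auto
    also have "\<dots> = 2 * exp \<theta> * exp (- (lam - \<eta> - \<theta>)) ^ k"
      by (simp add: exp_of_nat_mult[symmetric] exp_add[symmetric] algebra_simps)
    finally show ?case by (simp add: p_def)
  qed
  moreover have "summable (\<lambda>k. 2 * exp \<theta> * exp (- (lam - \<eta> - \<theta>)) ^ k)"
    using \<eta> by (intro summable_mult summable_geometric) auto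
  ultimately have sum: "summable (\<lambda>k. exp (\<theta> * (real k + 1)) * p k)"
    by (rule summable_comparison_test_ev)
  \<comment> \<open>The real line is sliced at the integer levels of
    \<open>\<bar>x\<bar> powr \<alpha>\<close>; on the slice (k, k + 1] the exponential is at most
    its value at the upper end.\<close>
  let ?f = "\<lambda>k x. ennreal (exp (\<theta> * (real k + 1))) * indicator {x. \<bar>x\<bar> powr \<alpha> > real k} x"
  have "ennreal (exp (\<theta> * \<bar>x\<bar> powr \<alpha>)) \<le> 1 + (\<Sum>k. ?f k x)" for x
  proof (cases "x = 0")
    case False
    then have y: "\<bar>x\<bar> powr \<alpha> > 0" by simp
    \<comment> \<open>Ceiling minus one puts \<open>\<bar>x\<bar> powr \<alpha>\<close> strictly
      above k, as the indicator demands. The point 0 lies in no slice and is covered by the summand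
      1.\<close>
    define k where "k = nat (\<lceil>\<bar>x\<bar> powr \<alpha>\<rceil> - 1)"
    have "real k = of_int \<lceil>\<bar>x\<bar> powr \<alpha>\<rceil> - 1" using y unfolding k_def by (simp add: of_nat_nat)
    then have k: "real k < \<bar>x\<bar> powr \<alpha>" "\<bar>x\<bar> powr \<alpha> \<le> real k + 1" by linarith+
    have "ennreal (exp (\<theta> * \<bar>x\<bar> powr \<alpha>)) \<le> ?f k x"
      using k \<theta> by (auto intro!: ennreal_leI mult_left_mono)
    also have "\<dots> \<le> (\<Sum>k. ?f k x)"
    proof -
      have "g k \<le> suminf g" for g :: "nat \<Rightarrow> ennreal"
        using sum_le_suminf[of g "{k}"] by simp
      then show ?thesis .
    qed
    also have "\<dots> \<le> 1 + (\<Sum>k. ?f k x)" by simp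
    finally show ?thesis .
  qed simp
  then have "(\<integral>\<^sup>+x. ennreal (exp (\<theta> * \<bar>x\<bar> powr \<alpha>)) \<partial>\<mu>) \<le> (\<integral>\<^sup>+x. 1 + (\<Sum>k. ?f k x) \<partial>\<mu>)"
    by (intro nn_integral_mono)
  also have "\<dots> = 1 + (\<Sum>k. ennreal (exp (\<theta> * (real k + 1))) * emeasure \<mu> {x. \<bar>x\<bar> powr \<alpha> > real k})"
    using m emeasure_space_1 by (simp add: nn_integral_add nn_integral_suminf nn_integral_cmult_indicator)
  also have "\<dots> = 1 + (\<Sum>k. ennreal (exp (\<theta> * (real k + 1)) * p k))"
    by (simp add: p_def emeasure_eq_measure ennreal_mult)
  also have "\<dots> < \<infinity>"
    using sum by (subst suminf_ennreal2) (auto simp: p_def)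
  finally show ?thesis .
qed

lemma exp_moment_real:
  assumes \<theta>: "0 \<le> \<theta>" "\<theta> < lam"
  obtains m where "m \<ge> 1" "(\<integral>\<^sup>+x. ennreal (exp (\<theta> * \<bar>x\<bar> powr \<alpha>)) \<partial>\<mu>) = ennreal m"
proof -
  have "(\<integral>\<^sup>+x. 1 \<partial>\<mu>) \<le> (\<integral>\<^sup>+x. ennreal (exp (\<theta> * \<bar>x\<bar> powr \<alpha>)) \<partial>\<mu>)"
    using \<theta> by (intro nn_integral_mono) auto
  then have "1 \<le> (\<integral>\<^sup>+x. ennreal (exp (\<theta> * \<bar>x\<bar> powr \<alpha>)) \<partial>\<mu>)"
    using emeasure_space_1 by simp
  then show ?thesis using exp_moment_finite[OF \<theta>] that
    by (cases "\<integral>\<^sup>+x. ennreal (exp (\<theta> * \<bar>x\<bar> powr \<alpha>)) \<partial>\<mu>") (auto simp: ennreal_ge_1)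
qed

text \<open>By convexity \<open>exp (w * y)\<close> is at most \<open>(1 - w) + w * exp y\<close>.
  The logarithm of the moment is thus bounded linearly in the weight, so a product over vertices is
  governed by the total weight instead of the number of vertices.\<close>

lemma exp_moment_weighted:
  assumes \<theta>: "0 \<le> \<theta>" and m: "m \<ge> 1" "(\<integral>\<^sup>+x. ennreal (exp (\<theta> * \<bar>x\<bar> powr \<alpha>)) \<partial>\<mu>) = ennreal m"
    and w: "0 \<le> w" "w \<le> 1"
  shows "(\<integral>\<^sup>+x. ennreal (exp (\<theta> * (w * \<bar>x\<bar> powr \<alpha>))) \<partial>\<mu>) \<le> ennreal (exp ((m - 1) * w))"
proof -
  have "exp (w * y) \<le> (1 - w) + w * exp y" for y :: real
    using convex_onD[OF convex_on_exp[of 1], of w 0 y] w by simp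
  from this[of "\<theta> * \<bar>x\<bar> powr \<alpha>" for x] have "(\<integral>\<^sup>+x. ennreal (exp (\<theta> * (w * \<bar>x\<bar> powr \<alpha>))) \<partial>\<mu>)
      \<le> (\<integral>\<^sup>+x. ennreal (1 - w) + ennreal w * ennreal (exp (\<theta> * \<bar>x\<bar> powr \<alpha>)) \<partial>\<mu>)"
    using w by (intro nn_integral_mono) (auto simp: ennreal_mult[symmetric] ennreal_plus[symmetric] mult.left_commute simp del: ennreal_plus intro!: ennreal_leI)
  also have "\<dots> = ennreal (1 - w) + ennreal w * ennreal m"
    using emeasure_space_1 by (simp add: nn_integral_add nn_integral_cmult m)
  also have "\<dots> = ennreal (1 + (m - 1) * w)"
    using w m by (simp add: ennreal_mult[symmetric] ennreal_plus[symmetric] algebra_simps del: ennreal_plus)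
  also have "\<dots> \<le> ennreal (exp ((m - 1) * w))" by (intro ennreal_leI exp_ge_add_one_self)
  finally show ?thesis .
qed

text \<open>With h < h1 < h2 < h + \<delta>, the event contains the difference of the tails beyond
  h1 and h2 (times sqrt n), and the second tail is exponentially smaller than the first. Choosing h1
  strictly to the right of h keeps it positive when h = 0, so that the tail asymptotics
  apply.\<close>

lemma local_lower_bound_nonneg:
  assumes h: "h \<ge> 0" and \<delta>: "\<delta> > 0" and \<epsilon>: "\<epsilon> > 0"
  shows "\<forall>\<^sub>F n in sequentially. exp (- (lam * h powr \<alpha> + \<epsilon>) * real n powr (\<alpha> / 2))
    \<le> prob {x. \<bar>x / sqrt (real n) - h\<bar> < \<delta>}"
proof -
  have "((\<lambda>x. lam * x powr \<alpha>) \<longlongrightarrow> lam * h powr \<alpha>) (at_right h)"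
    using \<alpha> h by (intro tendsto_intros tendsto_powr2) (auto simp: eventually_at_right_less[THEN eventually_mono])
  then have "\<forall>\<^sub>F x in at_right h. lam * x powr \<alpha> < lam * h powr \<alpha> + \<epsilon> / 4"
    using \<epsilon> by (intro order_tendstoD) auto
  moreover have "\<forall>\<^sub>F x in at_right h. x < h + \<delta> \<and> h < x"
    using \<delta> by (intro eventually_conj eventually_at_right_less) (auto simp: eventually_at_right_field intro: exI[of _ "h + \<delta>"])
  ultimately have "\<forall>\<^sub>F x in at_right h. lam * x powr \<alpha> < lam * h powr \<alpha> + \<epsilon> / 4 \<and> x < h + \<delta> \<and> h < x"
    by (rule eventually_conj)
  then obtain h1 where h1: "lam * h1 powr \<alpha> < lam * h powr \<alpha> + \<epsilon> / 4" "h1 < h + \<delta>" "h < h1"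
    using eventually_happens trivial_limit_at_right_real by blast
  define h2 where "h2 = (h1 + (h + \<delta>)) / 2"
  have h2: "h1 < h2" "h2 < h + \<delta>" using h1 by (auto simp: h2_def)
  have pos: "0 < h1" "0 < h2" using h h1 h2 by auto
  have p12: "h1 powr \<alpha> < h2 powr \<alpha>" using \<alpha> pos h2 by (intro powr_less_mono2) auto
  have "((\<lambda>\<eta>. (lam + \<eta>) * h1 powr \<alpha>) \<longlongrightarrow> (lam + 0) * h1 powr \<alpha>) (at_right 0)"
    by (intro tendsto_intros)
  then have e1: "\<forall>\<^sub>F \<eta> in at_right 0. (lam + \<eta>) * h1 powr \<alpha> < lam * h1 powr \<alpha> + \<epsilon> / 4"
    using \<epsilon> by (intro order_tendstoD) auto
  have lim2: "((\<lambda>\<eta>. (lam - \<eta>) * h2 powr \<alpha> - (lam + \<eta>) * h1 powr \<alpha>) \<longlongrightarrow> (lam - 0) * h2 powr \<alpha> - (lam + 0) * h1 powr \<alpha>) (at_right 0)"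
    by (intro tendsto_intros)
  have e2: "\<forall>\<^sub>F \<eta> in at_right 0. 0 < (lam - \<eta>) * h2 powr \<alpha> - (lam + \<eta>) * h1 powr \<alpha>"
    by (rule order_tendstoD(1)[OF lim2]) (use p12 lam in simp)
  \<comment> \<open>The tail error \<eta> must be small enough to cost at most \<epsilon> / 4 at h1
    and not to reverse the order of the two tail exponents.\<close>
  obtain \<eta> where \<eta>: "\<eta> > 0" "(lam + \<eta>) * h1 powr \<alpha> < lam * h1 powr \<alpha> + \<epsilon> / 4"
    "0 < (lam - \<eta>) * h2 powr \<alpha> - (lam + \<eta>) * h1 powr \<alpha>"
    using eventually_happens[OF eventually_conj[OF eventually_at_right_less[of 0] eventually_conj[OF e1 e2]]]
      trivial_limit_at_right_real[of 0] by blast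
  define a where "a = (lam + \<eta>) * h1 powr \<alpha>"
  define c where "c = (lam - \<eta>) * h2 powr \<alpha>"
  have ac: "a < c" "a < lam * h powr \<alpha> + \<epsilon> / 2" using \<eta> h1 by (auto simp: a_def c_def)
  have lim: "filterlim (\<lambda>n. y * sqrt (real n)) at_top sequentially" if "y > 0" for y
    using that by real_asymp
  have pw: "(y * sqrt (real n)) powr \<alpha> = y powr \<alpha> * real n powr (\<alpha> / 2)" if "y > 0" for y n
    using that by (simp add: powr_mult powr_half_sqrt[symmetric] powr_powr)
  have s: "filterlim (\<lambda>n. real n powr (\<alpha> / 2)) at_top sequentially"
    using \<alpha> by real_asymp
  \<comment> \<open>The choices of h1 and \<eta> use \<epsilon> / 2 of the allowed exponent; the
    remaining \<epsilon> / 2 absorbs the factor \<open>1 - exp (- (c - a) * sn)\<close> left by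
    subtracting the tails.\<close>
  have "(\<lambda>n. exp (- (c - a) * real n powr (\<alpha> / 2)) + exp (- (\<epsilon> / 2) * real n powr (\<alpha> / 2))) \<longlonglongrightarrow> 0"
  proof -
    have "(\<lambda>n. exp (- k * real n powr (\<alpha> / 2))) \<longlonglongrightarrow> 0" if "k > 0" for k
      using that \<alpha> by real_asymp
    from tendsto_add[OF this[of "c - a"] this[of "\<epsilon> / 2"]] show ?thesis using ac \<epsilon> by simp
  qed
  then have "\<forall>\<^sub>F n in sequentially. exp (- (c - a) * real n powr (\<alpha> / 2)) + exp (- (\<epsilon> / 2) * real n powr (\<alpha> / 2)) < 1"
    by (intro order_tendstoD) auto
  with eventually_compose_filterlim[OF tail_bounds(1)[OF \<eta>(1)] lim[OF pos(1)]]
    eventually_compose_filterlim[OF tail_bounds(2)[OF \<eta>(1)] lim[OF pos(2)]] eventually_gt_at_top[of 0]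
  show ?thesis
  proof eventually_elim
    case (elim n)
    define sn where "sn = real n powr (\<alpha> / 2)"
    have low: "exp (- a * sn) \<le> prob {h1 * sqrt (real n)<..}"
      using elim(1) unfolding pw[OF pos(1), of n] a_def sn_def by (simp only: mult.assoc mult_minus_left)
    have up: "prob {h2 * sqrt (real n)<..} \<le> exp (- c * sn)"
      using elim(2) unfolding pw[OF pos(2), of n] c_def sn_def by (simp only: mult.assoc mult_minus_left)
    have n: "sqrt (real n) > 0" using elim by simp
    have sub: "{h1 * sqrt (real n)<..} - {h2 * sqrt (real n)<..} \<subseteq> {x. \<bar>x / sqrt (real n) - h\<bar> < \<delta>}"
    proof
      fix x assume "x \<in> {h1 * sqrt (real n)<..} - {h2 * sqrt (real n)<..}"
      then have "h1 < x / sqrt (real n)" "x / sqrt (real n) \<le> h2"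
        using n by (auto simp: pos_less_divide_eq pos_divide_le_eq)
      then show "x \<in> {x. \<bar>x / sqrt (real n) - h\<bar> < \<delta>}" using h1 h2 by auto
    qed
    have "exp (- (lam * h powr \<alpha> + \<epsilon>) * sn) \<le> exp (- a * sn) * exp (- (\<epsilon> / 2) * sn)"
    proof -
      have "a * sn \<le> (lam * h powr \<alpha> + \<epsilon> / 2) * sn"
        using ac by (intro mult_right_mono) (auto simp: sn_def)
      then show ?thesis by (simp flip: exp_add add: algebra_simps)
    qed
    also have "\<dots> \<le> exp (- a * sn) * (1 - exp (- (c - a) * sn))"
      using elim(4) by (intro mult_left_mono) (auto simp: sn_def)
    also have "\<dots> = exp (- a * sn) - exp (- c * sn)"
      by (simp add: right_diff_distrib algebra_simps flip: exp_add)
    also have "\<dots> \<le> prob {h1 * sqrt (real n)<..} - prob {h2 * sqrt (real n)<..}"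
      using low up by simp
    also have "\<dots> = prob ({h1 * sqrt (real n)<..} - {h2 * sqrt (real n)<..})"
      using n h2 by (subst finite_measure_Diff) (auto intro: less_imp_le order.strict_trans1[OF mult_right_mono])
    also have "\<dots> \<le> prob {x. \<bar>x / sqrt (real n) - h\<bar> < \<delta>}"
      by (intro finite_measure_mono sub) (simp add: events_eq_borel)
    finally show ?case by (simp add: sn_def)
  qed
qed

lemma local_lower_bound:
  assumes \<delta>: "\<delta> > 0" and \<epsilon>: "\<epsilon> > 0"
  shows "\<forall>\<^sub>F n in sequentially. exp (- (lam * \<bar>h\<bar> powr \<alpha> + \<epsilon>) * real n powr (\<alpha> / 2))
    \<le> prob {x. \<bar>x / sqrt (real n) - h\<bar> < \<delta>}"
proof (cases "h \<ge> 0")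
  case True
  then show ?thesis using local_lower_bound_nonneg[OF True \<delta> \<epsilon>] by simp
next
  case False
  have eq: "prob {x. \<bar>x / sqrt (real n) - h\<bar> < \<delta>} = prob {x. \<bar>x / sqrt (real n) - \<bar>h\<bar>\<bar> < \<delta>}" for n
  proof -
    have "uminus -` {x. \<bar>x / sqrt (real n) - \<bar>h\<bar>\<bar> < \<delta>} = {x. \<bar>x / sqrt (real n) - h\<bar> < \<delta>}"
      using False by (auto simp: abs_real_def algebra_simps split: if_splits)
    then show ?thesis using prob_uminus[of "{x. \<bar>x / sqrt (real n) - \<bar>h\<bar>\<bar> < \<delta>}"] by simp
  qed
  show ?thesis unfolding eq by (rule local_lower_bound_nonneg[OF _ \<delta> \<epsilon>]) simp
qed

end


section \<open>The branching random walk\<close>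

text \<open>The singleton blocks \<open>{f j}\<close> are disjoint by injectivity, and evaluation
  recovers the variable from its block.\<close>

lemma (in prob_space) indep_vars_reindex:
  assumes X: "indep_vars M' X I" and f: "inj_on f J" "f ` J \<subseteq> I"
  shows "indep_vars (\<lambda>j. M' (f j)) (\<lambda>j. X (f j)) J"
proof -
  have "indep_vars (\<lambda>j. PiM {f j} M') (\<lambda>j \<omega>. restrict (\<lambda>i. X i \<omega>) {f j}) J"
    by (rule indep_vars_restrict[OF X]) (use f in \<open>auto simp: disjoint_family_on_def inj_on_def\<close>)
  then have "indep_vars (\<lambda>j. M' (f j)) (\<lambda>j \<omega>. (\<lambda>g. g (f j)) (restrict (\<lambda>i. X i \<omega>) {f j})) J"
    by (rule indep_vars_compose2) auto
  then show ?thesis by simp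
qed

context regular_tree
begin

lemma tree_append: "v @ w \<in> tree b \<longleftrightarrow> v \<in> tree b \<and> w \<in> tree b"
  unfolding tree_def mem_Collect_eq set_append Un_subset_iff ..

lemma tree_take: "v \<in> tree b \<Longrightarrow> take k v \<in> tree b"
  by (metis append_take_drop_id tree_append)

lemma level_mean_append: "level_mean (L + m) f = level_mean L (\<lambda>v. level_mean m (\<lambda>w. f (v @ w)))"
proof -
  have "bij_betw (\<lambda>(v, w). v @ w) (level b L \<times> level b m) (level b (L + m))"
  proof (rule bij_betw_byWitness[where f'="\<lambda>u. (take L u, drop L u)"])
    show "(\<lambda>u. (take L u, drop L u)) ` level b (L + m) \<subseteq> level b L \<times> level b m"
      by (auto simp: level_eq dest!: in_set_takeD in_set_dropD)
    show "(\<lambda>(v, w). v @ w) ` (level b L \<times> level b m) \<subseteq> level b (L + m)"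
      by (auto simp: level_def tree_append)
  qed (auto simp: level_eq)
  then have "(\<Sum>u\<in>level b (L + m). f u) = (\<Sum>p\<in>level b L \<times> level b m. f (case p of (v, w) \<Rightarrow> v @ w))"
    by (rule sum.reindex_bij_betw[symmetric])
  also have "\<dots> = (\<Sum>v\<in>level b L. \<Sum>w\<in>level b m. f (v @ w))"
    by (simp add: sum.cartesian_product case_prod_unfold)
  finally show ?thesis
    by (simp add: level_mean_def power_add mult.assoc sum_distrib_left[symmetric])
qed

lemma path_sum_snoc: "path_sum h (u @ [i]) = path_sum h u + h (u @ [i])"
  by (simp add: path_sum_def)

lemma path_sum_append: "path_sum h (v @ w) = path_sum h v + path_sum (\<lambda>w'. h (v @ w')) w"
proof (induction w rule: rev_induct)
  case Nil
  then show ?case by (simp add: path_sum_def)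
next
  case (snoc i w)
  then show ?case using path_sum_snoc[of h "v @ w" i] by (simp add: path_sum_snoc)
qed

text \<open>The ancestors of \<open>u\<close> other than the root are its nonempty prefixes, which
  correspond to their lengths.\<close>

lemma position_eq: "position \<xi> u \<omega> = path_sum (\<lambda>v. \<xi> v \<omega>) u"
proof -
  have "bij_betw (\<lambda>k. take (Suc k) u) {..<length u} {v. strict_prefix [] v \<and> prefix v u}"
  proof (rule bij_betw_byWitness[where f'="\<lambda>v. length v - 1"])
    show "\<forall>v\<in>{v. strict_prefix [] v \<and> prefix v u}. take (Suc (length v - 1)) u = v"
    proof
      fix v assume "v \<in> {v. strict_prefix [] v \<and> prefix v u}"
      then show "take (Suc (length v - 1)) u = v" by (cases v) (auto simp: prefix_def)
    qed
    show "(\<lambda>k. take (Suc k) u) ` {..<length u} \<subseteq> {v. strict_prefix [] v \<and> prefix v u}"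
      by (cases u) (auto simp: take_is_prefix strict_prefix_def)
    show "(\<lambda>v. length v - 1) ` {v. strict_prefix [] v \<and> prefix v u} \<subseteq> {..<length u}"
    proof clarify
      fix v assume "strict_prefix [] v" "prefix v u"
      then show "length v - 1 < length u" using prefix_length_le[of v u] by (cases v) auto
    qed
  qed auto
  then show ?thesis
    unfolding position_def path_sum_def by (rule sum.reindex_bij_betw[symmetric])
qed

lemma brw_empirical_eq: "brw_empirical b \<xi> n \<omega> B = level_mean n (\<lambda>u. indicator B (path_sum (\<lambda>v. \<xi> v \<omega>) u))"
  by (simp add: brw_empirical_def brw_count_def position_eq card_level level_mean_def power_one_over field_simps)

end

locale branching_walk = regular_tree b + displacement_law \<mu> \<alpha> lam + W: prob_space M
  for b :: nat and \<mu> :: "real measure" and \<alpha> lam :: real and M :: "'w measure" +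
  fixes \<xi> :: "nat list \<Rightarrow> 'w \<Rightarrow> real"
  assumes indep: "W.indep_vars (\<lambda>_. borel) \<xi> (tree b - {[]})"
    and law: "\<And>v. v \<in> tree b - {[]} \<Longrightarrow> distr M borel (\<xi> v) = \<mu>"
    and mean: "(\<integral>x. x \<partial>\<mu>) = 0"
    and variance: "integrable \<mu> (\<lambda>x. x\<^sup>2)" "(\<integral>x. x\<^sup>2 \<partial>\<mu>) = 1"
begin

lemma \<xi>_measurable: "v \<in> tree b - {[]} \<Longrightarrow> \<xi> v \<in> borel_measurable M"
  using indep unfolding W.indep_vars_def by auto

lemma nn_integral_\<xi>:
  assumes "v \<in> tree b - {[]}" "f \<in> borel_measurable borel"
  shows "(\<integral>\<^sup>+\<omega>. f (\<xi> v \<omega>) \<partial>M) = (\<integral>\<^sup>+x. f x \<partial>\<mu>)"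
  unfolding law[OF assms(1), symmetric]
  by (rule nn_integral_distr[symmetric]) (use assms \<xi>_measurable in auto)

lemma prob_\<xi>:
  assumes "v \<in> tree b - {[]}" "B \<in> sets borel"
  shows "W.prob {\<omega> \<in> space M. \<xi> v \<omega> \<in> B} = prob B"
  unfolding law[OF assms(1), symmetric]
  by (subst measure_distr) (use assms \<xi>_measurable in \<open>auto simp: vimage_def Int_def conj_commute\<close>)

text \<open>Chernoff's inequality, used in two regimes: unit weights on finitely many generations
  with \<theta> close to \<open>lam\<close>, which gives the sharp rate, and discounted weights up
  to the cut level with \<theta> = lam / 2, which gives a crude bound uniform in depth.\<close>

lemma weighted_energy_tail:
  assumes V: "finite V" "V \<subseteq> tree b - {[]}" and \<theta>: "0 \<le> \<theta>"
    and m: "m \<ge> 1" "(\<integral>\<^sup>+x. ennreal (exp (\<theta> * \<bar>x\<bar> powr \<alpha>)) \<partial>\<mu>) = ennreal m"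
    and w: "\<And>v. v \<in> V \<Longrightarrow> 0 \<le> w v \<and> w v \<le> 1"
  shows "W.prob {\<omega> \<in> space M. y \<le> (\<Sum>v\<in>V. w v * \<bar>\<xi> v \<omega>\<bar> powr \<alpha>)}
    \<le> exp (- \<theta> * y + (m - 1) * (\<Sum>v\<in>V. w v))"
proof -
  have ms [measurable]: "\<xi> v \<in> borel_measurable M" if "v \<in> V" for v using that V \<xi>_measurable by auto
  let ?S = "\<lambda>\<omega>. \<Sum>v\<in>V. w v * \<bar>\<xi> v \<omega>\<bar> powr \<alpha>"
  let ?g = "\<lambda>v \<omega>. ennreal (exp (\<theta> * (w v * \<bar>\<xi> v \<omega>\<bar> powr \<alpha>)))"
  have "W.indep_vars (\<lambda>_. borel) (\<lambda>v \<omega>. (\<lambda>x. ennreal (exp (\<theta> * (w v * \<bar>x\<bar> powr \<alpha>)))) (\<xi> v \<omega>)) V"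
    by (rule W.indep_vars_compose2[OF W.indep_vars_subset[OF indep V(2)]]) measurable
  then have ind: "W.indep_vars (\<lambda>_. borel) ?g V" .
  have "{\<omega> \<in> space M. y \<le> ?S \<omega>} \<subseteq> {\<omega> \<in> space M. 1 \<le> ennreal (exp (- \<theta> * y)) * (\<Prod>v\<in>V. ?g v \<omega>)}"
  proof clarify
    fix \<omega> assume y: "y \<le> ?S \<omega>"
    have "ennreal (exp (- \<theta> * y)) * (\<Prod>v\<in>V. ?g v \<omega>) = ennreal (exp (- \<theta> * y) * exp (\<theta> * ?S \<omega>))"
      using V by (simp add: prod_ennreal ennreal_mult[symmetric] prod_nonneg exp_sum sum_distrib_left)
    also have "\<dots> = ennreal (exp (\<theta> * (?S \<omega> - y)))" by (simp add: algebra_simps flip: exp_add)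
    also have "1 \<le> \<dots>" using y \<theta> by (simp add: ennreal_ge_1)
    finally show "1 \<le> ennreal (exp (- \<theta> * y)) * (\<Prod>v\<in>V. ?g v \<omega>)" .
  qed
  then have "emeasure M {\<omega> \<in> space M. y \<le> ?S \<omega>}
      \<le> emeasure M {\<omega> \<in> space M. 1 \<le> ennreal (exp (- \<theta> * y)) * (\<Prod>v\<in>V. ?g v \<omega>)}"
    using V by (intro emeasure_mono) measurable
  also have "\<dots> \<le> ennreal (exp (- \<theta> * y)) * (\<integral>\<^sup>+\<omega>. (\<Prod>v\<in>V. ?g v \<omega>) * indicator (space M) \<omega> \<partial>M)"
    using V by (intro nn_integral_Markov_inequality) measurable
  also have "(\<integral>\<^sup>+\<omega>. (\<Prod>v\<in>V. ?g v \<omega>) * indicator (space M) \<omega> \<partial>M) = (\<integral>\<^sup>+\<omega>. (\<Prod>v\<in>V. ?g v \<omega>) \<partial>M)"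
    by (intro nn_integral_cong) auto
  also have "\<dots> = (\<Prod>v\<in>V. \<integral>\<^sup>+\<omega>. ?g v \<omega> \<partial>M)"
    by (rule W.indep_vars_nn_integral[OF V(1) ind]) simp
  also have "\<dots> = (\<Prod>v\<in>V. \<integral>\<^sup>+x. ennreal (exp (\<theta> * (w v * \<bar>x\<bar> powr \<alpha>))) \<partial>\<mu>)"
    using V by (intro prod.cong refl nn_integral_\<xi>[where f="\<lambda>x. ennreal (exp (\<theta> * (w _ * \<bar>x\<bar> powr \<alpha>)))"]) auto
  also have "\<dots> \<le> (\<Prod>v\<in>V. ennreal (exp ((m - 1) * w v)))"
    using exp_moment_weighted[OF \<theta> m] w by (intro prod_mono_ennreal) auto
  also have "\<dots> = ennreal (exp ((m - 1) * (\<Sum>v\<in>V. w v)))"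
    using V by (simp add: prod_ennreal exp_sum sum_distrib_left)
  finally have "emeasure M {\<omega> \<in> space M. y \<le> ?S \<omega>} \<le> ennreal (exp (- \<theta> * y)) * ennreal (exp ((m - 1) * (\<Sum>v\<in>V. w v)))"
    by (simp add: mult_left_mono)
  then show ?thesis
    by (simp add: W.emeasure_eq_measure ennreal_mult[symmetric] flip: exp_add)
qed

text \<open>Independence multiplies the one-vertex bounds, each of which receives an equal share of
  \<epsilon>. The set \<open>V\<close> stays fixed while n grows, so finitely many eventual
  statements can be combined.\<close>

lemma local_lower_bound_tree:
  assumes V: "finite V" "V \<subseteq> tree b - {[]}" and \<delta>: "\<delta> > 0" and \<epsilon>: "\<epsilon> > 0"
  shows "\<forall>\<^sub>F n in sequentially. exp (- (lam * (\<Sum>v\<in>V. \<bar>h v\<bar> powr \<alpha>) + \<epsilon>) * real n powr (\<alpha> / 2))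
    \<le> W.prob {\<omega> \<in> space M. \<forall>v\<in>V. \<bar>\<xi> v \<omega> / sqrt (real n) - h v\<bar> < \<delta>}"
proof (cases "V = {}")
  case True
  then show ?thesis using \<epsilon> W.prob_space by simp
next
  case False
  define e where "e = \<epsilon> / card V"
  have e: "e > 0" using V False \<epsilon> by (simp add: e_def card_gt_0_iff)
  have "\<forall>\<^sub>F n in sequentially. \<forall>v\<in>V. exp (- (lam * \<bar>h v\<bar> powr \<alpha> + e) * real n powr (\<alpha> / 2))
      \<le> prob {x. \<bar>x / sqrt (real n) - h v\<bar> < \<delta>}"
    using V local_lower_bound[OF \<delta> e] by (intro eventually_ball_finite) auto
  then show ?thesis
  proof eventually_elim
    case (elim n)
    define B where "B v = {x. \<bar>x / sqrt (real n) - h v\<bar> < \<delta>}" for v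
    have B: "B v \<in> sets borel" for v unfolding B_def by measurable
    have "{\<omega> \<in> space M. \<forall>v\<in>V. \<bar>\<xi> v \<omega> / sqrt (real n) - h v\<bar> < \<delta>} = (\<Inter>v\<in>V. \<xi> v -` B v \<inter> space M)"
      using False by (auto simp: B_def)
    also have "W.prob \<dots> = (\<Prod>v\<in>V. W.prob (\<xi> v -` B v \<inter> space M))"
      by (rule W.indep_varsD_finite[OF W.indep_vars_subset[OF indep V(2)] False V(1)]) (use B in auto)
    also have "\<dots> = (\<Prod>v\<in>V. prob (B v))"
    proof (rule prod.cong)
      fix v assume "v \<in> V"
      then have "W.prob {\<omega> \<in> space M. \<xi> v \<omega> \<in> B v} = prob (B v)" using V B by (intro prob_\<xi>) auto
      moreover have "{\<omega> \<in> space M. \<xi> v \<omega> \<in> B v} = \<xi> v -` B v \<inter> space M" by auto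
      ultimately show "W.prob (\<xi> v -` B v \<inter> space M) = prob (B v)" by simp
    qed simp
    finally have eq: "W.prob {\<omega> \<in> space M. \<forall>v\<in>V. \<bar>\<xi> v \<omega> / sqrt (real n) - h v\<bar> < \<delta>} = (\<Prod>v\<in>V. prob (B v))" .
    have "(\<Prod>v\<in>V. exp (- (lam * \<bar>h v\<bar> powr \<alpha> + e) * real n powr (\<alpha> / 2))) \<le> (\<Prod>v\<in>V. prob (B v))"
      using elim by (intro prod_mono) (auto simp: B_def)
    moreover have "(\<Sum>v\<in>V. - (lam * \<bar>h v\<bar> powr \<alpha> + e) * real n powr (\<alpha> / 2))
        = - (lam * (\<Sum>v\<in>V. \<bar>h v\<bar> powr \<alpha>) + \<epsilon>) * real n powr (\<alpha> / 2)"
    proof -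
      have "(\<Sum>v\<in>V. lam * \<bar>h v\<bar> powr \<alpha> + e) = lam * (\<Sum>v\<in>V. \<bar>h v\<bar> powr \<alpha>) + \<epsilon>"
        using V False by (simp add: sum.distrib sum_distrib_left e_def card_gt_0_iff)
      then show ?thesis by (simp only: sum_negf sum_distrib_right[symmetric])
    qed
    ultimately show ?case unfolding eq using V by (simp add: exp_sum[symmetric])
  qed
qed

section \<open>The law of a single path and its Gaussian approximation\<close>

definition spine :: "nat \<Rightarrow> nat list" where
  "spine i = replicate (Suc i) 1"

lemma spine: "inj spine" "range spine \<subseteq> tree b - {[]}"
proof -
  show "inj spine" by (rule inj_on_inverseI[where g="\<lambda>v. length v - 1"]) (simp add: spine_def)
  show "range spine \<subseteq> tree b - {[]}" using b by (auto simp: spine_def tree_def)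
qed

definition spine_walk :: "nat \<Rightarrow> 'w \<Rightarrow> real" where
  "spine_walk m \<omega> = (\<Sum>i<m. \<xi> (spine i) \<omega>)"

definition walk_prob :: "nat \<Rightarrow> real set \<Rightarrow> real \<Rightarrow> real" where
  "walk_prob m B s = W.prob {\<omega> \<in> space M. s + spine_walk m \<omega> \<in> B}"

lemma spine_walk_measurable [measurable]: "spine_walk m \<in> borel_measurable M"
  unfolding spine_walk_def using spine by (intro borel_measurable_sum \<xi>_measurable) auto

text \<open>The right side does not mention \<open>f\<close>: any injective choice of m vertices
  gives the same law. The walk along \<open>spine\<close> can therefore represent every path of the
  tree.\<close>

lemma distr_path_sum:
  fixes f :: "nat \<Rightarrow> nat list"
  assumes f: "inj_on f {..<m}" "f ` {..<m} \<subseteq> tree b - {[]}"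
  shows "distr M borel (\<lambda>\<omega>. \<Sum>i<m. \<xi> (f i) \<omega>) = distr (PiM {..<m} (\<lambda>_. \<mu>)) borel (\<lambda>x. \<Sum>i<m. x i)"
\<comment> \<open>The characterisation of independence by a product law requires a nonempty index
  set.\<close>
proof (cases "m = 0")
  case True
  interpret P: prob_space "PiM {} (\<lambda>_::nat. \<mu>)" by (intro prob_space_PiM) auto
  have "distr M borel (\<lambda>\<omega>. 0::real) = return borel 0"
    by (intro W.distr_const) simp
  moreover have "distr (PiM {} (\<lambda>_::nat. \<mu>)) borel (\<lambda>\<omega>. 0::real) = return borel 0"
    by (intro P.distr_const) simp
  ultimately show ?thesis using True by simp
next
  case False
  have rv: "\<xi> (f i) \<in> borel_measurable M" if "i < m" for i using f that by (intro \<xi>_measurable) auto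
  have "W.indep_vars (\<lambda>_. borel) (\<lambda>i. \<xi> (f i)) {..<m}"
    using W.indep_vars_reindex[OF indep f] .
  then have "distr M (PiM {..<m} (\<lambda>_. borel)) (\<lambda>\<omega>. \<lambda>i\<in>{..<m}. \<xi> (f i) \<omega>) = PiM {..<m} (\<lambda>i. distr M borel (\<xi> (f i)))"
    by (subst (asm) W.indep_vars_iff_distr_eq_PiM') (use False rv in auto)
  also have "\<dots> = PiM {..<m} (\<lambda>_. \<mu>)" using f by (intro PiM_cong refl law) auto
  finally have *: "PiM {..<m} (\<lambda>_. \<mu>) = distr M (PiM {..<m} (\<lambda>_. borel)) (\<lambda>\<omega>. \<lambda>i\<in>{..<m}. \<xi> (f i) \<omega>)" ..
  have "distr (PiM {..<m} (\<lambda>_. \<mu>)) borel (\<lambda>x. \<Sum>i<m. x i)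
      = distr M borel ((\<lambda>x. \<Sum>i<m. x i) \<circ> (\<lambda>\<omega>. \<lambda>i\<in>{..<m}. \<xi> (f i) \<omega>))"
    unfolding * by (rule distr_distr; intro borel_measurable_sum measurable_component_singleton measurable_restrict)
      (use rv in auto)
  also have "\<dots> = distr M borel (\<lambda>\<omega>. \<Sum>i<m. \<xi> (f i) \<omega>)"
    by (rule arg_cong[where f="distr M borel"]) (auto simp: fun_eq_iff)
  finally show ?thesis ..
qed

lemma prob_path_sum:
  fixes f :: "nat \<Rightarrow> nat list"
  assumes f: "inj_on f {..<m}" "f ` {..<m} \<subseteq> tree b - {[]}" and B: "B \<in> sets borel"
  shows "W.prob {\<omega> \<in> space M. s + (\<Sum>i<m. \<xi> (f i) \<omega>) \<in> B} = walk_prob m B s"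
proof -
  have B': "(+) s -` B \<in> sets borel" using B by (intro measurable_sets_borel[OF _ B]) simp
  have *: "W.prob {\<omega> \<in> space M. s + Y \<omega> \<in> B} = measure (distr M borel Y) ((+) s -` B)"
    if "Y \<in> borel_measurable M" for Y
    using that B' by (subst measure_distr) (auto simp: vimage_def Int_def conj_commute)
  have "(\<lambda>\<omega>. \<Sum>i<m. \<xi> (f i) \<omega>) \<in> borel_measurable M"
    using f by (intro borel_measurable_sum \<xi>_measurable) auto
  moreover have "distr M borel (\<lambda>\<omega>. \<Sum>i<m. \<xi> (f i) \<omega>) = distr M borel (spine_walk m)"
    unfolding distr_path_sum[OF f] spine_walk_def
    by (subst distr_path_sum) (use spine in \<open>auto intro: inj_on_subset\<close>)
  ultimately show ?thesis unfolding walk_prob_def by (simp add: *)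
qed

lemma walk_prob_bounds: "0 \<le> walk_prob m B s" "walk_prob m B s \<le> 1"
  by (auto simp: walk_prob_def)

text \<open>As in Fubini's theorem: the value at s is the measure of the s-section of the preimage
  of \<open>B\<close> under addition.\<close>

lemma walk_prob_measurable [measurable]:
  assumes B: "B \<in> sets borel"
  shows "walk_prob m B \<in> borel_measurable borel"
proof -
  interpret D: prob_space "distr M borel (spine_walk m)" by (rule W.prob_space_distr) measurable
  let ?Q = "(\<lambda>p. fst p + snd p) -` B \<inter> space (borel \<Otimes>\<^sub>M distr M borel (spine_walk m))"
  have Q: "?Q \<in> sets (borel \<Otimes>\<^sub>M distr M borel (spine_walk m))"
    by (rule measurable_sets[OF _ B]) measurable
  have "emeasure (distr M borel (spine_walk m)) (Pair s -` ?Q) = ennreal (walk_prob m B s)" for s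
  proof -
    have "Pair s -` ?Q = (+) s -` B" by (auto simp: space_pair_measure)
    moreover have "(+) s -` B \<in> sets borel" using B by (intro measurable_sets_borel[OF _ B]) simp
    ultimately show ?thesis
      by (simp add: emeasure_distr walk_prob_def W.emeasure_eq_measure vimage_def Int_def conj_commute)
  qed
  moreover have "(\<lambda>s. emeasure (distr M borel (spine_walk m)) (Pair s -` ?Q)) \<in> borel_measurable borel"
    by (rule D.measurable_emeasure_Pair[OF Q])
  ultimately have "(\<lambda>s. ennreal (walk_prob m B s)) \<in> borel_measurable borel" by simp
  then have "(\<lambda>s. enn2real (ennreal (walk_prob m B s))) \<in> borel_measurable borel" by measurable
  then show ?thesis by (simp add: walk_prob_bounds)
qed

lemma walk_clt: "weak_conv_m (\<lambda>m. distr M borel (\<lambda>\<omega>. spine_walk m \<omega> / sqrt (real m))) std_normal_distribution"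
proof -
  have sp: "spine i \<in> tree b - {[]}" for i using spine by auto
  note m [measurable] = \<xi>_measurable[OF sp]
  have d: "distr M borel (\<xi> (spine i)) = \<mu>" for i by (rule law[OF sp])
  have E: "W.expectation (\<xi> (spine i)) = 0" for i
    using mean unfolding d[of i, symmetric] by (subst (asm) integral_distr) auto
  have I: "integrable M (\<lambda>\<omega>. (\<xi> (spine i) \<omega>)\<^sup>2)" for i
    using variance(1) unfolding d[of i, symmetric] by (subst (asm) integrable_distr_eq) auto
  have V: "W.expectation (\<lambda>\<omega>. (\<xi> (spine i) \<omega>)\<^sup>2) = 1" for i
    using variance(2) unfolding d[of i, symmetric] by (subst (asm) integral_distr) auto
  have "weak_conv_m (\<lambda>n. distr M borel (\<lambda>x. (\<Sum>i<n. \<xi> (spine i) x) / sqrt (real n * 1\<^sup>2))) std_normal_distribution"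
  proof (rule W.central_limit_theorem_zero_mean[where \<mu>=\<mu>])
    show "W.indep_vars (\<lambda>i. borel) (\<lambda>i. \<xi> (spine i)) UNIV"
      using W.indep_vars_reindex[OF indep spine] .
  qed (use E I V d in auto)
  then show ?thesis by (simp add: spine_walk_def)
qed

text \<open>Uniformity in s comes from the translation invariance of the uniform distance between
  cdfs. The remaining n - L n steps are normalised by sqrt n; this is harmless because the ratio of
  the two normalisations tends to 1.\<close>

lemma walk_prob_gauss:
  assumes A: "interval_union r A" and L: "(\<lambda>n. real (L n) / real n) \<longlonglongrightarrow> 0" and \<epsilon>: "\<epsilon> > 0"
  shows "\<forall>\<^sub>F n in sequentially. \<forall>s.
    \<bar>walk_prob (n - L n) ((\<lambda>a. sqrt (real n) * a) ` A) s - gauss_shift A (s / sqrt (real n))\<bar> \<le> \<epsilon>"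
proof -
  define \<Phi> where "\<Phi> = cdf std_normal_distribution"
  define H where "H m = cdf (distr M borel (\<lambda>\<omega>. spine_walk m \<omega> / sqrt (real m)))" for m
  define F where "F n t = W.prob {\<omega> \<in> space M. spine_walk (n - L n) \<omega> \<le> sqrt (real n) * t}" for n t
  have Hd: "real_distribution (distr M borel (\<lambda>\<omega>. spine_walk m \<omega> / sqrt (real m)))" for m
    by (rule W.real_distribution_distr) measurable
  have H_eq: "H m t = W.prob {\<omega> \<in> space M. spine_walk m \<omega> / sqrt (real m) \<le> t}" for m t
    unfolding H_def cdf_def by (subst measure_distr) (auto simp: vimage_def Int_def conj_commute)
  have \<Phi>c: "isCont \<Phi> t" for t unfolding \<Phi>_def by (rule isCont_cdf_std_normal)
  have Hlim: "(\<lambda>m. H m t) \<longlonglongrightarrow> \<Phi> t" for t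
    using walk_clt isCont_cdf_std_normal unfolding weak_conv_m_def weak_conv_def H_def \<Phi>_def by auto
  \<comment> \<open>Uniform convergence is needed already here, since the point at which
    \<open>H\<close> is evaluated moves with n.\<close>
  have Huni: "\<forall>\<^sub>F m in sequentially. \<forall>t. \<bar>H m t - \<Phi> t\<bar> \<le> e" if "e > 0" for e
    unfolding \<Phi>_def
  proof (rule cdf_convergence_uniform[OF real_distribution_std_normal isCont_cdf_std_normal])
    show "mono (H n)" for n unfolding H_def mono_def
      using finite_borel_measure.cdf_nondecreasing[OF real_distribution.finite_borel_measure_M[OF Hd]] by auto
  qed (use Hlim that in \<open>auto simp: H_eq \<Phi>_def\<close>)
  have "\<forall>\<^sub>F n in sequentially. real (L n) / real n < 1/2" using L by (intro order_tendstoD) auto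
  then have small: "\<forall>\<^sub>F n in sequentially. n > 0 \<and> real (L n) < real n / 2"
    using eventually_gt_at_top[of 0] by eventually_elim (auto simp: field_simps)
  have minf: "filterlim (\<lambda>n. n - L n) at_top sequentially"
    unfolding filterlim_at_top
  proof
    fix Z :: nat
    show "\<forall>\<^sub>F n in sequentially. Z \<le> n - L n"
      using small eventually_ge_at_top[of "2 * Z"] by eventually_elim linarith
  qed
  have "(\<lambda>n. sqrt (1 / (1 - real (L n) / real n))) \<longlonglongrightarrow> sqrt (1 / (1 - 0))"
    by (intro tendsto_intros L) auto
  moreover have "\<forall>\<^sub>F n in sequentially. sqrt (1 / (1 - real (L n) / real n)) = sqrt (real n / real (n - L n))"
    using small by eventually_elim (auto simp: field_simps of_nat_diff)
  ultimately have ratio: "(\<lambda>n. sqrt (real n / real (n - L n))) \<longlonglongrightarrow> 1"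
    by (subst (asm) tendsto_cong) auto
  have Flim: "(\<lambda>n. F n t) \<longlonglongrightarrow> \<Phi> t" for t
  proof -
    have F_eq: "\<forall>\<^sub>F n in sequentially. F n t = H (n - L n) (sqrt (real n / real (n - L n)) * t)"
      using small
    proof eventually_elim
      case (elim n)
      then have "real (n - L n) > 0" by simp
      then have "spine_walk (n - L n) \<omega> / sqrt (real (n - L n)) \<le> sqrt (real n / real (n - L n)) * t
          \<longleftrightarrow> spine_walk (n - L n) \<omega> \<le> sqrt (real n) * t" for \<omega>
        by (simp add: real_sqrt_divide divide_le_cancel)
      then show ?case unfolding F_def H_eq by simp
    qed
    have arg: "(\<lambda>n. sqrt (real n / real (n - L n)) * t) \<longlonglongrightarrow> t"
      using tendsto_mult[OF ratio tendsto_const[of t]] by simp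
    have "(\<lambda>n. H (n - L n) (sqrt (real n / real (n - L n)) * t) - \<Phi> (sqrt (real n / real (n - L n)) * t)) \<longlonglongrightarrow> 0"
    proof (rule tendstoI)
      fix e :: real assume e: "e > 0"
      then have "\<forall>\<^sub>F n in sequentially. \<forall>t. \<bar>H (n - L n) t - \<Phi> t\<bar> \<le> e / 2"
        by (intro eventually_compose_filterlim[OF Huni minf]) simp
      then show "\<forall>\<^sub>F n in sequentially. dist (H (n - L n) (sqrt (real n / real (n - L n)) * t)
          - \<Phi> (sqrt (real n / real (n - L n)) * t)) 0 < e"
      proof eventually_elim
        case (elim n)
        then have "\<bar>H (n - L n) (sqrt (real n / real (n - L n)) * t) - \<Phi> (sqrt (real n / real (n - L n)) * t)\<bar> \<le> e / 2"
          by blast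
        then show ?case using e by (simp only: dist_real_def) simp
      qed
    qed
    moreover have "(\<lambda>n. \<Phi> (sqrt (real n / real (n - L n)) * t)) \<longlonglongrightarrow> \<Phi> t"
      by (rule isCont_tendsto_compose[OF \<Phi>c arg])
    ultimately have "(\<lambda>n. H (n - L n) (sqrt (real n / real (n - L n)) * t)
        - \<Phi> (sqrt (real n / real (n - L n)) * t) + \<Phi> (sqrt (real n / real (n - L n)) * t)) \<longlonglongrightarrow> 0 + \<Phi> t"
      by (rule tendsto_add)
    then show ?thesis using tendsto_cong[OF F_eq] by simp
  qed
  define e where "e = \<epsilon> / (2 * real r + 1)"
  have e: "e > 0" "2 * real r * e \<le> \<epsilon>" using \<epsilon> by (auto simp: e_def field_simps)
  \<comment> \<open>A second use of Polya's theorem, now for the walk with its final normalisation;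
    the factor lost to the intervals is built into \<open>e\<close>.\<close>
  have "\<forall>\<^sub>F n in sequentially. \<forall>t. \<bar>F n t - \<Phi> t\<bar> \<le> e"
    unfolding \<Phi>_def
  proof (rule cdf_convergence_uniform[OF real_distribution_std_normal isCont_cdf_std_normal])
    show "mono (F n)" for n
      unfolding F_def mono_def
    proof (intro allI impI W.finite_measure_mono)
      fix x y :: real assume "x \<le> y"
      then have "sqrt (real n) * x \<le> sqrt (real n) * y" by (intro mult_left_mono) auto
      then show "{\<omega> \<in> space M. spine_walk (n - L n) \<omega> \<le> sqrt (real n) * x}
          \<subseteq> {\<omega> \<in> space M. spine_walk (n - L n) \<omega> \<le> sqrt (real n) * y}" by auto
    qed measurable
  qed (use Flim e in \<open>auto simp: F_def \<Phi>_def\<close>)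
  then show ?thesis using eventually_gt_at_top[of 0]
  proof eventually_elim
    case (elim n)
    then have n: "sqrt (real n) > 0" by simp
    show ?case
    proof
      fix s
      let ?Y = "\<lambda>\<omega>. (s + spine_walk (n - L n) \<omega>) / sqrt (real n)"
      have Yd: "real_distribution (distr M borel ?Y)" by (rule W.real_distribution_distr) measurable
      have Am: "A \<in> sets borel" by (rule interval_union_borel[OF A])
      have "s + spine_walk (n - L n) \<omega> \<in> (\<lambda>a. sqrt (real n) * a) ` A \<longleftrightarrow> ?Y \<omega> \<in> A" for \<omega>
        using n by (auto simp: image_iff intro!: bexI[of _ "?Y \<omega>"])
      then have "walk_prob (n - L n) ((\<lambda>a. sqrt (real n) * a) ` A) s = measure (distr M borel ?Y) A"
        using Am by (subst measure_distr) (auto simp: walk_prob_def vimage_def Int_def conj_commute)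
      moreover have "\<bar>measure (distr M borel ?Y) A
          - measure (distr std_normal_distribution borel (\<lambda>z. z + s / sqrt (real n))) A\<bar> \<le> 2 * real r * e"
      proof (rule measure_interval_union_diff_le[OF Yd real_distribution_shift _ A])
        fix t
        have "cdf (distr M borel ?Y) t = F n (t - s / sqrt (real n))"
        proof -
          have "?Y \<omega> \<le> t \<longleftrightarrow> spine_walk (n - L n) \<omega> \<le> sqrt (real n) * (t - s / sqrt (real n))" for \<omega>
            using n by (simp add: pos_divide_le_eq right_diff_distrib algebra_simps)
          then show ?thesis unfolding cdf_def F_def
            by (subst measure_distr) (auto simp: vimage_def Int_def conj_commute)
        qed
        then show "\<bar>cdf (distr M borel ?Y) t
            - cdf (distr std_normal_distribution borel (\<lambda>z. z + s / sqrt (real n))) t\<bar> \<le> e"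
          using elim by (simp add: cdf_shift \<Phi>_def)
      qed
      ultimately show "\<bar>walk_prob (n - L n) ((\<lambda>a. sqrt (real n) * a) ` A) s - gauss_shift A (s / sqrt (real n))\<bar> \<le> \<epsilon>"
        using e by (simp add: gauss_shift_eq_distr[OF Am])
    qed
  qed
qed


text \<open>With the positions \<open>s v\<close> at generation \<open>L\<close> frozen, the
  subtrees below distinct v use disjoint blocks of displacements. Their averages are independent,
  [0,1]-valued and have mean \<open>walk_prob m B (s v)\<close>, so Hoeffding's inequality for
  \<open>b ^ L\<close> variables applies.\<close>

lemma concentration_fixed_environment:
  assumes m: "m > 0" and B: "B \<in> sets borel" and e: "e > 0"
  shows "W.prob {\<omega> \<in> space M. e \<le> \<bar>level_mean L (\<lambda>v. level_mean m (\<lambda>w.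
        indicator B (s v + path_sum (\<lambda>w'. \<xi> (v @ w') \<omega>) w)) - walk_prob m B (s v))\<bar>}
      \<le> 2 * exp (- 2 * e\<^sup>2 * real b ^ L)"
proof -
  define K where "K v = (\<lambda>w. v @ w) ` below m" for v :: "nat list"
  define g where "g v y = level_mean m (\<lambda>w. indicator B (s v + path_sum (\<lambda>w'. y (v @ w')) w))" for v and y :: "nat list \<Rightarrow> real"
  define U where "U v \<omega> = g v (\<lambda>u. \<xi> u \<omega>)" for v \<omega>
  have below_take: "take (Suc k) w \<in> below m" if "w \<in> level b m" "k < m" for k w
    using that by (auto simp: below_def level_def tree_take)
  have K_sub: "K v \<subseteq> tree b - {[]}" if "v \<in> level b L" for v
    using that by (auto simp: K_def below_def level_def tree_append)
  have K_disj: "disjoint_family_on K (level b L)"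
    unfolding disjoint_family_on_def K_def by (auto simp: level_def)
  \<comment> \<open>Since \<open>g v\<close> reads only the block \<open>K v\<close>, independence
    of the blocks passes to the averages \<open>U v\<close>.\<close>
  have g_cong: "g v y = g v y'" if "\<And>u. u \<in> K v \<Longrightarrow> y u = y' u" for v y y'
  proof -
    have "path_sum (\<lambda>w'. y (v @ w')) w = path_sum (\<lambda>w'. y' (v @ w')) w" if w: "w \<in> level b m" for w
      unfolding path_sum_def
      by (intro sum.cong refl \<open>\<And>u. u \<in> K v \<Longrightarrow> y u = y' u\<close>) (use below_take[OF w] length_level[OF w] in \<open>auto simp: K_def\<close>)
    then show ?thesis by (simp add: g_def level_mean_def)
  qed
  have gm: "g v \<in> borel_measurable (PiM (K v) (\<lambda>_. borel))" for v
  proof -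
    have "(\<lambda>y. s v + path_sum (\<lambda>w'. y (v @ w')) w) \<in> borel_measurable (PiM (K v) (\<lambda>_. borel))"
      if w: "w \<in> level b m" for w
      unfolding path_sum_def
      by (intro borel_measurable_add borel_measurable_const borel_measurable_sum measurable_component_singleton)
        (use below_take[OF w] length_level[OF w] in \<open>auto simp: K_def\<close>)
    then show ?thesis unfolding g_def level_mean_def
      by (intro borel_measurable_times borel_measurable_const borel_measurable_sum)
        (auto intro: measurable_compose[OF _ borel_measurable_indicator[OF B]])
  qed
  have "W.indep_vars (\<lambda>v. PiM (K v) (\<lambda>_. borel)) (\<lambda>v \<omega>. restrict (\<lambda>i. \<xi> i \<omega>) (K v)) (level b L)"
    by (rule W.indep_vars_restrict[OF indep K_sub K_disj])
  then have "W.indep_vars (\<lambda>_. borel) (\<lambda>v \<omega>. g v (restrict (\<lambda>i. \<xi> i \<omega>) (K v))) (level b L)"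
    by (rule W.indep_vars_compose2) (rule gm)
  moreover have "g v (restrict (\<lambda>i. \<xi> i \<omega>) (K v)) = U v \<omega>" for v \<omega>
    unfolding U_def by (rule g_cong) simp
  ultimately have ind: "W.indep_vars (\<lambda>_. borel) U (level b L)" by simp
  have U01: "U v \<omega> \<in> {0..1}" for v \<omega>
    using level_mean_nonneg[of m "\<lambda>w. indicator B (s v + path_sum (\<lambda>w'. \<xi> (v @ w') \<omega>) w)"]
      level_mono_mean[of m "\<lambda>w. indicator B (s v + path_sum (\<lambda>w'. \<xi> (v @ w') \<omega>) w)" "\<lambda>_. 1"]
    by (auto simp: U_def g_def level_mean_const indicator_le_1)
  have EU: "W.expectation (U v) = walk_prob m B (s v)" if v: "v \<in> level b L" for v
  proof -
    define E where "E w = {\<omega> \<in> space M. s v + path_sum (\<lambda>w'. \<xi> (v @ w') \<omega>) w \<in> B}" for w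
    have PE: "W.prob (E w) = walk_prob m B (s v)" and Em: "E w \<in> W.events" if w: "w \<in> level b m" for w
    proof -
      have f: "inj_on (\<lambda>k. v @ take (Suc k) w) {..<m}" "(\<lambda>k. v @ take (Suc k) w) ` {..<m} \<subseteq> tree b - {[]}"
        using length_level[OF w] K_sub[OF v] below_take[OF w]
        by (auto simp: inj_on_def K_def dest!: arg_cong[where f=length])
      show "W.prob (E w) = walk_prob m B (s v)"
        using prob_path_sum[OF f B, of "s v"] length_level[OF w] by (simp add: E_def path_sum_def)
      have "(\<lambda>\<omega>. s v + path_sum (\<lambda>w'. \<xi> (v @ w') \<omega>) w) \<in> borel_measurable M"
        unfolding path_sum_def using length_level[OF w] f
        by (intro borel_measurable_add borel_measurable_const borel_measurable_sum \<xi>_measurable) auto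
      from measurable_sets[OF this B] show "E w \<in> W.events"
        by (simp add: E_def vimage_def Int_def conj_commute)
    qed
    have "W.expectation (U v) = W.expectation (\<lambda>\<omega>. level_mean m (\<lambda>w. indicator (E w) \<omega>))"
      by (intro Bochner_Integration.integral_cong refl) (auto simp: U_def g_def E_def level_mean_def indicator_def)
    also have "\<dots> = level_mean m (\<lambda>w. W.prob (E w))"
      unfolding level_mean_def using Em
      by (subst integral_mult_right_zero, subst Bochner_Integration.integral_sum)
        (auto intro!: integrable_real_indicator simp: W.emeasure_eq_measure)
    also have "\<dots> = level_mean m (\<lambda>w. walk_prob m B (s v))" by (simp add: level_mean_def PE)
    finally show ?thesis by (simp add: level_mean_const)
  qed
  interpret Hoef: Hoeffding_ineq M "level b L" U "\<lambda>_. 0" "\<lambda>_. 1" "\<Sum>v\<in>level b L. walk_prob m B (s v)"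
    by unfold_locales (use ind U01 EU in auto)
  have bL: "real b ^ L > 0" using b by simp
  have "e \<le> \<bar>level_mean L (\<lambda>v. g v (\<lambda>u. \<xi> u \<omega>) - walk_prob m B (s v))\<bar>
      \<longleftrightarrow> e * real b ^ L \<le> \<bar>(\<Sum>v\<in>level b L. U v \<omega>) - (\<Sum>v\<in>level b L. walk_prob m B (s v))\<bar>" for \<omega>
  proof -
    have "level_mean L (\<lambda>v. g v (\<lambda>u. \<xi> u \<omega>) - walk_prob m B (s v))
        = ((\<Sum>v\<in>level b L. U v \<omega>) - (\<Sum>v\<in>level b L. walk_prob m B (s v))) / real b ^ L"
      by (simp add: level_mean_def sum_subtractf U_def power_one_over)
    then show ?thesis using bL by (simp add: abs_divide pos_le_divide_eq)
  qed
  then have "W.prob {\<omega> \<in> space M. e \<le> \<bar>level_mean L (\<lambda>v. g v (\<lambda>u. \<xi> u \<omega>) - walk_prob m B (s v))\<bar>}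
      = W.prob {\<omega> \<in> space M. e * real b ^ L \<le> \<bar>(\<Sum>v\<in>level b L. U v \<omega>) - (\<Sum>v\<in>level b L. walk_prob m B (s v))\<bar>}"
    by simp
  also have "\<dots> \<le> 2 * exp (- 2 * (e * real b ^ L)\<^sup>2 / (\<Sum>v\<in>level b L. (1 - 0)\<^sup>2))"
    by (rule Hoef.Hoeffding_ineq_abs_ge) (use e bL in \<open>auto simp: card_level\<close>)
  also have "\<dots> = 2 * exp (- 2 * e\<^sup>2 * real b ^ L)"
    using bL by (simp add: card_level power2_eq_square field_simps)
  finally show ?thesis by (simp add: g_def)
qed

text \<open>Conditioning on the first \<open>L\<close> generations is Fubini on the product of the laws of the two
  independent blocks of displacements.\<close>

lemma concentration:
  assumes m: "m > 0" and B: "B \<in> sets borel" and e: "e > 0"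
  shows "W.prob {\<omega> \<in> space M. e \<le> \<bar>brw_empirical b \<xi> (L + m) \<omega> B
      - level_mean L (\<lambda>v. walk_prob m B (path_sum (\<lambda>u. \<xi> u \<omega>) v))\<bar>} \<le> 2 * exp (- 2 * e\<^sup>2 * real b ^ L)"
proof -
  define D1 where "D1 = below L"
  define D2 where "D2 = below (L + m) - below L"
  define G where "G x y = level_mean L (\<lambda>v. level_mean m (\<lambda>w.
        indicator B (path_sum x v + path_sum (\<lambda>w'. y (v @ w')) w)) - walk_prob m B (path_sum x v))"
    for x y :: "nat list \<Rightarrow> real"
  define P1 where "P1 = PiM D1 (\<lambda>_. borel :: real measure)"
  define P2 where "P2 = PiM D2 (\<lambda>_. borel :: real measure)"
  define V1 where "V1 \<omega> = restrict (\<lambda>i. \<xi> i \<omega>) D1" for \<omega>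
  define V2 where "V2 \<omega> = restrict (\<lambda>i. \<xi> i \<omega>) D2" for \<omega>
  define C where "C = 2 * exp (- 2 * e\<^sup>2 * real b ^ L)"
  have D1: "take (Suc k) v \<in> D1" if "v \<in> level b L" "k < L" for v k
    using that by (auto simp: D1_def below_def level_def tree_take)
  have D2: "v @ take (Suc k) w \<in> D2" if "v \<in> level b L" "w \<in> level b m" "k < m" for v w k
    using that by (auto simp: D2_def below_def level_def tree_take tree_append)
  have D: "D1 \<inter> D2 = {}" "D1 \<subseteq> tree b - {[]}" "D2 \<subseteq> tree b - {[]}"
    using below_subset by (auto simp: D1_def D2_def)
  have Ym: "(\<lambda>p. path_sum (fst p) v) \<in> borel_measurable (P1 \<Otimes>\<^sub>M P2)" if v: "v \<in> level b L" for v
    unfolding path_sum_def P1_def using D1[OF v] length_level[OF v]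
    by (intro borel_measurable_sum measurable_compose[OF measurable_fst measurable_component_singleton]) auto
  have Zm: "(\<lambda>p. path_sum (\<lambda>w'. snd p (v @ w')) w) \<in> borel_measurable (P1 \<Otimes>\<^sub>M P2)"
    if v: "v \<in> level b L" and w: "w \<in> level b m" for v w
    unfolding path_sum_def P2_def using D2[OF v w] length_level[OF w]
    by (intro borel_measurable_sum measurable_compose[OF measurable_snd measurable_component_singleton]) auto
  have Gm: "(\<lambda>p. G (fst p) (snd p)) \<in> borel_measurable (P1 \<Otimes>\<^sub>M P2)"
    unfolding G_def level_mean_def
    by (intro borel_measurable_times borel_measurable_const borel_measurable_sum borel_measurable_diff
        measurable_compose[OF _ borel_measurable_indicator[OF B]] measurable_compose[OF _ walk_prob_measurable[OF B]]
        borel_measurable_add Ym Zm)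
  define Ev where "Ev = {p \<in> space (P1 \<Otimes>\<^sub>M P2). e \<le> \<bar>G (fst p) (snd p)\<bar>}"
  have Ev: "Ev \<in> sets (P1 \<Otimes>\<^sub>M P2)"
    unfolding Ev_def using Gm by measurable
  \<comment> \<open>\<open>G\<close> reads its first argument only on \<open>D1\<close> and its
    second only on \<open>D2\<close>, so either block may be exchanged for the full family.\<close>
  have Gx: "G x (V2 \<omega>) = G x (\<lambda>u. \<xi> u \<omega>)" for x \<omega>
  proof -
    have "path_sum (\<lambda>w'. V2 \<omega> (v @ w')) w = path_sum (\<lambda>w'. \<xi> (v @ w') \<omega>) w"
      if "v \<in> level b L" "w \<in> level b m" for v w
      unfolding path_sum_def using D2[OF that] length_level[OF that(2)] by (intro sum.cong) (auto simp: V2_def)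
    then show ?thesis by (simp add: G_def level_mean_def)
  qed
  have Gy: "G (V1 \<omega>) y = G (\<lambda>u. \<xi> u \<omega>) y" for y \<omega>
  proof -
    have "path_sum (V1 \<omega>) v = path_sum (\<lambda>u. \<xi> u \<omega>) v" if "v \<in> level b L" for v
      unfolding path_sum_def using D1[OF that] length_level[OF that] by (intro sum.cong) (auto simp: V1_def)
    then show ?thesis by (simp add: G_def level_mean_def)
  qed
  have iv: "W.indep_var P1 V1 P2 V2"
    unfolding P1_def P2_def V1_def V2_def by (rule W.indep_var_restrict[OF indep D])
  then have V [measurable]: "V1 \<in> measurable M P1" "V2 \<in> measurable M P2"
    and prod: "distr M P1 V1 \<Otimes>\<^sub>M distr M P2 V2 = distr M (P1 \<Otimes>\<^sub>M P2) (\<lambda>x. (V1 x, V2 x))"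
    unfolding W.indep_var_distribution_eq by auto
  interpret Q1: prob_space "distr M P1 V1" by (rule W.prob_space_distr[OF V(1)])
  interpret Q2: prob_space "distr M P2 V2" by (rule W.prob_space_distr[OF V(2)])
  have Ev': "Ev \<in> sets (distr M P1 V1 \<Otimes>\<^sub>M distr M P2 V2)"
    using Ev by (simp cong: sets_pair_measure_cong)
  have "brw_empirical b \<xi> (L + m) \<omega> B - level_mean L (\<lambda>v. walk_prob m B (path_sum (\<lambda>u. \<xi> u \<omega>) v))
      = G (V1 \<omega>) (V2 \<omega>)" for \<omega>
    unfolding Gx Gy by (simp add: G_def brw_empirical_eq level_mean_append level_mean_diff path_sum_append)
  then have "emeasure M {\<omega> \<in> space M. e \<le> \<bar>brw_empirical b \<xi> (L + m) \<omega> B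
      - level_mean L (\<lambda>v. walk_prob m B (path_sum (\<lambda>u. \<xi> u \<omega>) v))\<bar>}
      = emeasure M ((\<lambda>\<omega>. (V1 \<omega>, V2 \<omega>)) -` Ev \<inter> space M)"
    using measurable_space[OF V(1)] measurable_space[OF V(2)]
    by (intro arg_cong[where f="emeasure M"]) (auto simp: Ev_def space_pair_measure)
  also have "\<dots> = emeasure (distr M P1 V1 \<Otimes>\<^sub>M distr M P2 V2) Ev"
    unfolding prod by (rule emeasure_distr[symmetric]) (use Ev in \<open>auto intro!: measurable_Pair V\<close>)
  also have "\<dots> = (\<integral>\<^sup>+x. emeasure (distr M P2 V2) (Pair x -` Ev) \<partial>distr M P1 V1)"
    by (rule Q2.emeasure_pair_measure_alt[OF Ev'])
  also have "\<dots> \<le> (\<integral>\<^sup>+x. ennreal C \<partial>distr M P1 V1)"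
  proof (rule nn_integral_mono)
    \<comment> \<open>For a frozen first block \<open>x\<close> the section is the event of
      \<open>concentration_fixed_environment\<close> with \<open>s v = path_sum x v\<close>, and the
      bound \<open>C\<close> is the same for all x.\<close>
    fix x assume "x \<in> space (distr M P1 V1)"
    then have x: "x \<in> space P1" by simp
    have "emeasure (distr M P2 V2) (Pair x -` Ev) = emeasure M (V2 -` (Pair x -` Ev) \<inter> space M)"
      using sets_Pair1[OF Ev] by (intro emeasure_distr V(2)) simp
    also have "V2 -` (Pair x -` Ev) \<inter> space M = {\<omega> \<in> space M. e \<le> \<bar>G x (\<lambda>u. \<xi> u \<omega>)\<bar>}"
      using x measurable_space[OF V(2)] by (auto simp: Ev_def space_pair_measure Gx)
    also have "emeasure M \<dots> \<le> ennreal C"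
      unfolding W.emeasure_eq_measure G_def C_def
      by (intro ennreal_leI concentration_fixed_environment[OF m B e])
    finally show "emeasure (distr M P2 V2) (Pair x -` Ev) \<le> ennreal C" .
  qed
  also have "\<dots> = ennreal C" using Q1.emeasure_space_1 by simp
  finally show ?thesis by (simp add: W.emeasure_eq_measure C_def)
qed

end


section \<open>Exponential approximation and the large deviation principle\<close>

context branching_walk
begin

definition scaled_field :: "nat \<Rightarrow> 'w \<Rightarrow> nat list \<Rightarrow> real" where
  "scaled_field n \<omega> = (\<lambda>v. \<xi> v \<omega> / sqrt (real n))"

abbreviation empirical :: "real set \<Rightarrow> nat \<Rightarrow> 'w \<Rightarrow> real" where
  "empirical A n \<omega> \<equiv> brw_empirical b \<xi> n \<omega> ((\<lambda>a. sqrt (real n) * a) ` A)"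

lemma path_sum_measurable:
  assumes "u \<in> tree b"
  shows "(\<lambda>\<omega>. path_sum (\<lambda>v. \<xi> v \<omega>) u) \<in> borel_measurable M"
  unfolding path_sum_def
  by (intro borel_measurable_sum \<xi>_measurable) (use assms in \<open>auto simp: tree_take\<close>)

lemma path_sum_scaled: "path_sum (scaled_field n \<omega>) u = path_sum (\<lambda>v. \<xi> v \<omega>) u / sqrt (real n)"
  by (simp add: path_sum_def scaled_field_def sum_divide_distrib)

text \<open>The case c = 0 arises from generation n = 0.\<close>

lemma scaled_image_borel:
  assumes A: "A \<in> sets borel"
  shows "(\<lambda>a. c * a) ` A \<in> sets (borel :: real measure)"
proof (cases "c = 0")
  case True
  then have "(\<lambda>a. c * a) ` A = {} \<or> (\<lambda>a. c * a) ` A = {0}" by auto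
  then show ?thesis by auto
next
  case False
  then have "(\<lambda>a. c * a) ` A = (\<lambda>x. x / c) -` A" by (auto simp: image_iff intro!: bexI[of _ "_ / c"])
  then show ?thesis using measurable_sets_borel[OF _ A, of "\<lambda>x. x / c"] by simp
qed

lemma empirical_measurable:
  assumes "B \<in> sets borel"
  shows "(\<lambda>\<omega>. brw_empirical b \<xi> n \<omega> B) \<in> borel_measurable M"
  unfolding brw_empirical_eq level_mean_def
  by (intro borel_measurable_times borel_measurable_const borel_measurable_sum
      measurable_compose[OF path_sum_measurable borel_measurable_indicator[OF assms]] level_in_tree)

lemma Psi_trunc_measurable:
  assumes "interval_union r A"
  shows "(\<lambda>\<omega>. Psi b A (trunc K (scaled_field n \<omega>))) \<in> borel_measurable M"
  unfolding Psi_trunc_eq level_mean_def path_sum_scaled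
  by (intro borel_measurable_times borel_measurable_const borel_measurable_sum
      measurable_compose[OF _ gauss_shift_measurable[OF assms]] borel_measurable_divide
      path_sum_measurable level_in_tree)

lemma empirical_range: "brw_empirical b \<xi> n \<omega> B \<in> {0..1}"
  unfolding brw_empirical_eq
  using level_mean_nonneg[of n "\<lambda>u. indicator B (path_sum (\<lambda>v. \<xi> v \<omega>) u)"]
    level_mono_mean[of n "\<lambda>u. indicator B (path_sum (\<lambda>v. \<xi> v \<omega>) u)" "\<lambda>_. 1"]
  by (auto simp: level_mean_const indicator_le_1)

lemma weighted_energy_measurable [measurable]:
  "(\<lambda>\<omega>. \<Sum>v\<in>below K. w v * \<bar>\<xi> v \<omega>\<bar> powr \<alpha>) \<in> borel_measurable M"
proof (intro borel_measurable_sum borel_measurable_times borel_measurable_const)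
  fix v assume "v \<in> below K"
  then have [measurable]: "\<xi> v \<in> borel_measurable M" using below_subset \<xi>_measurable by blast
  show "(\<lambda>\<omega>. \<bar>\<xi> v \<omega>\<bar> powr \<alpha>) \<in> borel_measurable M" by measurable
qed

lemma scaled_powr: "n > 0 \<Longrightarrow> \<bar>scaled_field n \<omega> v\<bar> powr \<alpha> = \<bar>\<xi> v \<omega>\<bar> powr \<alpha> / real n powr (\<alpha> / 2)"
  by (simp add: scaled_field_def abs_divide powr_divide powr_half_sqrt[symmetric] powr_powr)

lemma exp_speed_tendsto_0: "k > 0 \<Longrightarrow> (\<lambda>n. exp (- k * real n powr (\<alpha> / 2))) \<longlonglongrightarrow> 0"
  using \<alpha> by real_asymp

text \<open>The cut level has \<open>b ^ cut_level n\<close> slightly above the speed \<open>n powr (\<alpha> / 2)\<close>: large enough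
  for the concentration bound to be superexponential, small enough for the exponential moments of the
  discounted energy up to that level to be negligible.\<close>

definition discount :: real where "discount = min 1 \<alpha> / 2"

definition cut_level :: "nat \<Rightarrow> nat" where
  "cut_level n = nat \<lceil>\<alpha> / 2 * (1 + discount) * log b n\<rceil>"

lemma discount: "0 < discount" "discount < min 1 \<alpha>" "discount < 1"
  using \<alpha> by (auto simp: discount_def)

lemma cut_level_bounds:
  assumes n: "n > 0"
  shows "real n powr (\<alpha> / 2 * (1 + discount)) \<le> real b ^ cut_level n"
    and "real b ^ cut_level n \<le> real b * real n powr (\<alpha> / 2 * (1 + discount))"
    and "real (cut_level n) \<le> \<alpha> / 2 * (1 + discount) * log b n + 1"
proof -
  define x where "x = \<alpha> / 2 * (1 + discount) * log b n"
  have b1: "real b > 1" using b by simp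
  have x: "x \<ge> 0" unfolding x_def using \<alpha> discount n b1 by (intro mult_nonneg_nonneg) auto
  then have L: "x \<le> real (cut_level n)" "real (cut_level n) \<le> x + 1"
    unfolding cut_level_def x_def[symmetric] by linarith+
  have bx: "real b powr x = real n powr (\<alpha> / 2 * (1 + discount))"
  proof -
    have "real b powr x = (real b powr log b n) powr (\<alpha> / 2 * (1 + discount))"
      by (simp add: powr_powr x_def mult.commute)
    then show ?thesis using b1 n by simp
  qed
  have pw: "real b ^ cut_level n = real b powr real (cut_level n)" using b1 by (simp add: powr_realpow)
  show "real n powr (\<alpha> / 2 * (1 + discount)) \<le> real b ^ cut_level n"
    unfolding bx[symmetric] pw using L b1 by (intro powr_mono) auto
  have "real b powr real (cut_level n) \<le> real b powr (x + 1)" using L b1 by (intro powr_mono) auto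
  then show "real b ^ cut_level n \<le> real b * real n powr (\<alpha> / 2 * (1 + discount))"
    unfolding bx[symmetric] pw using b1 by (simp add: powr_add mult.commute)
  show "real (cut_level n) \<le> \<alpha> / 2 * (1 + discount) * log b n + 1" using L by (simp add: x_def)
qed

lemma cut_level_at_top: "filterlim cut_level at_top sequentially"
proof -
  have "filterlim (\<lambda>n. \<alpha> / 2 * (1 + discount) * log b n) at_top sequentially"
  proof -
    have "ln (real b) > 0" "\<alpha> / 2 * (1 + discount) > 0" using b \<alpha> discount by auto
    then show ?thesis unfolding log_def by real_asymp
  qed
  then show ?thesis
    unfolding filterlim_at_top cut_level_def
  proof (intro allI)
    fix Z :: nat
    assume "\<forall>Z. \<forall>\<^sub>F n in sequentially. Z \<le> \<alpha> / 2 * (1 + discount) * log (real b) (real n)"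
    then have "\<forall>\<^sub>F n in sequentially. real Z \<le> \<alpha> / 2 * (1 + discount) * log (real b) (real n)" ..
    then show "\<forall>\<^sub>F n in sequentially. Z \<le> nat \<lceil>\<alpha> / 2 * (1 + discount) * log (real b) (real n)\<rceil>"
      by eventually_elim linarith
  qed
qed

lemma cut_level_small: "(\<lambda>n. real (cut_level n) / real n) \<longlonglongrightarrow> 0"
proof (rule Lim_null_comparison)
  show "\<forall>\<^sub>F n in sequentially. norm (real (cut_level n) / real n) \<le> (\<alpha> / 2 * (1 + discount) * log b n + 1) / real n"
    using eventually_gt_at_top[of 0]
  proof eventually_elim
    case (elim n)
    then show ?case using cut_level_bounds(3)[OF elim] by (simp add: divide_right_mono)
  qed
  have "ln (real b) > 0" using b by auto
  then show "(\<lambda>n. (\<alpha> / 2 * (1 + discount) * log b n + 1) / real n) \<longlonglongrightarrow> 0"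
    unfolding log_def by real_asymp
qed

definition weight :: "nat list \<Rightarrow> real" where
  "weight v = real b powr (- discount * real (length v))"

lemma weight_bounds: "0 \<le> weight v \<and> weight v \<le> 1"
proof -
  have "real b powr (- discount * real (length v)) \<le> real b powr 0"
    using b discount by (intro powr_mono) auto
  then show ?thesis using b by (simp add: weight_def)
qed

text \<open>Generation k has \<open>b ^ k\<close> vertices and hence total weight
  \<open>b powr ((1 - discount) * k)\<close>; replacing every generation by the last one costs the
  factor \<open>L\<close>, which is logarithmic at the cut level.\<close>

lemma total_weight_le: "(\<Sum>v\<in>below L. weight v) \<le> real L * (real b ^ L) powr (1 - discount)"
proof -
  have b0: "real b > 0" using b by simp
  have "(\<Sum>v\<in>below L. weight v) = (\<Sum>k<L. real b powr ((1 - discount) * real (Suc k)))"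
  proof -
    have "(\<Sum>v\<in>level b (Suc k). weight v) = real b powr ((1 - discount) * real (Suc k))" for k
    proof -
      have "(\<Sum>v\<in>level b (Suc k). weight v) = real (b ^ Suc k) * real b powr (- discount * real (Suc k))"
        by (simp add: weight_def length_level card_level)
      also have "real (b ^ Suc k) = real b powr real (Suc k)"
        using b0 powr_realpow[of "real b" "Suc k"] by simp
      also have "real b powr real (Suc k) * real b powr (- discount * real (Suc k))
          = real b powr ((1 - discount) * real (Suc k))"
        unfolding powr_add[symmetric] by (simp add: algebra_simps)
      finally show ?thesis .
    qed
    then show ?thesis by (simp add: sum_below)
  qed
  also have "\<dots> \<le> (\<Sum>k<L. real b powr ((1 - discount) * real L))"
    using b discount by (intro sum_mono powr_mono mult_left_mono) auto
  also have "real b powr ((1 - discount) * real L) = (real b ^ L) powr (1 - discount)"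
    using b0 by (simp add: powr_realpow[symmetric] powr_powr mult.commute)
  finally show ?thesis by simp
qed

lemma total_weight_negligible:
  "(\<lambda>n. (\<Sum>v\<in>below (cut_level n). weight v) / real n powr (\<alpha> / 2)) \<longlonglongrightarrow> 0"
proof (rule Lim_null_comparison)
  define a where "a = \<alpha> / 2 * (1 + discount)"
  \<comment> \<open>The exponent of the total weight is
    \<open>\<alpha> / 2 * (1 + discount) * (1 - discount)\<close>, that is
    \<open>\<alpha> / 2 - d\<close>: the power \<open>n powr (- d)\<close> relative to the speed
    outweighs the logarithm from the cut level.\<close>
  define d where "d = \<alpha> / 2 * discount\<^sup>2"
  define g where "g n = (a * (ln (real n) / ln (real b)) + 1) * real b powr (1 - discount) * real n powr (- d)" for n :: nat
  have d: "d > 0" using \<alpha> discount by (simp add: d_def)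
  have a: "a * (1 - discount) = \<alpha> / 2 - d" by (simp add: a_def d_def field_simps power2_eq_square)
  show "\<forall>\<^sub>F n in sequentially. norm ((\<Sum>v\<in>below (cut_level n). weight v) / real n powr (\<alpha> / 2)) \<le> g n"
    using eventually_gt_at_top[of 0]
  proof eventually_elim
    case (elim n)
    have s: "real n powr (\<alpha> / 2) > 0" using elim by simp
    have "(\<Sum>v\<in>below (cut_level n). weight v) \<le> real (cut_level n) * (real b ^ cut_level n) powr (1 - discount)"
      by (rule total_weight_le)
    also have "\<dots> \<le> (a * log b n + 1) * (real b * real n powr a) powr (1 - discount)"
      using cut_level_bounds(2,3)[OF elim] discount b
      by (intro mult_mono powr_mono2) (auto simp: a_def intro: order_trans[OF of_nat_0_le_iff])
    also have "(real b * real n powr a) powr (1 - discount) = real b powr (1 - discount) * real n powr (\<alpha> / 2 - d)"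
      by (simp add: powr_mult powr_powr a)
    also have "real n powr (\<alpha> / 2 - d) = real n powr (- d) * real n powr (\<alpha> / 2)"
      by (simp flip: powr_add)
    finally have "(\<Sum>v\<in>below (cut_level n). weight v) \<le> g n * real n powr (\<alpha> / 2)"
      by (simp add: g_def log_def mult.assoc)
    moreover have "0 \<le> (\<Sum>v\<in>below (cut_level n). weight v)" using weight_bounds by (simp add: sum_nonneg)
    ultimately show ?case using s by (simp add: pos_divide_le_eq)
  qed
  have "ln (real b) > 0" using b by auto
  then show "g \<longlonglongrightarrow> 0" unfolding g_def using d by real_asymp
qed

text \<open>The rate \<open>c\<close> is arbitrary. Outside the Hoeffding event and the event of
  large discounted energy, the remaining errors are deterministic: the Gaussian approximation and
  the generations between \<open>K\<close> and the cut level. After division by the speed the energy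
  bound is the constant \<open>y\<close>, so \<open>K\<close> can be chosen before n.\<close>

lemma exponential_approximation:
  assumes A: "interval_union r A" and \<epsilon>: "\<epsilon> > 0"
  shows "\<forall>\<^sub>F K in sequentially. \<forall>\<^sub>F n in sequentially.
    W.prob {\<omega> \<in> space M. \<epsilon> \<le> \<bar>empirical A n \<omega> - Psi b A (trunc K (scaled_field n \<omega>))\<bar>}
      \<le> exp (- c * real n powr (\<alpha> / 2))"
proof -
  define c' where "c' = max c 0"
  have "0 \<le> lam / 2" "lam / 2 < lam" using lam by auto
  then obtain m where m: "m \<ge> 1" "(\<integral>\<^sup>+x. ennreal (exp (lam / 2 * \<bar>x\<bar> powr \<alpha>)) \<partial>\<mu>) = ennreal m"
    by (rule exp_moment_real)
  \<comment> \<open>Of the exponent \<open>c' + 2\<close>, one unit pays for the moment factor of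
    the total weight and one for the factor 3 from the union bound.\<close>
  define y where "y = (c' + 2) / (lam / 2)"
  have y: "lam / 2 * y = c' + 2" "y > 0" using lam by (auto simp: y_def c'_def)
  define \<rho> where "\<rho> = decay \<alpha> discount"
  have \<rho>: "0 < \<rho>" "\<rho> < 1" unfolding \<rho>_def using decay_bounds[OF \<alpha> discount(2)] by auto
  define C where "C = 2 * real r * (y powr (1 / \<alpha>) / (1 - \<rho>))"
  have "(\<lambda>K. C * \<rho> ^ K) \<longlonglongrightarrow> C * 0"
    using \<rho> by (intro tendsto_intros LIMSEQ_power_zero) auto
  then have "\<forall>\<^sub>F K in sequentially. C * \<rho> ^ K < \<epsilon> / 3" using \<epsilon> by (intro order_tendstoD) auto
  then show ?thesis
  proof eventually_elim
    case (elim K)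
    note K = elim
    have Am: "A \<in> sets borel" by (rule interval_union_borel[OF A])
    have e3: "\<epsilon> / 3 > 0" "\<epsilon> / 4 > 0" using \<epsilon> by auto
    have 1: "\<forall>\<^sub>F n in sequentially. K \<le> cut_level n"
      using cut_level_at_top by (simp add: filterlim_at_top)
    have 2: "\<forall>\<^sub>F n in sequentially. real (cut_level n) / real n < 1"
      by (rule order_tendstoD(2)[OF cut_level_small]) simp
    \<comment> \<open>The threshold 1 / m makes \<open>(m - 1)\<close> times the total weight at
      most the speed.\<close>
    have 3: "\<forall>\<^sub>F n in sequentially. (\<Sum>v\<in>below (cut_level n). weight v) / real n powr (\<alpha> / 2) < 1 / m"
      by (rule order_tendstoD(2)[OF total_weight_negligible]) (use m in simp)
    have "filterlim (\<lambda>n. 2 * (\<epsilon> / 3)\<^sup>2 * real n powr (\<alpha> / 2 * discount)) at_top sequentially"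
    proof -
      have "2 * (\<epsilon> / 3)\<^sup>2 > 0" "\<alpha> / 2 * discount > 0" using \<epsilon> \<alpha> discount by auto
      then show ?thesis by real_asymp
    qed
    then have 4: "\<forall>\<^sub>F n in sequentially. c' + 1 \<le> 2 * (\<epsilon> / 3)\<^sup>2 * real n powr (\<alpha> / 2 * discount)"
      by (simp add: filterlim_at_top)
    have 5: "\<forall>\<^sub>F n in sequentially. exp (- 1 * real n powr (\<alpha> / 2)) < 1 / 3"
      by (rule order_tendstoD(2)[OF exp_speed_tendsto_0]) auto
    show ?case
      using 1 2 3 4 5 walk_prob_gauss[OF A cut_level_small e3(2)] eventually_gt_at_top[of 0]
    proof eventually_elim
      case (elim n)
      define L where "L = cut_level n"
      define s where "s = real n powr (\<alpha> / 2)"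
      have n: "n > 0" and s: "s > 0" using elim by (auto simp: s_def)
      have nL: "n = L + (n - L)" "n - L > 0" using elim by (auto simp: L_def)
      let ?B = "(\<lambda>a. sqrt (real n) * a) ` A"
      have Bm: "?B \<in> sets borel" by (rule scaled_image_borel[OF Am])
      define E1 where "E1 = {\<omega> \<in> space M. \<epsilon> / 3 \<le> \<bar>empirical A n \<omega>
        - level_mean L (\<lambda>v. walk_prob (n - L) ?B (path_sum (\<lambda>u. \<xi> u \<omega>) v))\<bar>}"
      define E2 where "E2 = {\<omega> \<in> space M. y * s \<le> (\<Sum>v\<in>below L. weight v * \<bar>\<xi> v \<omega>\<bar> powr \<alpha>)}"
      have "(\<lambda>\<omega>. level_mean L (\<lambda>v. walk_prob (n - L) ?B (path_sum (\<lambda>u. \<xi> u \<omega>) v))) \<in> borel_measurable M"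
        unfolding level_mean_def
        by (intro borel_measurable_times borel_measurable_const borel_measurable_sum
            measurable_compose[OF path_sum_measurable walk_prob_measurable[OF Bm]] level_in_tree)
      note [measurable] = this empirical_measurable[OF Bm]
      have E1m: "E1 \<in> W.events" unfolding E1_def by measurable
      have E2m: "E2 \<in> W.events" unfolding E2_def by measurable
      have "W.prob E1 \<le> 2 * exp (- 2 * (\<epsilon> / 3)\<^sup>2 * real b ^ L)"
        using concentration[OF nL(2) Bm e3(1), of L] nL(1) by (simp add: E1_def)
      also have "\<dots> \<le> 2 * exp (- (c' + 1) * s)"
      proof -
        have "(c' + 1) * s \<le> 2 * (\<epsilon> / 3)\<^sup>2 * real n powr (\<alpha> / 2 * discount) * s"
          using elim(4) s by (intro mult_right_mono) auto
        also have "\<dots> = 2 * (\<epsilon> / 3)\<^sup>2 * real n powr (\<alpha> / 2 * (1 + discount))"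
          by (simp add: s_def powr_add[symmetric] add_divide_distrib algebra_simps)
        also have "\<dots> \<le> 2 * (\<epsilon> / 3)\<^sup>2 * real b ^ L"
          unfolding L_def by (intro mult_left_mono cut_level_bounds(1)[OF n]) auto
        finally have "- 2 * (\<epsilon> / 3)\<^sup>2 * real b ^ L \<le> - (c' + 1) * s" by linarith
        then show ?thesis by simp
      qed
      finally have P1: "W.prob E1 \<le> 2 * exp (- (c' + 1) * s)" .
      have "W.prob E2 \<le> exp (- (lam / 2) * (y * s) + (m - 1) * (\<Sum>v\<in>below L. weight v))"
        unfolding E2_def
        by (rule weighted_energy_tail[OF finite_below below_subset _ m weight_bounds]) (use lam in simp)
      also have "\<dots> \<le> exp (- (c' + 1) * s)"
      proof -
        have w0: "0 \<le> (\<Sum>v\<in>below L. weight v)" using weight_bounds by (simp add: sum_nonneg)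
        have "(\<Sum>v\<in>below L. weight v) < s / m"
          using elim(3) s by (simp add: L_def s_def pos_divide_less_eq)
        then have "m * (\<Sum>v\<in>below L. weight v) \<le> s" using m by (simp add: field_simps)
        then have "(m - 1) * (\<Sum>v\<in>below L. weight v) \<le> s" using w0 by (simp add: algebra_simps)
        moreover have "- (lam / 2) * (y * s) = - ((c' + 1) * s) - s"
        proof -
          have "lam / 2 * (y * s) = (c' + 2) * s" using y(1) by (metis mult.assoc)
          then show ?thesis by (simp add: algebra_simps)
        qed
        ultimately have "- (lam / 2) * (y * s) + (m - 1) * (\<Sum>v\<in>below L. weight v) \<le> - (c' + 1) * s" by linarith
        then show ?thesis by (simp only: exp_le_cancel_iff)
      qed
      finally have P2: "W.prob E2 \<le> exp (- (c' + 1) * s)" .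
      have sub: "{\<omega> \<in> space M. \<epsilon> \<le> \<bar>empirical A n \<omega> - Psi b A (trunc K (scaled_field n \<omega>))\<bar>} \<subseteq> E1 \<union> E2"
      proof (rule ccontr)
        assume "\<not> ?thesis"
        then obtain \<omega> where \<omega>: "\<omega> \<in> space M" "\<omega> \<notin> E1" "\<omega> \<notin> E2"
          and far: "\<epsilon> \<le> \<bar>empirical A n \<omega> - Psi b A (trunc K (scaled_field n \<omega>))\<bar>" by blast
        let ?m = "level_mean L (\<lambda>v. walk_prob (n - L) ?B (path_sum (\<lambda>u. \<xi> u \<omega>) v))"
        let ?X = "scaled_field n \<omega>"
        have d1: "\<bar>empirical A n \<omega> - ?m\<bar> < \<epsilon> / 3" using \<omega> by (simp add: E1_def)
        have "\<bar>?m - Psi b A (trunc L ?X)\<bar> \<le> level_mean L (\<lambda>v. \<bar>walk_prob (n - L) ?B (path_sum (\<lambda>u. \<xi> u \<omega>) v)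
            - gauss_shift A (path_sum (\<lambda>u. \<xi> u \<omega>) v / sqrt (real n))\<bar>)"
          unfolding Psi_trunc_eq path_sum_scaled level_mean_diff[symmetric] by (rule abs_level_mean_le)
        also have "\<dots> \<le> level_mean L (\<lambda>_. \<epsilon> / 4)"
          using elim(6) by (intro level_mono_mean) (simp add: L_def)
        finally have d2: "\<bar>?m - Psi b A (trunc L ?X)\<bar> \<le> \<epsilon> / 4" by (simp add: level_mean_const)
        \<comment> \<open>Outside \<open>E2\<close> the weighted energy of each generation is at
          most \<open>y * s\<close>; removing the weight costs \<open>b powr (discount * k)\<close>,
          exactly the growth that \<open>Psi_trunc_diff_le\<close> permits.\<close>
        have en: "level_energy \<alpha> (Suc k) (trunc L ?X) \<le> real b powr (discount * real (Suc k)) * y" for k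
        proof (cases "Suc k \<le> L")
          case True
          have "(\<Sum>v\<in>level b (Suc k). weight v * \<bar>\<xi> v \<omega>\<bar> powr \<alpha>) \<le> (\<Sum>v\<in>below L. weight v * \<bar>\<xi> v \<omega>\<bar> powr \<alpha>)"
            using True weight_bounds by (intro sum_mono2 finite_below) (auto simp: below_def level_def)
          also have "\<dots> \<le> y * s" using \<omega> by (simp add: E2_def)
          finally have W: "(\<Sum>v\<in>level b (Suc k). weight v * \<bar>\<xi> v \<omega>\<bar> powr \<alpha>) \<le> y * s" .
          have "\<bar>\<xi> v \<omega>\<bar> powr \<alpha> = real b powr (discount * real (Suc k)) * (weight v * \<bar>\<xi> v \<omega>\<bar> powr \<alpha>)"
            if "v \<in> level b (Suc k)" for v
            using b unfolding weight_def length_level[OF that]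
            by (simp add: mult.assoc[symmetric] flip: powr_add)
          then have "(\<Sum>v\<in>level b (Suc k). \<bar>\<xi> v \<omega>\<bar> powr \<alpha>)
              = real b powr (discount * real (Suc k)) * (\<Sum>v\<in>level b (Suc k). weight v * \<bar>\<xi> v \<omega>\<bar> powr \<alpha>)"
            unfolding sum_distrib_left by (rule sum.cong[OF refl])
          also have "\<dots> \<le> real b powr (discount * real (Suc k)) * (y * s)"
            by (intro mult_left_mono W) simp
          finally have "(\<Sum>v\<in>level b (Suc k). \<bar>\<xi> v \<omega>\<bar> powr \<alpha>) / s \<le> real b powr (discount * real (Suc k)) * y"
            using s by (simp add: pos_divide_le_eq mult.assoc)
          moreover have "level_energy \<alpha> (Suc k) ?X = (\<Sum>v\<in>level b (Suc k). \<bar>\<xi> v \<omega>\<bar> powr \<alpha>) / s"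
            by (simp add: level_energy_def scaled_powr[OF n] s_def sum_divide_distrib)
          ultimately show ?thesis using True by (simp add: level_energy_trunc)
        qed (use y in \<open>simp add: level_energy_trunc\<close>)
        have "\<bar>Psi b A (trunc L ?X) - Psi b A (trunc K (trunc L ?X))\<bar>
            \<le> 2 * real r * (y powr (1 / \<alpha>) * decay \<alpha> discount ^ K / (1 - decay \<alpha> discount))"
          by (rule Psi_trunc_diff_le[OF A \<alpha> discount(2) trunc_in_tree_fields en])
        also have "\<dots> = C * \<rho> ^ K" by (simp add: C_def \<rho>_def)
        finally have d3: "\<bar>Psi b A (trunc L ?X) - Psi b A (trunc K ?X)\<bar> < \<epsilon> / 3"
          using K elim(1) by (simp add: trunc_trunc L_def)
        show False using far d1 d2 d3 \<epsilon> by linarith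
      qed
      have "W.prob {\<omega> \<in> space M. \<epsilon> \<le> \<bar>empirical A n \<omega> - Psi b A (trunc K (scaled_field n \<omega>))\<bar>} \<le> W.prob (E1 \<union> E2)"
        using sub E1m E2m by (intro W.finite_measure_mono) auto
      also have "\<dots> \<le> W.prob E1 + W.prob E2" by (rule measure_Un_le[OF E1m E2m])
      also have "\<dots> \<le> 3 * exp (- (c' + 1) * s)" using P1 P2 by simp
      also have "\<dots> = exp (- c' * s) * (3 * exp (- 1 * s))" by (simp add: algebra_simps flip: exp_add)
      also have "\<dots> \<le> exp (- c' * s) * 1" using elim(5) by (intro mult_left_mono) (auto simp: s_def)
      also have "\<dots> \<le> exp (- c * s)" using s by (simp add: c'_def mult_right_mono)
      finally show ?case by (simp add: s_def)
    qed
  qed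
qed

text \<open>If the empirical mass lies in \<open>F\<close> and the truncated field is a good proxy
  for it, separation keeps that field out of the sublevel set of \<open>c\<close>. Its energy on
  finitely many vertices is then large, an event for Chernoff's inequality.\<close>

lemma upper_bound:
  assumes A: "interval_union r A" and c: "c \<ge> 0" and F: "closed F"
    and large: "\<And>q. q \<in> F \<Longrightarrow> ennreal c < rate_Q b \<alpha> lam A q" and d: "0 \<le> d" "d < c"
  shows "\<forall>\<^sub>F n in sequentially. W.prob {\<omega> \<in> space M. empirical A n \<omega> \<in> F} \<le> exp (- d * real n powr (\<alpha> / 2))"
proof -
  obtain \<epsilon> where \<epsilon>: "\<epsilon> > 0" "\<And>h q. h \<in> sublevel \<alpha> lam c \<Longrightarrow> q \<in> F \<Longrightarrow> \<epsilon> \<le> \<bar>Psi b A h - q\<bar>"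
    using rate_Q_separation[OF A \<alpha> lam c F large] by blast
  obtain K where K: "\<forall>\<^sub>F n in sequentially.
    W.prob {\<omega> \<in> space M. \<epsilon> \<le> \<bar>empirical A n \<omega> - Psi b A (trunc K (scaled_field n \<omega>))\<bar>}
      \<le> exp (- c * real n powr (\<alpha> / 2))"
    using eventually_happens[OF exponential_approximation[OF A \<epsilon>(1), of c]] by auto
  \<comment> \<open>The intermediate rate leaves room on both sides: \<open>d' < c\<close> makes
    \<theta> smaller than \<open>lam\<close>, so the moment is finite, and \<open>d < d'\<close>
    absorbs the constant \<open>C\<close>.\<close>
  define d' where "d' = (c + d) / 2"
  have d': "d < d'" "d' < c" "0 < d'" using d by (auto simp: d'_def)
  define \<theta> where "\<theta> = lam * (d' / c)"
  have "0 \<le> \<theta>" "\<theta> < lam" using lam d d' by (auto simp: \<theta>_def pos_divide_less_eq)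
  have \<theta>c: "\<theta> * (c / lam) = d'" using lam d d' by (simp add: \<theta>_def)
  obtain m where m: "m \<ge> 1" "(\<integral>\<^sup>+x. ennreal (exp (\<theta> * \<bar>x\<bar> powr \<alpha>)) \<partial>\<mu>) = ennreal m"
    using exp_moment_real[OF \<open>0 \<le> \<theta>\<close> \<open>\<theta> < lam\<close>] by blast
  define C where "C = exp ((m - 1) * (\<Sum>v\<in>below K. 1))"
  have "(\<lambda>n. exp (- (c - d) * real n powr (\<alpha> / 2)) + C * exp (- (d' - d) * real n powr (\<alpha> / 2))) \<longlonglongrightarrow> 0 + C * 0"
    by (intro tendsto_intros exp_speed_tendsto_0) (use d d' in auto)
  then have "\<forall>\<^sub>F n in sequentially. exp (- (c - d) * real n powr (\<alpha> / 2)) + C * exp (- (d' - d) * real n powr (\<alpha> / 2)) < 1"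
    by (intro order_tendstoD) auto
  then show ?thesis using K eventually_gt_at_top[of 0]
  proof eventually_elim
    case (elim n)
    define s where "s = real n powr (\<alpha> / 2)"
    have s: "s > 0" using elim by (simp add: s_def)
    define E1 where "E1 = {\<omega> \<in> space M. \<epsilon> \<le> \<bar>empirical A n \<omega> - Psi b A (trunc K (scaled_field n \<omega>))\<bar>}"
    define E2 where "E2 = {\<omega> \<in> space M. c / lam * s \<le> (\<Sum>v\<in>below K. 1 * \<bar>\<xi> v \<omega>\<bar> powr \<alpha>)}"
    note [measurable] = empirical_measurable[OF scaled_image_borel[OF interval_union_borel[OF A]]] Psi_trunc_measurable[OF A]
    have E1m: "E1 \<in> W.events" unfolding E1_def by measurable
    have E2m: "E2 \<in> W.events" unfolding E2_def by measurable
    have P2: "W.prob E2 \<le> exp (- \<theta> * (c / lam * s) + (m - 1) * (\<Sum>v\<in>below K. 1))"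
      unfolding E2_def by (rule weighted_energy_tail[OF finite_below below_subset \<open>0 \<le> \<theta>\<close> m]) simp
    have "\<theta> * (c / lam * s) = d' * s" using \<theta>c by (metis mult.assoc)
    then have P2': "W.prob E2 \<le> C * exp (- d' * s)"
      using P2 by (simp add: C_def exp_add[symmetric] algebra_simps)
    have sub: "{\<omega> \<in> space M. empirical A n \<omega> \<in> F} \<subseteq> E1 \<union> E2"
    proof
      fix \<omega> assume "\<omega> \<in> {\<omega> \<in> space M. empirical A n \<omega> \<in> F}"
      then have \<omega>: "\<omega> \<in> space M" "empirical A n \<omega> \<in> F" by auto
      show "\<omega> \<in> E1 \<union> E2"
      proof (cases "trunc K (scaled_field n \<omega>) \<in> sublevel \<alpha> lam c")
        case True
        then show ?thesis using \<epsilon>(2)[OF True \<omega>(2)] \<omega> by (simp add: E1_def abs_minus_commute)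
      next
        case False
        then have "c < lam * (\<Sum>v\<in>below K. \<bar>scaled_field n \<omega> v\<bar> powr \<alpha>)"
          using trunc_in_sublevel[OF lam c, where h="scaled_field n \<omega>" and K=K] by (meson not_le)
        also have "\<dots> = lam * (\<Sum>v\<in>below K. \<bar>\<xi> v \<omega>\<bar> powr \<alpha>) / s"
          using elim(3) by (simp add: scaled_powr s_def flip: sum_divide_distrib)
        finally show ?thesis using lam s \<omega> by (simp add: E2_def field_simps)
      qed
    qed
    have "W.prob {\<omega> \<in> space M. empirical A n \<omega> \<in> F} \<le> W.prob (E1 \<union> E2)"
      using sub E1m E2m by (intro W.finite_measure_mono) auto
    also have "\<dots> \<le> W.prob E1 + W.prob E2" by (rule measure_Un_le[OF E1m E2m])
    also have "\<dots> \<le> exp (- c * s) + C * exp (- d' * s)"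
      using elim(2) P2' by (intro add_mono) (auto simp: E1_def s_def)
    also have "\<dots> = exp (- d * s) * (exp (- (c - d) * s) + C * exp (- (d' - d) * s))"
      by (simp add: distrib_left algebra_simps flip: exp_add)
    also have "\<dots> \<le> exp (- d * s) * 1" using elim(1) by (intro mult_left_mono) (auto simp: s_def)
    finally show ?case by (simp add: s_def)
  qed
qed

text \<open>Steering the displacements of the first \<open>K\<close> generations close to
  \<open>h\<close> costs at most \<open>c\<close>, up to a small error. The probability that the
  empirical mass fails to follow is of smaller exponential order and can be subtracted.\<close>

lemma lower_bound:
  assumes A: "interval_union r A" and h: "h \<in> tree_fields b" and c: "c \<ge> 0" "field_cost b \<alpha> lam h \<le> ennreal c"
    and d: "c < d" and \<rho>: "\<rho> > 0"
  shows "\<forall>\<^sub>F n in sequentially. exp (- d * real n powr (\<alpha> / 2))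
    \<le> W.prob {\<omega> \<in> space M. \<bar>empirical A n \<omega> - Psi b A h\<bar> < \<rho>}"
proof -
  have \<rho>3: "\<rho> / 3 > 0" using \<rho> by simp
  have g: "0 < min 1 \<alpha>" using \<alpha> by simp
  define C where "C = 2 * real r * ((c / lam) powr (1 / \<alpha>) / (1 - decay \<alpha> 0))"
  have "(\<lambda>K. C * decay \<alpha> 0 ^ K) \<longlonglongrightarrow> C * 0"
    using decay_bounds[OF \<alpha> g] by (intro tendsto_intros LIMSEQ_power_zero) auto
  then have "\<forall>\<^sub>F K in sequentially. C * decay \<alpha> 0 ^ K < \<rho> / 3" using \<rho>3 by (intro order_tendstoD) auto
  from eventually_happens[OF eventually_conj[OF this exponential_approximation[OF A \<rho>3, of "d + 1"]]]
  obtain K where K1: "C * decay \<alpha> 0 ^ K < \<rho> / 3"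
    and K2: "\<forall>\<^sub>F n in sequentially. W.prob {\<omega> \<in> space M. \<rho> / 3 \<le> \<bar>empirical A n \<omega> - Psi b A (trunc K (scaled_field n \<omega>))\<bar>}
      \<le> exp (- (d + 1) * real n powr (\<alpha> / 2))" by auto
  have "\<bar>Psi b A h - Psi b A (trunc K h)\<bar>
      \<le> 2 * real r * ((c / lam) powr (1 / \<alpha>) * decay \<alpha> 0 ^ K / (1 - decay \<alpha> 0))"
    by (rule Psi_trunc_diff_le[OF A \<alpha> g h level_energy_le[OF lam c]])
  then have D1: "\<bar>Psi b A h - Psi b A (trunc K h)\<bar> < \<rho> / 3" using K1 by (simp add: C_def)
  \<comment> \<open>An error \<delta> per vertex moves \<open>Psi\<close> by at most
    \<open>2 * real r * (real K * \<delta>)\<close>; the added 1 keeps the denominator positive and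
    the estimate strict.\<close>
  define \<delta> where "\<delta> = \<rho> / (3 * (2 * real r * real K + 1))"
  have \<delta>: "\<delta> > 0" using \<rho> by (simp add: \<delta>_def add_nonneg_pos)
  define z where "z = 2 * real r * real K + 1"
  have "z > 0" by (simp add: z_def add_nonneg_pos)
  then have "z * \<delta> = \<rho> / 3" unfolding \<delta>_def z_def[symmetric] by simp
  then have \<delta>': "2 * real r * (real K * \<delta>) < \<rho> / 3" using \<delta> by (simp add: z_def algebra_simps)
  \<comment> \<open>Half of the gap d - c is spent in the local bound, the other half on the
    subtraction of the failure probability.\<close>
  define \<epsilon> where "\<epsilon> = (d - c) / 2"
  have \<epsilon>: "\<epsilon> > 0" using d by (simp add: \<epsilon>_def)
  have energy: "lam * (\<Sum>v\<in>below K. \<bar>h v\<bar> powr \<alpha>) \<le> c"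
    using c(2) below_subset unfolding field_cost_le_iff[OF lam c(1)] by (meson finite_below)
  have "(\<lambda>n. exp (- \<epsilon> * real n powr (\<alpha> / 2)) + exp (- 1 * real n powr (\<alpha> / 2))) \<longlonglongrightarrow> 0 + 0"
    by (intro tendsto_intros exp_speed_tendsto_0) (use \<epsilon> in auto)
  then have "\<forall>\<^sub>F n in sequentially. exp (- \<epsilon> * real n powr (\<alpha> / 2)) + exp (- 1 * real n powr (\<alpha> / 2)) < 1"
    by (intro order_tendstoD) auto
  then show ?thesis
    using K2 local_lower_bound_tree[of "below K" \<delta> \<epsilon> h, OF finite_below below_subset \<delta> \<epsilon>] eventually_gt_at_top[of 0]
  proof eventually_elim
    case (elim n)
    define s where "s = real n powr (\<alpha> / 2)"
    have s: "s > 0" using elim by (simp add: s_def)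
    define E0 where "E0 = {\<omega> \<in> space M. \<forall>v\<in>below K. \<bar>\<xi> v \<omega> / sqrt (real n) - h v\<bar> < \<delta>}"
    define E1 where "E1 = {\<omega> \<in> space M. \<rho> / 3 \<le> \<bar>empirical A n \<omega> - Psi b A (trunc K (scaled_field n \<omega>))\<bar>}"
    define E2 where "E2 = {\<omega> \<in> space M. \<bar>empirical A n \<omega> - Psi b A h\<bar> < \<rho>}"
    note [measurable] = empirical_measurable[OF scaled_image_borel[OF interval_union_borel[OF A]]] Psi_trunc_measurable[OF A]
    have E1m: "E1 \<in> W.events" unfolding E1_def by measurable
    have E2m: "E2 \<in> W.events" unfolding E2_def by measurable
    have sub: "E0 \<subseteq> E1 \<union> E2"
    proof
      fix \<omega> assume \<omega>: "\<omega> \<in> E0"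
      have "\<bar>Psi b A (trunc K (scaled_field n \<omega>)) - Psi b A (trunc K h)\<bar> \<le> 2 * real r * (real K * \<delta>)"
        by (rule Psi_trunc_local[OF A])
          (use \<omega> \<delta> in \<open>auto simp: E0_def below_def scaled_field_def intro: less_imp_le\<close>)
      then have "\<bar>Psi b A (trunc K (scaled_field n \<omega>)) - Psi b A h\<bar> < 2 * (\<rho> / 3)"
        using D1 \<delta>' by linarith
      then have "\<rho> / 3 \<le> \<bar>empirical A n \<omega> - Psi b A (trunc K (scaled_field n \<omega>))\<bar> \<or> \<bar>empirical A n \<omega> - Psi b A h\<bar> < \<rho>"
        by linarith
      then show "\<omega> \<in> E1 \<union> E2" using \<omega> unfolding E0_def E1_def E2_def by blast
    qed
    have "exp (- (c + \<epsilon>) * s) \<le> exp (- (lam * (\<Sum>v\<in>below K. \<bar>h v\<bar> powr \<alpha>) + \<epsilon>) * s)"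
      using energy s by (simp add: mult_right_mono)
    also have "\<dots> \<le> W.prob E0" using elim(3) by (simp add: E0_def s_def)
    also have "\<dots> \<le> W.prob (E1 \<union> E2)" using sub E1m E2m by (intro W.finite_measure_mono) auto
    also have "\<dots> \<le> W.prob E1 + W.prob E2" by (rule measure_Un_le[OF E1m E2m])
    also have "W.prob E1 \<le> exp (- (d + 1) * s)" using elim(2) by (simp add: E1_def s_def)
    finally have P: "exp (- (c + \<epsilon>) * s) - exp (- (d + 1) * s) \<le> W.prob E2" by simp
    have "exp (- d * s) = exp (- (c + \<epsilon>) * s) * exp (- \<epsilon> * s)"
      by (simp add: \<epsilon>_def algebra_simps flip: exp_add)
    also have "\<dots> \<le> exp (- (c + \<epsilon>) * s) * (1 - exp (- 1 * s))"
      using elim(1) by (intro mult_left_mono) (auto simp: s_def)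
    also have "\<dots> \<le> exp (- (c + \<epsilon>) * s) - exp (- (d + 1) * s)"
    proof -
      have "(c + \<epsilon>) * s \<le> d * s" using d s by (intro mult_right_mono) (auto simp: \<epsilon>_def field_simps)
      then have "exp (- (d + 1) * s) \<le> exp (- (c + \<epsilon>) * s) * exp (- 1 * s)"
        by (simp add: algebra_simps flip: exp_add)
      then show ?thesis by (simp add: right_diff_distrib)
    qed
    also note P
    finally show ?case by (simp add: s_def E2_def)
  qed
qed


section \<open>From exponential bounds to the large deviation principle\<close>

lemma eventually_speed_pos: "\<forall>\<^sub>F n in sequentially. 0 < real n powr (\<alpha> / 2)"
  using eventually_gt_at_top[of 0] by eventually_elim simp

lemma scaled_elog_le:
  assumes "0 < s" "p \<le> exp (- d * s)"
  shows "ereal (1 / s) * elog p \<le> ereal (- d)"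
proof (cases "p \<le> 0")
  case False
  then have "ln p \<le> - d * s" using assms by (metis exp_le_cancel_iff exp_ln not_le)
  then show ?thesis using False assms(1) by (simp add: elog_def field_simps)
qed (use assms in \<open>simp add: elog_def\<close>)

lemma scaled_elog_ge:
  assumes "0 < s" "exp (- d * s) \<le> p"
  shows "ereal (- d) \<le> ereal (1 / s) * elog p"
proof -
  have p: "p > 0" using assms(2) by (rule less_le_trans[OF exp_gt_zero])
  then have "- d * s \<le> ln p" using assms by (metis exp_le_cancel_iff exp_ln)
  then show ?thesis using p assms(1) by (simp add: elog_def field_simps)
qed

lemma neg_enn2ereal_less_iff: "0 \<le> d \<Longrightarrow> - enn2ereal I < ereal (- d) \<longleftrightarrow> ennreal d < I"
  using ereal_minus_less_minus[of "enn2ereal I" "ereal d"] by (simp add: less_ennreal.rep_eq)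

lemma less_neg_enn2ereal_iff: "0 \<le> d \<Longrightarrow> ereal (- d) < - enn2ereal I \<longleftrightarrow> I < ennreal d"
  using ereal_minus_less_minus[of "ereal d" "enn2ereal I"] by (simp add: less_ennreal.rep_eq)

lemma rate_upper_bound:
  assumes A: "interval_union r A" and F: "closed F"
    and r: "r' = (\<lambda>n. ereal (1 / real n powr (\<alpha> / 2)) * elog (W.prob {\<omega> \<in> space M. empirical A n \<omega> \<in> F}))"
  shows "limsup r' \<le> - enn2ereal (INF q\<in>F. rate_Q b \<alpha> lam A q)"
proof (rule dense_ge)
  fix x assume x: "- enn2ereal (INF q\<in>F. rate_Q b \<alpha> lam A q) < x"
  \<comment> \<open>For nonnegative x it suffices that probabilities are at most 1.\<close>
  have le0: "\<forall>\<^sub>F n in sequentially. r' n \<le> ereal (- 0)"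
    using eventually_speed_pos unfolding r by eventually_elim (rule scaled_elog_le, auto)
  show "limsup r' \<le> x"
  proof (cases "x \<ge> 0")
    case True
    have "\<forall>\<^sub>F n in sequentially. r' n \<le> x" using le0
    proof eventually_elim
      case (elim n)
      then have "r' n \<le> 0" by (simp only: minus_zero zero_ereal_def)
      then show ?case using True by (rule order_trans)
    qed
    then show ?thesis by (rule Limsup_bounded)
  next
    case False
    then obtain d where d: "x = ereal (- d)" "d > 0"
      using x by (cases x) (auto intro: that[of "- _"])
    have "ennreal d < (INF q\<in>F. rate_Q b \<alpha> lam A q)"
      using x d neg_enn2ereal_less_iff[of d] by simp
    \<comment> \<open>A finite value strictly between \<open>d\<close> and the infimum exists even
      if the infimum is infinite; \<open>upper_bound\<close> needs this gap.\<close>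
    then obtain c' where c': "ennreal d < c'" "c' < (INF q\<in>F. rate_Q b \<alpha> lam A q)" using dense by blast
    then obtain c where c: "c' = ennreal c" "c \<ge> 0" by (cases c') auto
    have "d < c" using c' c d by (simp add: ennreal_less_iff)
    have "\<forall>\<^sub>F n in sequentially. W.prob {\<omega> \<in> space M. empirical A n \<omega> \<in> F} \<le> exp (- d * real n powr (\<alpha> / 2))"
      by (rule upper_bound[OF A c(2) F]) (use c' c d \<open>d < c\<close> in \<open>auto intro: less_le_trans INF_lower\<close>)
    then have "\<forall>\<^sub>F n in sequentially. r' n \<le> x"
      using eventually_speed_pos unfolding r d(1) by eventually_elim (rule scaled_elog_le)
    then show ?thesis by (rule Limsup_bounded)
  qed
qed

text \<open>A cheap point q of the relative interior has a field \<open>h\<close> attaining its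
  rate. Empirical masses always lie in [0,1], so staying near q within [0,1] is enough to remain in
  \<open>\<Gamma>\<close>.\<close>

lemma rate_lower_bound:
  assumes A: "interval_union r A" and \<Gamma>: "\<Gamma> \<in> sets borel" "\<Gamma> \<subseteq> {0..1}"
    and r: "r' = (\<lambda>n. ereal (1 / real n powr (\<alpha> / 2)) * elog (W.prob {\<omega> \<in> space M. empirical A n \<omega> \<in> \<Gamma>}))"
  shows "- enn2ereal (INF q\<in>top_of_set {0..1} interior_of \<Gamma>. rate_Q b \<alpha> lam A q) \<le> liminf r'"
proof (rule dense_le)
  fix x assume x: "x < - enn2ereal (INF q\<in>top_of_set {0..1} interior_of \<Gamma>. rate_Q b \<alpha> lam A q)"
  then have "x < 0" by (rule less_le_trans) simp
  then consider "x = - \<infinity>" | d where "x = ereal (- d)" "d > 0"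
    by (cases x) (auto intro: that(2)[of "- _"])
  then show "x \<le> liminf r'"
  proof cases
    case (2 d)
    then have "(INF q\<in>top_of_set {0..1} interior_of \<Gamma>. rate_Q b \<alpha> lam A q) < ennreal d"
      using x less_neg_enn2ereal_iff[of d] by simp
    then obtain q where q: "q \<in> top_of_set {0..1} interior_of \<Gamma>" "rate_Q b \<alpha> lam A q < ennreal d"
      by (auto simp: INF_less_iff)
    then have "rate_Q b \<alpha> lam A q < \<infinity>" by (auto intro: less_trans)
    then obtain h where h: "h \<in> tree_fields b" "Psi b A h = q" "field_cost b \<alpha> lam h = rate_Q b \<alpha> lam A q"
      by (rule rate_Q_attained[OF A \<alpha> lam])
    obtain c where c: "field_cost b \<alpha> lam h = ennreal c" "c \<ge> 0"
    proof (cases "field_cost b \<alpha> lam h")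
      case (real c)
      then show ?thesis by (intro that)
    qed (use q h in simp)
    have cd: "c < d" using c q h by (simp add: ennreal_less_iff)
    obtain U where U: "open U" "q \<in> U" "{0..1} \<inter> U \<subseteq> \<Gamma>"
      using q(1) by (auto simp: interior_of_def openin_open)
    obtain \<rho> where \<rho>: "\<rho> > 0" "ball q \<rho> \<subseteq> U" using U openE by blast
    have "\<forall>\<^sub>F n in sequentially. exp (- d * real n powr (\<alpha> / 2))
      \<le> W.prob {\<omega> \<in> space M. \<bar>empirical A n \<omega> - Psi b A h\<bar> < \<rho>}"
      by (rule lower_bound[OF A h(1) c(2) _ cd \<rho>(1)]) (simp add: c)
    then have "\<forall>\<^sub>F n in sequentially. x \<le> r' n"
      using eventually_speed_pos unfolding r 2(1)
    proof eventually_elim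
      case (elim n)
      have "{\<omega> \<in> space M. \<bar>empirical A n \<omega> - Psi b A h\<bar> < \<rho>} \<subseteq> {\<omega> \<in> space M. empirical A n \<omega> \<in> \<Gamma>}"
      proof clarify
        fix \<omega> assume "\<bar>empirical A n \<omega> - Psi b A h\<bar> < \<rho>"
        then have "empirical A n \<omega> \<in> U"
          using \<rho>(2) h(2) by (auto simp: dist_real_def abs_minus_commute)
        then show "empirical A n \<omega> \<in> \<Gamma>" using U(3) empirical_range by blast
      qed
      moreover have "{\<omega> \<in> space M. empirical A n \<omega> \<in> \<Gamma>} \<in> W.events"
        using measurable_sets[OF empirical_measurable[OF scaled_image_borel[OF interval_union_borel[OF A]]] \<Gamma>(1)]
        by (simp add: vimage_def Int_def conj_commute)
      ultimately have "W.prob {\<omega> \<in> space M. \<bar>empirical A n \<omega> - Psi b A h\<bar> < \<rho>}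
          \<le> W.prob {\<omega> \<in> space M. empirical A n \<omega> \<in> \<Gamma>}" by (rule W.finite_measure_mono)
      then show ?case using elim by (intro scaled_elog_ge) auto
    qed
    then show ?thesis by (rule Liminf_bounded)
  qed simp
qed

theorem LDP_empirical:
  assumes A: "interval_union r A"
  shows "LDP_on {0..1} M (\<lambda>n \<omega>. empirical A n \<omega>) (\<lambda>n. real n powr (\<alpha> / 2)) (rate_Q b \<alpha> lam A)"
  unfolding LDP_on_def Let_def
proof (intro ballI impI conjI)
  fix \<Gamma> :: "real set" assume \<Gamma>: "\<Gamma> \<in> sets borel" "\<Gamma> \<subseteq> {0..1}"
  let ?r = "\<lambda>B n. ereal (1 / real n powr (\<alpha> / 2)) * elog (W.prob {\<omega> \<in> space M. empirical A n \<omega> \<in> B})"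
  show "- enn2ereal (INF q\<in>top_of_set {0..1} interior_of \<Gamma>. rate_Q b \<alpha> lam A q) \<le> liminf (?r \<Gamma>)"
    by (rule rate_lower_bound[OF A \<Gamma> refl])
  show "liminf (?r \<Gamma>) \<le> limsup (?r \<Gamma>)" by (rule Liminf_le_Limsup) simp
  \<comment> \<open>The interval [0,1] is closed, so the relative closure is the closure in the
    line, and the upper bound for closed sets applies.\<close>
  have cl: "top_of_set {0..1} closure_of \<Gamma> = closure \<Gamma>"
  proof -
    have "closure \<Gamma> \<subseteq> {0..1}" using \<Gamma>(2) by (rule closure_minimal) simp
    then show ?thesis using \<Gamma>(2) by (auto simp: closure_of_subtopology inf.absorb2)
  qed
  have "limsup (?r \<Gamma>) \<le> limsup (?r (closure \<Gamma>))"
  proof (rule Limsup_mono, rule always_eventually, rule allI)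
    fix n
    have "{\<omega> \<in> space M. empirical A n \<omega> \<in> closure \<Gamma>} \<in> W.events"
      using measurable_sets[OF empirical_measurable[OF scaled_image_borel[OF interval_union_borel[OF A]]], of "closure \<Gamma>"]
      by (simp add: vimage_def Int_def conj_commute)
    then have "W.prob {\<omega> \<in> space M. empirical A n \<omega> \<in> \<Gamma>} \<le> W.prob {\<omega> \<in> space M. empirical A n \<omega> \<in> closure \<Gamma>}"
      using closure_subset by (intro W.finite_measure_mono) auto
    then have "elog (W.prob {\<omega> \<in> space M. empirical A n \<omega> \<in> \<Gamma>}) \<le> elog (W.prob {\<omega> \<in> space M. empirical A n \<omega> \<in> closure \<Gamma>})"
      by (auto simp: elog_def)
    then show "?r \<Gamma> n \<le> ?r (closure \<Gamma>) n" by (intro ereal_mult_left_mono) auto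
  qed
  also have "\<dots> \<le> - enn2ereal (INF q\<in>closure \<Gamma>. rate_Q b \<alpha> lam A q)"
    by (rule rate_upper_bound[OF A closed_closure refl])
  finally show "limsup (?r \<Gamma>) \<le> - enn2ereal (INF q\<in>top_of_set {0..1} closure_of \<Gamma>. rate_Q b \<alpha> lam A q)"
    by (simp add: cl)
qed

end

theorem theorem1p1:
  fixes b :: nat and \<alpha> lam :: real
    and N :: "'x measure" and X :: "'x \<Rightarrow> real"
    and M :: "'w measure" and \<xi> :: "nat list \<Rightarrow> 'w \<Rightarrow> real"
    and A :: "real set" and r :: nat and J :: "nat \<Rightarrow> real set" and lo hi :: "nat \<Rightarrow> ereal"
  assumes b: "b \<ge> 2" and \<alpha>: "\<alpha> > 0" and lam: "lam > 0"
    and N: "prob_space N" and X: "X \<in> borel_measurable N"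
    and symmetric: "distr N borel (\<lambda>x. - X x) = distr N borel X"
    and mean: "integrable N X" "prob_space.expectation N X = 0"
    and second_moment: "prob_space.expectation N (\<lambda>x. (X x)\<^sup>2) = 1"
    and tail: "((\<lambda>t::real. ereal (t powr (- \<alpha>)) * elog (measure N {x \<in> space N. X x > t}))
                 \<longlongrightarrow> ereal (- lam)) at_top"
    and M: "prob_space M"
    and displacements: "iid_copies M (tree b - {[]}) \<xi> N X"
    and A_nontrivial: "A \<notin> {{}, UNIV}"
    and r: "r \<ge> 1" and A_eq: "A = (\<Union>j<r. J j)"
    and disjoint: "disjoint_family_on J {..<r}"
    and intervals: "\<And>j. j < r \<Longrightarrow> lo j < hi j \<and> interval_with_endpoints (lo j) (hi j) (J j)"
  shows "good_rate_function_on {0..1} (rate_Q b \<alpha> lam A)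
    \<and> LDP_on {0..1} M (\<lambda>n \<omega>. brw_empirical b \<xi> n \<omega> ((\<lambda>a. sqrt (real n) * a) ` A))
        (\<lambda>n. real n powr (\<alpha> / 2)) (rate_Q b \<alpha> lam A)
    \<and> (\<forall>q\<in>{0..1}. rate_Q b \<alpha> lam A q < \<infinity> \<longrightarrow>
         (\<exists>h\<in>tree_fields b. Psi b A h = q \<and> field_cost b \<alpha> lam h = rate_Q b \<alpha> lam A q))"
proof -
  define \<mu> where "\<mu> = distr N borel X"
  interpret N: prob_space N by (rule N)
  interpret M: prob_space M by (rule M)
  interpret \<mu>: real_distribution \<mu> unfolding \<mu>_def using X by (rule N.real_distribution_distr)
  have A: "interval_union r A"
    unfolding interval_union_def
    using A_eq disjoint intervals interval_with_endpoints_is_interval by blast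
  have sym: "distr \<mu> borel uminus = \<mu>"
    unfolding \<mu>_def symmetric[symmetric] using X by (subst distr_distr) (auto simp: comp_def symmetric)
  have "measure \<mu> {t<..} = measure N {x \<in> space N. X x > t}" for t
    unfolding \<mu>_def using X by (subst measure_distr) (auto simp: vimage_def Int_def conj_commute)
  then have tl: "((\<lambda>t. ereal (t powr (- \<alpha>)) * elog (measure \<mu> {t<..})) \<longlongrightarrow> ereal (- lam)) at_top"
    using tail by simp
  \<comment> \<open>The integral of a non-integrable function is 0 by convention, so the value 1
    entails integrability.\<close>
  have "integrable N (\<lambda>x. (X x)\<^sup>2)"
    using second_moment not_integrable_integral_eq[of N "\<lambda>x. (X x)\<^sup>2"] by fastforce
  then have var: "integrable \<mu> (\<lambda>x. x\<^sup>2)" "(\<integral>x. x\<^sup>2 \<partial>\<mu>) = 1"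
    unfolding \<mu>_def using X second_moment by (simp_all add: integrable_distr_eq integral_distr)
  have mn: "(\<integral>x. x \<partial>\<mu>) = 0"
    unfolding \<mu>_def using X mean by (simp add: integral_distr)
  interpret branching_walk b \<mu> \<alpha> lam M \<xi>
    by unfold_locales
      (use b \<alpha> lam sym tl var mn displacements in \<open>auto simp: iid_copies_def \<mu>_def\<close>)
  show ?thesis
  proof (intro conjI ballI impI)
    fix q assume "rate_Q b \<alpha> lam A q < \<infinity>"
    then obtain h where "h \<in> tree_fields b" "Psi b A h = q" "field_cost b \<alpha> lam h = rate_Q b \<alpha> lam A q"
      by (rule rate_Q_attained[OF A \<alpha> lam])
    then show "\<exists>h\<in>tree_fields b. Psi b A h = q \<and> field_cost b \<alpha> lam h = rate_Q b \<alpha> lam A q" by blast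
  qed (rule good_rate_Q[OF A \<alpha> lam] LDP_empirical[OF A])+
qed

end
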